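(* Consider strategies $\sigma : A \stackrel{S}{\to} B$ and $\tau : B \stackrel{T}{\to} C$ that do not deadlock, and assume that $B$ is representable. Then for all symmetry classes $\mathsf{x}_A \in \mathscr{C}(A)/{\cong_A}$ and $\mathsf{x}_C \in \mathscr{C}(C)/{\cong_C}$, \[ (\mathrm{coll}(\tau \odot \sigma))_{\mathsf{x}_A, \mathsf{x}_C} = \sum_{\mathsf{x}_B \in \mathscr{C}(B)/{\cong_B}} (\mathrm{coll}\, \sigma)_{\mathsf{x}_A, \mathsf{x}_B} \cdot (\mathrm{coll}\, \tau)_{\mathsf{x}_B, \mathsf{x}_C}\,, \] where the sum is computed in $\overline{\mathbb{N}} = \mathbb{N} \cup \{+\infty\}$.
   Context: Setting: thin concurrent games (tcgs) and $\sim$-strategies in the sense of Castellan–Clairambault–Winskel. A tcg $A$ has a symmetry $\cong_A$ (bijections between configurations) with positive and negative sub-symmetries $\cong_A^+$, $\cong_A^-$. $\mathscr{C}(A)$ is the set of configurations of $A$ and $\mathscr{C}(A)/{\cong_A}$ the set of symmetry classes (metavariables $\mathsf{x}, \mathsf{y}$). A strategy $\sigma : A \stackrel{S}{\to} B$ is a $\sim$-strategy $\sigma : S \to A^\perp \parallel B$; for $x^S \in \mathscr{C}(S)$ write $\sigma x^S = x^S_A \parallel x^S_B$. A configuration of $S$ is $+$-covered if all its maximal events are positive; $\mathscr{C}^+(S)$ denotes the set of $+$-covered configurations. The composition $\tau\odot\sigma : A \stackrel{T\odot S}{\to} C$ is the usual composition of $\sim$-strategies (interaction followed by hiding of $B$).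 A configuration $x \in \mathscr{C}(A)$ is canonical if every endosymmetry $\theta : x \cong_A x$ factors uniquely as $\theta_+ \circ \theta_-$ with $\theta_- : x \cong_A^- x$ and $\theta_+ : x \cong_A^+ x$ (i.e. with $x$ itself in the middle). $A$ is representable if every symmetry class $\mathsf{x}$ contains a canonical configuration; for each tcg and each class $\mathsf{x}$ one fixes once and for all a canonical representative $\underline{\mathsf{x}} \in \mathsf{x}$ (games $A$, $C$ are also assumed representable so that these choices exist). Witnesses: $\mathsf{wit}^+_\sigma(\mathsf{x}_A,\mathsf{x}_B) = \{x^S \in \mathscr{C}^+(S) \mid x^S_A \cong_A^- \underline{\mathsf{x}}_A ~\&~ x^S_B \cong_B^+ \underline{\mathsf{x}}_B\}$, and the weighted collapse is $(\mathrm{coll}\,\sigma)_{\mathsf{x}_A,\mathsf{x}_B} = |\mathsf{wit}^+_\sigma(\mathsf{x}_A,\mathsf{x}_B)| \in \overline{\mathbb{N}}$ (cardinal, $+\infty$ if infinite). $\sigma$ and $\tau$ do not deadlock iff for all $x^S \in \mathscr{C}(S)$, $x^T \in \mathscr{C}(T)$ and every symmetry $\theta_B : x^S_B \cong_B x^T_B$, the composite bijection $x^S \parallel x^T_C \simeq x^S_A \parallel x^S_B \parallel x^T_C \simeq x^S_A \parallel x^T_B \parallel x^T_C \simeq x^S_A \parallel x^T$ (via $\sigma$, then $\theta_B$, then $\tau^{-1}$) is secured. *)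

theory Defs
  imports "HOL-Analysis.Infinite_Sum"
begin

section \<open>Event structures with symmetry and polarity\<close>

record 'a es =
  events :: "'a set"
  causal :: "('a \<times> 'a) set"
  consis :: "'a set set"

definition event_structure :: "('a, 'm) es_scheme \<Rightarrow> bool" where
  "event_structure E \<longleftrightarrow>
     partial_order_on (events E) (causal E) \<and>
     (\<forall>e\<in>events E. finite {e'. (e', e) \<in> causal E}) \<and>
     consis E \<noteq> {} \<and>
     (\<forall>X\<in>consis E. finite X \<and> X \<subseteq> events E) \<and>
     (\<forall>e\<in>events E. {e} \<in> consis E) \<and>
     (\<forall>X\<in>consis E. \<forall>Y\<subseteq>X. Y \<in> consis E) \<and>
     (\<forall>X\<in>consis E. \<forall>e'\<in>X. \<forall>e. (e, e') \<in> causal E \<longrightarrow> insert e X \<in> consis E)"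

text \<open>Configurations are finite, since consistent sets are.\<close>

definition conf :: "('a, 'm) es_scheme \<Rightarrow> 'a set set" where
  "conf E = {x \<in> consis E. \<forall>e\<in>x. \<forall>e'. (e', e) \<in> causal E \<longrightarrow> e' \<in> x}"

definition strict :: "('a \<times> 'a) set \<Rightarrow> ('a \<times> 'a) set" where
  "strict r = r - Id"

definition immediate :: "('a, 'm) es_scheme \<Rightarrow> ('a \<times> 'a) set" where
  "immediate E = {(e, e') \<in> strict (causal E).
     \<nexists>d. (e, d) \<in> strict (causal E) \<and> (d, e') \<in> strict (causal E)}"

definition down :: "('a, 'm) es_scheme \<Rightarrow> 'a set \<Rightarrow> 'a set" where
  "down E x = {e'. \<exists>e\<in>x. (e', e) \<in> causal E}"

text \<open>
  A bijection \<open>\<theta> : x \<simeq> y\<close> is represented by its graph, so that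
  \<open>x = Domain \<theta>\<close> and \<open>y = Range \<theta>\<close>. Composition in diagrammatic order is
  relational composition, and the action of a map \<open>f\<close> on a bijection is the
  image under \<open>map_prod f f\<close>.
\<close>

definition conf_bij :: "('a, 'm) es_scheme \<Rightarrow> ('a \<times> 'a) set \<Rightarrow> bool" where
  "conf_bij E \<theta> \<longleftrightarrow> single_valued \<theta> \<and> single_valued (\<theta>\<inverse>) \<and>
     Domain \<theta> \<in> conf E \<and> Range \<theta> \<in> conf E"

definition iso_family :: "('a, 'm) es_scheme \<Rightarrow> ('a \<times> 'a) set set \<Rightarrow> bool" where
  "iso_family E \<Theta> \<longleftrightarrow>
     (\<forall>\<theta>\<in>\<Theta>. conf_bij E \<theta>) \<and>
     (\<forall>x\<in>conf E. Id_on x \<in> \<Theta>) \<and>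
     (\<forall>\<theta>\<in>\<Theta>. \<theta>\<inverse> \<in> \<Theta>) \<and>
     (\<forall>\<theta>\<in>\<Theta>. \<forall>\<theta>'\<in>\<Theta>. Range \<theta> = Domain \<theta>' \<longrightarrow> \<theta> O \<theta>' \<in> \<Theta>) \<and>
     (\<forall>\<theta>\<in>\<Theta>. \<forall>x'\<in>conf E. x' \<subseteq> Domain \<theta> \<longrightarrow> \<theta> \<inter> (x' \<times> UNIV) \<in> \<Theta>) \<and>
     (\<forall>\<theta>\<in>\<Theta>. \<forall>x'\<in>conf E. Domain \<theta> \<subseteq> x' \<longrightarrow>
        (\<exists>\<theta>'\<in>\<Theta>. \<theta> \<subseteq> \<theta>' \<and> Domain \<theta>' = x'))"

text \<open>\<open>related_by \<Theta> x y\<close> says that some bijection of the family \<open>\<Theta>\<close> goes from \<open>x\<close> to \<open>y\<close>.\<close>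

definition related_by :: "('a \<times> 'a) set set \<Rightarrow> 'a set \<Rightarrow> 'a set \<Rightarrow> bool" where
  "related_by \<Theta> x y \<longleftrightarrow> (\<exists>\<theta>\<in>\<Theta>. Domain \<theta> = x \<and> Range \<theta> = y)"

record 'a ess = "'a es" +
  symm :: "('a \<times> 'a) set set"

datatype polarity = Neg | Pos

primrec flip :: "polarity \<Rightarrow> polarity" where
  "flip Neg = Pos"
| "flip Pos = Neg"

record 'a essp = "'a ess" +
  pol :: "'a \<Rightarrow> polarity"

definition ess_with_polarity :: "('a, 'm) essp_scheme \<Rightarrow> bool" where
  "ess_with_polarity E \<longleftrightarrow>
     event_structure E \<and> iso_family E (symm E) \<and>
     (\<forall>\<theta>\<in>symm E. \<forall>(e, e')\<in>\<theta>. pol E e = pol E e')"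

section \<open>Thin concurrent games\<close>

record 'a tcg = "'a essp" +
  symm_neg :: "('a \<times> 'a) set set"
  symm_pos :: "('a \<times> 'a) set set"

definition thin_concurrent_game :: "'a tcg \<Rightarrow> bool" where
  "thin_concurrent_game A \<longleftrightarrow>
     ess_with_polarity A \<and>
     iso_family A (symm_neg A) \<and> symm_neg A \<subseteq> symm A \<and>
     iso_family A (symm_pos A) \<and> symm_pos A \<subseteq> symm A \<and>
     (\<forall>\<theta>\<in>symm_neg A \<inter> symm_pos A. \<theta> \<subseteq> Id) \<and>
     (\<forall>\<theta>\<in>symm_neg A. \<forall>\<theta>'\<in>symm A.
        \<theta> \<subseteq> \<theta>' \<and> (\<forall>(a, a')\<in>\<theta>' - \<theta>. pol A a = Neg) \<longrightarrow> \<theta>' \<in> symm_neg A) \<and>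
     (\<forall>\<theta>\<in>symm_pos A. \<forall>\<theta>'\<in>symm A.
        \<theta> \<subseteq> \<theta>' \<and> (\<forall>(a, a')\<in>\<theta>' - \<theta>. pol A a = Pos) \<longrightarrow> \<theta>' \<in> symm_pos A)"

definition symm_classes :: "'a tcg \<Rightarrow> 'a set set set" where
  "symm_classes A = conf A // {(x, y). related_by (symm A) x y}"

text \<open>
  \<open>\<theta>n O \<theta>p\<close> is \<open>\<theta>p \<circ> \<theta>n\<close>: the negative symmetry is applied first.
\<close>

definition canonical :: "'a tcg \<Rightarrow> 'a set \<Rightarrow> bool" where
  "canonical A x \<longleftrightarrow> x \<in> conf A \<and>
     (\<forall>\<theta>\<in>symm A. Domain \<theta> = x \<and> Range \<theta> = x \<longrightarrow>
        (\<exists>!p. fst p \<in> symm_neg A \<and> Domain (fst p) = x \<and> Range (fst p) = x \<and>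
              snd p \<in> symm_pos A \<and> Domain (snd p) = x \<and> Range (snd p) = x \<and>
              \<theta> = fst p O snd p))"

definition representable :: "'a tcg \<Rightarrow> bool" where
  "representable A \<longleftrightarrow> (\<forall>X\<in>symm_classes A. \<exists>x\<in>X. canonical A x)"

definition canonical_choice :: "'a tcg \<Rightarrow> ('a set set \<Rightarrow> 'a set) \<Rightarrow> bool" where
  "canonical_choice A r \<longleftrightarrow> (\<forall>X\<in>symm_classes A. r X \<in> X \<and> canonical A (r X))"

section \<open>Parallel composition and strategies\<close>

definition rel_par :: "('a \<times> 'a) set \<Rightarrow> ('b \<times> 'b) set \<Rightarrow> (('a + 'b) \<times> ('a + 'b)) set" where
  "rel_par r s = map_prod Inl Inl ` r \<union> map_prod Inr Inr ` s"

definition par :: "('a, 'm) ess_scheme \<Rightarrow> ('b, 'n) ess_scheme \<Rightarrow> ('a + 'b) ess"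
    (infixr \<open>\<parallel>\<close> 65) where
  "A \<parallel> B =
     \<lparr>events = events A <+> events B,
      causal = rel_par (causal A) (causal B),
      consis = {x <+> y | x y. x \<in> consis A \<and> y \<in> consis B},
      symm = {rel_par \<theta> \<theta>' | \<theta> \<theta>'. \<theta> \<in> symm A \<and> \<theta>' \<in> symm B}\<rparr>"

text \<open>
  The game \<open>A\<^sup>\<bottom> \<parallel> B\<close> in which a strategy from \<open>A\<close> to \<open>B\<close> is played. Its positive and
  negative sub-symmetries play no role in the definition of a strategy.
\<close>

definition arrow_game :: "'a tcg \<Rightarrow> 'b tcg \<Rightarrow> ('a + 'b) essp" where
  "arrow_game A B =
     \<lparr>events = events (A \<parallel> B), causal = causal (A \<parallel> B),
      consis = consis (A \<parallel> B), symm = symm (A \<parallel> B),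
      pol = case_sum (flip \<circ> pol A) (pol B)\<rparr>"

text \<open>A strategy consists of an event structure \<open>S\<close> and a labelling map \<open>\<sigma>\<close> to the game.\<close>

record ('s, 'a) strat =
  supp :: "'s essp"
  disp :: "'s \<Rightarrow> 'a"

definition is_map :: "('s, 'm) essp_scheme \<Rightarrow> ('a, 'n) essp_scheme \<Rightarrow> ('s \<Rightarrow> 'a) \<Rightarrow> bool" where
  "is_map S G f \<longleftrightarrow>
     f ` events S \<subseteq> events G \<and>
     (\<forall>x\<in>conf S. f ` x \<in> conf G \<and> inj_on f x) \<and>
     (\<forall>\<theta>\<in>symm S. map_prod f f ` \<theta> \<in> symm G) \<and>
     (\<forall>s\<in>events S. pol G (f s) = pol S s)"

definition receptive :: "('s, 'm) essp_scheme \<Rightarrow> ('a, 'n) essp_scheme \<Rightarrow> ('s \<Rightarrow> 'a) \<Rightarrow> bool" where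
  "receptive S G f \<longleftrightarrow>
     (\<forall>x\<in>conf S. \<forall>a. a \<notin> f ` x \<and> insert a (f ` x) \<in> conf G \<and> pol G a = Neg \<longrightarrow>
        (\<exists>!s. insert s x \<in> conf S \<and> f s = a))"

definition sim_receptive :: "('s, 'm) essp_scheme \<Rightarrow> ('a, 'n) essp_scheme \<Rightarrow> ('s \<Rightarrow> 'a) \<Rightarrow> bool" where
  "sim_receptive S G f \<longleftrightarrow>
     (\<forall>\<theta>\<in>symm S. \<forall>a a'. a \<notin> f ` Domain \<theta> \<and>
        insert (a, a') (map_prod f f ` \<theta>) \<in> symm G \<and> pol G a = Neg \<and> pol G a' = Neg \<longrightarrow>
        (\<exists>!p. insert p \<theta> \<in> symm S \<and> map_prod f f p = (a, a')))"

definition courteous :: "('s, 'm) essp_scheme \<Rightarrow> ('a, 'n) essp_scheme \<Rightarrow> ('s \<Rightarrow> 'a) \<Rightarrow> bool" where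
  "courteous S G f \<longleftrightarrow>
     (\<forall>(s, s')\<in>immediate S. pol S s = Pos \<or> pol S s' = Neg \<longrightarrow> (f s, f s') \<in> immediate G)"

definition thin :: "('s, 'm) essp_scheme \<Rightarrow> bool" where
  "thin S \<longleftrightarrow>
     (\<forall>x\<in>conf S. \<forall>s s'. s \<notin> x \<and> pol S s = Pos \<and> insert (s, s') (Id_on x) \<in> symm S \<longrightarrow> s = s')"

definition sim_strategy :: "'a tcg \<Rightarrow> 'b tcg \<Rightarrow> ('s, 'a + 'b) strat \<Rightarrow> bool" where
  "sim_strategy A B \<sigma> \<longleftrightarrow>
     ess_with_polarity (supp \<sigma>) \<and>
     is_map (supp \<sigma>) (arrow_game A B) (disp \<sigma>) \<and>
     receptive (supp \<sigma>) (arrow_game A B) (disp \<sigma>) \<and>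
     sim_receptive (supp \<sigma>) (arrow_game A B) (disp \<sigma>) \<and>
     courteous (supp \<sigma>) (arrow_game A B) (disp \<sigma>) \<and>
     thin (supp \<sigma>)"

text \<open>The two components of the display \<open>\<sigma> x = x\<^sub>A \<parallel> x\<^sub>B\<close> of a configuration.\<close>

definition left :: "('s, 'a + 'b) strat \<Rightarrow> 's set \<Rightarrow> 'a set" where
  "left \<sigma> x = Inl -` (disp \<sigma> ` x)"

definition right :: "('s, 'a + 'b) strat \<Rightarrow> 's set \<Rightarrow> 'b set" where
  "right \<sigma> x = Inr -` (disp \<sigma> ` x)"

section \<open>Secured bijections, interaction, and hiding\<close>

text \<open>
  The causality generated on (the graph of) a bijection \<open>\<phi>\<close> by the causal orders on its
  two sides; \<open>\<phi>\<close> is secured when it is acyclic.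
\<close>

definition bij_causal ::
  "('d, 'm) es_scheme \<Rightarrow> ('e, 'n) es_scheme \<Rightarrow> ('d \<times> 'e) set \<Rightarrow> (('d \<times> 'e) \<times> ('d \<times> 'e)) set" where
  "bij_causal D E \<phi> = {((d, e), (d', e')). (d, e) \<in> \<phi> \<and> (d', e') \<in> \<phi> \<and>
     ((d, d') \<in> strict (causal D) \<or> (e, e') \<in> strict (causal E))}"

definition secured :: "('d, 'm) es_scheme \<Rightarrow> ('e, 'n) es_scheme \<Rightarrow> ('d \<times> 'e) set \<Rightarrow> bool" where
  "secured D E \<phi> \<longleftrightarrow> single_valued \<phi> \<and> single_valued (\<phi>\<inverse>) \<and> acyclic (bij_causal D E \<phi>)"

text \<open>The composite bijection \<open>x \<simeq> f x \<simeq> g y \<simeq> y\<close> whose middle component is \<open>\<theta>\<close>.\<close>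

definition bij_via ::
  "('d \<Rightarrow> 'g) \<Rightarrow> ('e \<Rightarrow> 'g) \<Rightarrow> ('g \<times> 'g) set \<Rightarrow> 'd set \<Rightarrow> 'e set \<Rightarrow> ('d \<times> 'e) set" where
  "bij_via f g \<theta> x y = {(d, e). d \<in> x \<and> e \<in> y \<and> (f d, g e) \<in> \<theta>}"

text \<open>
  The pullback of two maps of event structures with symmetry \<open>f\<close> and \<open>g\<close> into a common
  target. Its finite configurations correspond to the secured bijections \<open>x \<simeq> f x = g y \<simeq> y\<close>;
  its events are those with a greatest element, which determines the two projections.
\<close>

definition sync_states ::
  "('d, 'm) es_scheme \<Rightarrow> ('e, 'n) es_scheme \<Rightarrow> ('d \<Rightarrow> 'g) \<Rightarrow> ('e \<Rightarrow> 'g) \<Rightarrow> ('d \<times> 'e) set set" where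
  "sync_states D E f g = {bij_via f g Id x y | x y.
     x \<in> conf D \<and> y \<in> conf E \<and> f ` x = g ` y \<and> secured D E (bij_via f g Id x y)}"

definition is_top ::
  "('d, 'm) es_scheme \<Rightarrow> ('e, 'n) es_scheme \<Rightarrow> ('d \<times> 'e) set \<Rightarrow> 'd \<times> 'e \<Rightarrow> bool" where
  "is_top D E \<phi> p \<longleftrightarrow> p \<in> \<phi> \<and> (\<forall>q\<in>\<phi>. (q, p) \<in> (bij_causal D E \<phi>)\<^sup>*)"

definition top_pair ::
  "('d, 'm) es_scheme \<Rightarrow> ('e, 'n) es_scheme \<Rightarrow> ('d \<times> 'e) set \<Rightarrow> 'd \<times> 'e" where
  "top_pair D E \<phi> = (THE p. is_top D E \<phi> p)"

definition pullback_es ::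
  "('d, 'm) es_scheme \<Rightarrow> ('e, 'n) es_scheme \<Rightarrow> ('d \<Rightarrow> 'g) \<Rightarrow> ('e \<Rightarrow> 'g) \<Rightarrow> ('d \<times> 'e) set es" where
  "pullback_es D E f g =
     (let P = {\<phi> \<in> sync_states D E f g. \<exists>p. is_top D E \<phi> p} in
      \<lparr>events = P,
       causal = {(\<phi>, \<psi>). \<phi> \<in> P \<and> \<psi> \<in> P \<and> \<phi> \<subseteq> \<psi>},
       consis = {X. finite X \<and> X \<subseteq> P \<and> \<Union>X \<in> sync_states D E f g}\<rparr>)"

definition pullback ::
  "('d, 'm) ess_scheme \<Rightarrow> ('e, 'n) ess_scheme \<Rightarrow> ('d \<Rightarrow> 'g) \<Rightarrow> ('e \<Rightarrow> 'g) \<Rightarrow> ('d \<times> 'e) set ess" where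
  "pullback D E f g =
     (let P = pullback_es D E f g; p1 = fst \<circ> top_pair D E; p2 = snd \<circ> top_pair D E in
      \<lparr>events = events P, causal = causal P, consis = consis P,
       symm = {\<theta>. conf_bij P \<theta> \<and> map_prod p1 p1 ` \<theta> \<in> symm D \<and> map_prod p2 p2 ` \<theta> \<in> symm E}\<rparr>)"

text \<open>The projection of an event structure with symmetry to a set \<open>V\<close> of visible events.\<close>

definition hide_es :: "('e, 'm) es_scheme \<Rightarrow> 'e set \<Rightarrow> 'e es" where
  "hide_es E V =
     \<lparr>events = events E \<inter> V, causal = causal E \<inter> (V \<times> V), consis = {X \<in> consis E. X \<subseteq> V}\<rparr>"

definition hide :: "('e, 'm) ess_scheme \<Rightarrow> 'e set \<Rightarrow> 'e ess" where
  "hide E V =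
     (let H = hide_es E V in
      \<lparr>events = events H, causal = causal H, consis = consis H,
       symm = {\<theta>. conf_bij H \<theta> \<and>
         (\<exists>\<theta>'\<in>symm E. \<theta> \<subseteq> \<theta>' \<and> Domain \<theta>' = down E (Domain \<theta>) \<and> Range \<theta>' = down E (Range \<theta>))}\<rparr>)"

section \<open>Composition of strategies\<close>

text \<open>The maps \<open>\<sigma> \<parallel> C : S \<parallel> C \<rightarrow> A \<parallel> B \<parallel> C\<close> and \<open>A \<parallel> \<tau> : A \<parallel> T \<rightarrow> A \<parallel> B \<parallel> C\<close>.\<close>

fun sum_assoc :: "('a + 'b) + 'c \<Rightarrow> 'a + ('b + 'c)" where
  "sum_assoc (Inl (Inl a)) = Inl a"
| "sum_assoc (Inl (Inr b)) = Inr (Inl b)"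
| "sum_assoc (Inr c) = Inr (Inr c)"

definition disp_par_id :: "('s, 'a + 'b) strat \<Rightarrow> 's + 'c \<Rightarrow> 'a + ('b + 'c)" where
  "disp_par_id \<sigma> = sum_assoc \<circ> map_sum (disp \<sigma>) id"

definition id_par_disp :: "('t, 'b + 'c) strat \<Rightarrow> 'a + 't \<Rightarrow> 'a + ('b + 'c)" where
  "id_par_disp \<tau> = map_sum id (disp \<tau>)"

definition interaction ::
  "'a tcg \<Rightarrow> 'c tcg \<Rightarrow> ('t, 'b + 'c) strat \<Rightarrow> ('s, 'a + 'b) strat \<Rightarrow>
     (('s + 'c) \<times> ('a + 't)) set ess" where
  "interaction A C \<tau> \<sigma> = pullback (supp \<sigma> \<parallel> C) (A \<parallel> supp \<tau>) (disp_par_id \<sigma>) (id_par_disp \<tau>)"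

definition interaction_disp ::
  "'a tcg \<Rightarrow> 'c tcg \<Rightarrow> ('t, 'b + 'c) strat \<Rightarrow> ('s, 'a + 'b) strat \<Rightarrow>
     (('s + 'c) \<times> ('a + 't)) set \<Rightarrow> 'a + ('b + 'c)" where
  "interaction_disp A C \<tau> \<sigma> \<phi> =
     disp_par_id \<sigma> (fst (top_pair (supp \<sigma> \<parallel> C) (A \<parallel> supp \<tau>) \<phi>))"

definition visible ::
  "'a tcg \<Rightarrow> 'c tcg \<Rightarrow> ('t, 'b + 'c) strat \<Rightarrow> ('s, 'a + 'b) strat \<Rightarrow>
     (('s + 'c) \<times> ('a + 't)) set set" where
  "visible A C \<tau> \<sigma> = {\<phi>. \<nexists>b. interaction_disp A C \<tau> \<sigma> \<phi> = Inr (Inl b)}"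

text \<open>The value \<open>undefined\<close> is only reached on events of \<open>B\<close>, which are hidden.\<close>

definition forget_middle :: "'a + ('b + 'c) \<Rightarrow> 'a + 'c" where
  "forget_middle = case_sum Inl (case_sum (\<lambda>b. undefined) Inr)"

definition comp_strat ::
  "'a tcg \<Rightarrow> 'c tcg \<Rightarrow> ('t, 'b + 'c) strat \<Rightarrow> ('s, 'a + 'b) strat \<Rightarrow>
     ((('s + 'c) \<times> ('a + 't)) set, 'a + 'c) strat" where
  "comp_strat A C \<tau> \<sigma> =
     (let H = hide (interaction A C \<tau> \<sigma>) (visible A C \<tau> \<sigma>);
          d = forget_middle \<circ> interaction_disp A C \<tau> \<sigma> in
      \<lparr>supp = \<lparr>events = events H, causal = causal H, consis = consis H, symm = symm H,
               pol = pol (arrow_game A C) \<circ> d\<rparr>,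
       disp = d\<rparr>)"

definition no_deadlock ::
  "'a tcg \<Rightarrow> 'b tcg \<Rightarrow> 'c tcg \<Rightarrow> ('s, 'a + 'b) strat \<Rightarrow> ('t, 'b + 'c) strat \<Rightarrow> bool" where
  "no_deadlock A B C \<sigma> \<tau> \<longleftrightarrow>
     (\<forall>x\<in>conf (supp \<sigma>). \<forall>y\<in>conf (supp \<tau>). \<forall>\<theta>\<in>symm B.
        Domain \<theta> = right \<sigma> x \<and> Range \<theta> = left \<tau> y \<longrightarrow>
        secured (supp \<sigma> \<parallel> C) (A \<parallel> supp \<tau>)
          (bij_via (disp_par_id \<sigma>) (id_par_disp \<tau>)
             (rel_par (Id_on (left \<sigma> x)) (rel_par \<theta> (Id_on (right \<tau> y))))
             (x <+> right \<tau> y) (left \<sigma> x <+> y)))"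

section \<open>The weighted collapse\<close>

definition pos_covered :: "('s, 'm) essp_scheme \<Rightarrow> 's set set" where
  "pos_covered S = {x \<in> conf S.
     \<forall>s\<in>x. (\<forall>s'\<in>x. (s, s') \<in> causal S \<longrightarrow> s' = s) \<longrightarrow> pol S s = Pos}"

definition pos_wit ::
  "'a tcg \<Rightarrow> 'b tcg \<Rightarrow> ('a set set \<Rightarrow> 'a set) \<Rightarrow> ('b set set \<Rightarrow> 'b set) \<Rightarrow>
     ('s, 'a + 'b) strat \<Rightarrow> 'a set set \<Rightarrow> 'b set set \<Rightarrow> 's set set" where
  "pos_wit A B rA rB \<sigma> XA XB = {x \<in> pos_covered (supp \<sigma>).
     related_by (symm_neg A) (left \<sigma> x) (rA XA) \<and>
     related_by (symm_pos B) (right \<sigma> x) (rB XB)}"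

definition ecard :: "'a set \<Rightarrow> enat" where
  "ecard X = (if finite X then enat (card X) else \<infinity>)"

definition coll ::
  "'a tcg \<Rightarrow> 'b tcg \<Rightarrow> ('a set set \<Rightarrow> 'a set) \<Rightarrow> ('b set set \<Rightarrow> 'b set) \<Rightarrow>
     ('s, 'a + 'b) strat \<Rightarrow> 'a set set \<Rightarrow> 'b set set \<Rightarrow> enat" where
  "coll A B rA rB \<sigma> XA XB = ecard (pos_wit A B rA rB \<sigma> XA XB)"

text \<open>Every family in \<open>enat\<close> is summable, so \<open>infsum\<close> never takes its default value there.\<close>

lemma infsum_enat:
  fixes f :: "'i \<Rightarrow> enat"
  shows "infsum f I = (SUP F\<in>{F. finite F \<and> F \<subseteq> I}. sum f F)"
  by (rule nonneg_infsum_complete) simp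

end

theory Submission
  imports Defs
begin

text \<open>
  A witness of \<open>\<tau> \<odot> \<sigma>\<close> is a pair \<open>(x, y)\<close> of \<open>+\<close>-covered configurations of \<open>\<sigma>\<close> and \<open>\<tau>\<close> that
  agree on \<open>B\<close>. Fix a symmetry class of \<open>B\<close> with canonical representative \<open>b\<close>. A pair of
  witnesses of \<open>\<sigma>\<close> and \<open>\<tau>\<close> agrees on \<open>B\<close> only up to a symmetry, and that symmetry can be
  chosen to pass through \<open>b\<close>, by a positive symmetry from the side of \<open>\<sigma>\<close> and a negative one
  from the side of \<open>\<tau>\<close>. In the absence of deadlocks the two configurations synchronize, in a
  unique way: sweeping through the events in causal order, the strategy that plays an event
  \<open>p\<close> of \<open>B\<close> chooses the new copy of \<open>p\<close> and the other one follows by receptivity, while thinness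
  makes the outcome unique. Conversely, a symmetry from \<open>x\<^sub>B = y\<^sub>B\<close> to \<open>b\<close> pulls \<open>x\<close> and \<open>y\<close> back to a
  pair of witnesses with polarized symmetries to \<open>b\<close>. Hence, writing \<open>w\<^sub>\<sigma>\<close>, \<open>w\<^sub>\<tau>\<close> and \<open>w\<close> for the
  numbers of witnesses and \<open>G\<close>, \<open>G\<^sup>+\<close>, \<open>G\<^sup>-\<close> for the groups of endosymmetries of \<open>b\<close>,
  we have \<open>w\<^sub>\<sigma> |G\<^sup>+| w\<^sub>\<tau> |G\<^sup>-| = w |G|\<close>. As \<open>b\<close> is canonical and finite, \<open>|G| = |G\<^sup>+| |G\<^sup>-|\<close> is a
  positive natural number, which cancels.
\<close>

section \<open>Configurations and isomorphism families\<close>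

text \<open>A pair of witnesses has no preferred symmetry to follow on \<open>B\<close>, and
  different choices may synchronize to different pairs, so there is no natural map between the bare
  sets of witnesses; the group orders account for the choices. Transport along \<open>A\<close> is
  restricted to negative symmetries and along \<open>C\<close> to positive ones, for two reasons.
  They preserve the conditions that define witnesses, and they leave no freedom: negative on
  \<open>A\<close> and positive on \<open>B\<close> together mean positive on
  \<open>A\<^sup>\<bottom> \<parallel> B\<close>, and a symmetry of a strategy with a positive
  display is an identity. The polarized symmetries to \<open>b\<close> come from a factorization:
  each symmetry out of the display of a configuration is the display of a symmetry of the strategy
  followed by a positive one. That the witnesses of the composition split into
  \<open>+\<close>-covered halves is due to courtesy. Hiding retains the states whose maximal pairs
  are visible; an event over \<open>B\<close> that is negative for one strategy is positive for the
  other, where courtesy turns any later event into a successor in \<open>B\<close> that both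
  strategies see.\<close>

lemma conf_finite: "event_structure E \<Longrightarrow> x \<in> conf E \<Longrightarrow> finite x"
  by (auto simp: event_structure_def conf_def)

lemma conf_subset_events: "event_structure E \<Longrightarrow> x \<in> conf E \<Longrightarrow> x \<subseteq> events E"
  by (auto simp: event_structure_def conf_def)

lemma conf_downD: "x \<in> conf E \<Longrightarrow> e \<in> x \<Longrightarrow> (e', e) \<in> causal E \<Longrightarrow> e' \<in> x"
  by (auto simp: conf_def)

lemma consis_subset: "event_structure E \<Longrightarrow> X \<in> consis E \<Longrightarrow> Y \<subseteq> X \<Longrightarrow> Y \<in> consis E"
  by (simp add: event_structure_def)

lemma conf_subset:
  assumes "event_structure E" "x \<in> conf E" "y \<subseteq> x"
    and "\<And>e e'. e \<in> y \<Longrightarrow> (e', e) \<in> causal E \<Longrightarrow> e' \<in> y"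
  shows "y \<in> conf E"
  using consis_subset[OF assms(1) _ assms(3)] assms(2,4) by (simp add: conf_def)

lemma conf_empty:
  assumes "event_structure E"
  shows "{} \<in> conf E"
proof -
  obtain X where "X \<in> consis E" using assms by (auto simp: event_structure_def)
  then show ?thesis using consis_subset[OF assms, of X "{}"] by (simp add: conf_def)
qed

lemma causal_partial_order: "event_structure E \<Longrightarrow> partial_order_on (events E) (causal E)"
  by (simp add: event_structure_def)

lemma causal_trans:
  "event_structure E \<Longrightarrow> (a, b) \<in> causal E \<Longrightarrow> (b, c) \<in> causal E \<Longrightarrow> (a, c) \<in> causal E"
  by (drule causal_partial_order) (blast dest: partial_order_onD(2) transD)

lemma causal_antisym:
  "event_structure E \<Longrightarrow> (a, b) \<in> causal E \<Longrightarrow> (b, a) \<in> causal E \<Longrightarrow> a = b"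
  by (drule causal_partial_order) (blast dest: partial_order_onD(3) antisymD)

lemma causal_refl: "event_structure E \<Longrightarrow> a \<in> events E \<Longrightarrow> (a, a) \<in> causal E"
  by (drule causal_partial_order) (blast dest: partial_order_onD(1) refl_onD)

lemma conf_principal:
  assumes "event_structure E" "x \<in> conf E" "e \<in> x"
  shows "{e'. (e', e) \<in> causal E} \<in> conf E"
  using assms by (intro conf_subset[OF assms(1,2)]) (auto intro: conf_downD causal_trans)

lemma conf_remove_maximal:
  assumes "event_structure E" "x \<in> conf E" "\<And>e. e \<in> x \<Longrightarrow> (s, e) \<in> causal E \<Longrightarrow> e = s"
  shows "x - {s} \<in> conf E"
  using assms by (intro conf_subset[OF assms(1,2)]) (auto intro: conf_downD)

lemma finite_acyclic_maximal:
  assumes "finite X" "X \<noteq> {}" "acyclic (r \<inter> X \<times> X)"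
  obtains m where "m \<in> X" "\<And>y. y \<in> X \<Longrightarrow> (m, y) \<notin> r"
proof -
  have "wf ((r \<inter> X \<times> X)\<inverse>)"
    using assms by (intro finite_acyclic_wf_converse) (auto intro: finite_subset[of _ "X \<times> X"])
  then obtain m where "m \<in> X" "\<And>y. (y, m) \<in> (r \<inter> X \<times> X)\<inverse> \<Longrightarrow> y \<notin> X"
    using assms(2) unfolding wf_eq_minimal by (metis all_not_in_conv)
  then show ?thesis using that by blast
qed

lemma acyclic_strict: "event_structure E \<Longrightarrow> acyclic (strict (causal E))"
proof -
  assume es: "event_structure E"
  have "trans (strict (causal E))"
    using causal_trans[OF es] causal_antisym[OF es] unfolding strict_def trans_def by blast
  then show ?thesis by (auto simp: acyclic_def trancl_id strict_def)
qed

text \<open>A nonempty finite configuration has a causally maximal event, and removing it leaves a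
  configuration. Rigidity and factorization of symmetries are both proved along this
  induction.\<close>

lemma conf_induct [consumes 2, case_names empty insert]:
  assumes "event_structure E" "x \<in> conf E"
    and "P {}"
    and "\<And>s x. \<lbrakk>x \<in> conf E; insert s x \<in> conf E; s \<notin> x; P x\<rbrakk> \<Longrightarrow> P (insert s x)"
  shows "P x"
proof -
  have "finite x" using assms(1,2) by (rule conf_finite)
  then show ?thesis using assms(2)
  proof (induction "card x" arbitrary: x)
    case 0
    then show ?case using assms(3) by simp
  next
    case (Suc n)
    then have ne: "x \<noteq> {}" by auto
    obtain s where s: "s \<in> x" "\<And>e. e \<in> x \<Longrightarrow> (s, e) \<notin> strict (causal E)"
      using finite_acyclic_maximal[OF \<open>finite x\<close> ne, of "strict (causal E)"]
        acyclic_subset[OF acyclic_strict[OF assms(1)]] by (metis inf_le1)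
    have c: "x - {s} \<in> conf E"
      using assms(1) \<open>x \<in> conf E\<close> s by (intro conf_remove_maximal) (auto simp: strict_def)
    have "n = card (x - {s})" using Suc.hyps(2) Suc.prems(1) s(1) by simp
    then have "P (x - {s})" using Suc.hyps(1) c Suc.prems(1) by blast
    then show ?case using assms(4)[OF c, of s] Suc.prems s(1) by (simp add: insert_absorb)
  qed
qed

section \<open>Isomorphism families, one event at a time\<close>

lemma iso_conf_bij: "iso_family E \<Theta> \<Longrightarrow> \<theta> \<in> \<Theta> \<Longrightarrow> conf_bij E \<theta>"
  by (simp add: iso_family_def)

lemma iso_Id_on: "iso_family E \<Theta> \<Longrightarrow> x \<in> conf E \<Longrightarrow> Id_on x \<in> \<Theta>"
  by (simp add: iso_family_def)

lemma iso_converse: "iso_family E \<Theta> \<Longrightarrow> \<theta> \<in> \<Theta> \<Longrightarrow> \<theta>\<inverse> \<in> \<Theta>"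
  by (simp add: iso_family_def)

lemma iso_comp:
  "iso_family E \<Theta> \<Longrightarrow> \<theta> \<in> \<Theta> \<Longrightarrow> \<theta>' \<in> \<Theta> \<Longrightarrow> Range \<theta> = Domain \<theta>' \<Longrightarrow> \<theta> O \<theta>' \<in> \<Theta>"
  by (simp add: iso_family_def)

lemma iso_restrict:
  "iso_family E \<Theta> \<Longrightarrow> \<theta> \<in> \<Theta> \<Longrightarrow> x \<in> conf E \<Longrightarrow> x \<subseteq> Domain \<theta> \<Longrightarrow> \<theta> \<inter> x \<times> UNIV \<in> \<Theta>"
  by (simp add: iso_family_def)

lemma iso_Domain: "iso_family E \<Theta> \<Longrightarrow> \<theta> \<in> \<Theta> \<Longrightarrow> Domain \<theta> \<in> conf E"
  by (simp add: iso_family_def conf_bij_def)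

lemma iso_Range: "iso_family E \<Theta> \<Longrightarrow> \<theta> \<in> \<Theta> \<Longrightarrow> Range \<theta> \<in> conf E"
  by (simp add: iso_family_def conf_bij_def)

lemma iso_fun: "iso_family E \<Theta> \<Longrightarrow> \<theta> \<in> \<Theta> \<Longrightarrow> (a, b) \<in> \<theta> \<Longrightarrow> (a, c) \<in> \<theta> \<Longrightarrow> b = c"
  by (drule (1) iso_conf_bij) (auto simp: conf_bij_def dest: single_valuedD)

lemma iso_inj: "iso_family E \<Theta> \<Longrightarrow> \<theta> \<in> \<Theta> \<Longrightarrow> (a, c) \<in> \<theta> \<Longrightarrow> (b, c) \<in> \<theta> \<Longrightarrow> a = b"
  by (drule (1) iso_conf_bij) (auto simp: conf_bij_def dest: single_valuedD[of "\<theta>\<inverse>"])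

lemma iso_comp_converse: "iso_family E \<Theta> \<Longrightarrow> \<theta> \<in> \<Theta> \<Longrightarrow> \<theta> O \<theta>\<inverse> = Id_on (Domain \<theta>)"
  using iso_inj[of E \<Theta> \<theta>] by blast

lemma iso_converse_comp: "iso_family E \<Theta> \<Longrightarrow> \<theta> \<in> \<Theta> \<Longrightarrow> \<theta>\<inverse> O \<theta> = Id_on (Range \<theta>)"
  using iso_fun[of E \<Theta> \<theta>] by blast

lemma iso_split:
  assumes "iso_family E \<Theta>" "\<theta> \<in> \<Theta>" "Domain \<theta> = insert s x" "s \<notin> x" "x \<in> conf E"
  obtains s' \<theta>' where "\<theta> = insert (s, s') \<theta>'" "\<theta>' \<in> \<Theta>" "Domain \<theta>' = x" "s' \<notin> Range \<theta>'"
proof -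
  obtain s' where s': "(s, s') \<in> \<theta>" using assms(3) by auto
  let ?\<theta>' = "\<theta> \<inter> x \<times> UNIV"
  have "u = s \<and> v = s' \<or> u \<in> x" if "(u, v) \<in> \<theta>" for u v
    using that s' iso_fun[OF assms(1,2)] DomainI[OF that] unfolding assms(3) by auto
  then have "\<theta> = insert (s, s') ?\<theta>'" using s' by auto
  moreover have "?\<theta>' \<in> \<Theta>" using assms by (intro iso_restrict) auto
  moreover have "Domain ?\<theta>' = x" using assms(3) by auto
  moreover have "s' \<notin> Range ?\<theta>'" using s' assms(4) iso_inj[OF assms(1,2)] by blast
  ultimately show ?thesis by (rule that)
qed

text \<open>The extension axiom only supplies some larger bijection whose domain gains
  \<open>s\<close>. Functionality forces it to agree with \<theta> elsewhere, so the extension is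
  the insertion of a single pair.\<close>

lemma iso_extend:
  assumes "iso_family E \<Theta>" "\<theta> \<in> \<Theta>" "insert s (Domain \<theta>) \<in> conf E" "s \<notin> Domain \<theta>"
  obtains s' where "insert (s, s') \<theta> \<in> \<Theta>" "s' \<notin> Range \<theta>"
proof -
  obtain \<theta>' where \<theta>': "\<theta>' \<in> \<Theta>" "\<theta> \<subseteq> \<theta>'" "Domain \<theta>' = insert s (Domain \<theta>)"
    using assms unfolding iso_family_def by (meson subset_insertI)
  obtain s' \<theta>'' where s: "\<theta>' = insert (s, s') \<theta>''" "Domain \<theta>'' = Domain \<theta>" "s' \<notin> Range \<theta>''"
    using iso_split[OF assms(1) \<theta>'(1,3) assms(4) iso_Domain[OF assms(1,2)]] by metis
  have "\<theta> \<subseteq> \<theta>''" using s(1) \<theta>'(2) assms(4) by auto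
  moreover have "(u, v) \<in> \<theta>" if uv: "(u, v) \<in> \<theta>''" for u v
  proof -
    obtain v' where "(u, v') \<in> \<theta>" using s(2) DomainI[OF uv] by auto
    then show ?thesis using iso_fun[OF assms(1) \<theta>'(1), of u v v'] \<theta>'(2) s(1) uv by auto
  qed
  ultimately have "\<theta>'' = \<theta>" by auto
  then show ?thesis using s \<theta>'(1) that by blast
qed

lemma iso_remove:
  assumes "iso_family E \<Theta>" "insert (a, b) \<theta> \<in> \<Theta>" "a \<notin> Domain \<theta>" "Domain \<theta> \<in> conf E"
  shows "\<theta> \<in> \<Theta>"
proof -
  have "insert (a, b) \<theta> \<inter> Domain \<theta> \<times> UNIV \<in> \<Theta>" using assms by (intro iso_restrict) auto
  moreover have "insert (a, b) \<theta> \<inter> Domain \<theta> \<times> UNIV = \<theta>" using assms(3) by auto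
  ultimately show ?thesis by simp
qed

text \<open>Restriction applies to the converse of \<theta> as well: cut down to the causes of
  \<open>u'\<close>, it still has a configuration as its range. That range contains
  \<open>u\<close>, hence everything below \<open>u\<close>.\<close>

lemma iso_causal:
  assumes "event_structure E" "iso_family E \<Theta>" "\<theta> \<in> \<Theta>"
    and "(s, s') \<in> \<theta>" "(u, u') \<in> \<theta>" "(s, u) \<in> causal E"
  shows "(s', u') \<in> causal E"
proof -
  let ?y = "{e. (e, u') \<in> causal E}"
  have u': "u' \<in> Range \<theta>" "Range \<theta> \<in> conf E" using assms iso_Range by auto
  have y: "?y \<in> conf E" using conf_principal[OF assms(1) u'(2,1)] .
  have "?y \<subseteq> Range \<theta>" using conf_downD[OF u'(2,1)] by auto
  then have "\<theta>\<inverse> \<inter> ?y \<times> UNIV \<in> \<Theta>"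
    using iso_restrict[OF assms(2) iso_converse[OF assms(2,3)] y] by simp
  then have "Range (\<theta>\<inverse> \<inter> ?y \<times> UNIV) \<in> conf E" by (rule iso_Range[OF assms(2)])
  moreover have "u \<in> Range (\<theta>\<inverse> \<inter> ?y \<times> UNIV)"
    using assms(1,5) u' causal_refl conf_subset_events by fastforce
  ultimately have "s \<in> Range (\<theta>\<inverse> \<inter> ?y \<times> UNIV)" using assms(6) conf_downD by metis
  then show ?thesis using iso_fun[OF assms(2,3)] assms(4) by blast
qed

text \<open>\<open>sub_symm A p \<Psi>\<close> abstracts what \<open>symm_neg A\<close> (for \<open>p = Neg\<close>) and \<open>symm_pos A\<close>
  (for \<open>p = Pos\<close>) have in common, so that both components of \<open>A\<^sup>\<bottom> \<parallel> B\<close> are treated alike.\<close>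

definition sub_symm :: "'a tcg \<Rightarrow> polarity \<Rightarrow> ('a \<times> 'a) set set \<Rightarrow> bool" where
  "sub_symm A p \<Psi> \<longleftrightarrow> iso_family A \<Psi> \<and> \<Psi> \<subseteq> symm A \<and>
     (\<forall>\<theta>\<in>\<Psi>. \<forall>a a'. insert (a, a') \<theta> \<in> symm A \<and> pol A a = p \<longrightarrow> insert (a, a') \<theta> \<in> \<Psi>)"

lemma sub_symm_neg: "thin_concurrent_game A \<Longrightarrow> sub_symm A Neg (symm_neg A)"
  by (auto simp: thin_concurrent_game_def sub_symm_def)

lemma sub_symm_pos: "thin_concurrent_game A \<Longrightarrow> sub_symm A Pos (symm_pos A)"
  by (auto simp: thin_concurrent_game_def sub_symm_def)

lemma sub_symm_insert:
  "sub_symm A p \<Psi> \<Longrightarrow> \<theta> \<in> \<Psi> \<Longrightarrow> insert (a, a') \<theta> \<in> symm A \<Longrightarrow> pol A a = p \<Longrightarrow> insert (a, a') \<theta> \<in> \<Psi>"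
  unfolding sub_symm_def by blast

section \<open>Polarized symmetries of a thin concurrent game\<close>

context
  fixes A :: "'a tcg"
  assumes tcg: "thin_concurrent_game A"
begin

lemma tcg_es: "event_structure A"
  using tcg by (simp add: thin_concurrent_game_def ess_with_polarity_def)

lemma tcg_iso: "iso_family A (symm A)"
  using tcg by (simp add: thin_concurrent_game_def ess_with_polarity_def)

lemma tcg_pol: "\<theta> \<in> symm A \<Longrightarrow> (a, a') \<in> \<theta> \<Longrightarrow> pol A a = pol A a'"
  using tcg by (auto simp: thin_concurrent_game_def ess_with_polarity_def)

lemma tcg_iso_neg: "iso_family A (symm_neg A)"
  using tcg by (simp add: thin_concurrent_game_def)

lemma tcg_iso_pos: "iso_family A (symm_pos A)"
  using tcg by (simp add: thin_concurrent_game_def)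

lemma tcg_neg_sub: "\<theta> \<in> symm_neg A \<Longrightarrow> \<theta> \<in> symm A"
  using tcg by (auto simp: thin_concurrent_game_def)

lemma tcg_pos_sub: "\<theta> \<in> symm_pos A \<Longrightarrow> \<theta> \<in> symm A"
  using tcg by (auto simp: thin_concurrent_game_def)

lemma tcg_neg_pos_id: "\<theta> \<in> symm_neg A \<Longrightarrow> \<theta> \<in> symm_pos A \<Longrightarrow> \<theta> \<subseteq> Id"
  using tcg by (simp add: thin_concurrent_game_def)

text \<open>An identity is also positive, and extending it by a positive event keeps it so. The
  extension thus lies in both sub-symmetries, which share only identities.\<close>

lemma tcg_neg_id:
  assumes "insert (a, a') (Id_on z) \<in> symm_neg A" "z \<in> conf A" "pol A a = Pos"
  shows "a = a'"
proof -
  have "insert (a, a') (Id_on z) \<in> symm_pos A"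
    using assms by (intro sub_symm_insert[OF sub_symm_pos] tcg_neg_sub iso_Id_on[OF tcg_iso_pos]) (auto simp: tcg)
  then show ?thesis using tcg_neg_pos_id assms(1) by blast
qed

lemma tcg_pos_id:
  assumes "insert (a, a') (Id_on z) \<in> symm_pos A" "z \<in> conf A" "pol A a = Neg"
  shows "a = a'"
proof -
  have "insert (a, a') (Id_on z) \<in> symm_neg A"
    using assms by (intro sub_symm_insert[OF sub_symm_neg] tcg_pos_sub iso_Id_on[OF tcg_iso_neg]) (auto simp: tcg)
  then show ?thesis using tcg_neg_pos_id assms(1) by blast
qed

text \<open>Serves the events played by the environment of a strategy: the target \<open>a'\<close>
  is prescribed and the middle copy \<open>a''\<close> is free. It is found by extending the
  converse of \<alpha> inside \<Psi>; composing with that extension then extends \<rho>, whatever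
  the polarity of \<open>a\<close>.\<close>

lemma sub_symm_lift:
  assumes "sub_symm A p \<Psi>" "\<alpha> \<in> \<Psi>" "Range \<rho> = Domain \<alpha>" "insert (a, a') (\<rho> O \<alpha>) \<in> symm A"
    and "a' \<notin> Range \<alpha>"
  obtains a'' where "insert (a, a'') \<rho> \<in> symm A" "insert (a'', a') \<alpha> \<in> \<Psi>" "a'' \<notin> Domain \<alpha>"
proof -
  have iso: "iso_family A \<Psi>" and sub: "\<Psi> \<subseteq> symm A" using assms(1) by (auto simp: sub_symm_def)
  have rng: "Range (insert (a, a') (\<rho> O \<alpha>)) = insert a' (Range \<alpha>)" using assms(3) by blast
  then have "insert a' (Domain (\<alpha>\<inverse>)) \<in> conf A" using iso_Range[OF tcg_iso assms(4)] by simp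
  then obtain a'' where a'': "insert (a', a'') (\<alpha>\<inverse>) \<in> \<Psi>" "a'' \<notin> Range (\<alpha>\<inverse>)"
    using iso_extend[OF iso iso_converse[OF iso assms(2)]] assms(5) by auto
  have "(insert (a, a') (\<rho> O \<alpha>)) O insert (a', a'') (\<alpha>\<inverse>) \<in> symm A"
    using assms(4) a'' sub rng by (intro iso_comp[OF tcg_iso]) auto
  moreover have "(insert (a, a') (\<rho> O \<alpha>)) O insert (a', a'') (\<alpha>\<inverse>) = insert (a, a'') \<rho>"
  proof -
    have "(insert (a, a') (\<rho> O \<alpha>)) O insert (a', a'') (\<alpha>\<inverse>) = insert (a, a'') (\<rho> O (\<alpha> O \<alpha>\<inverse>))"
      using assms(5) by auto
    also have "\<alpha> O \<alpha>\<inverse> = Id_on (Domain \<alpha>)" by (rule iso_comp_converse[OF iso assms(2)])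
    also have "\<rho> O Id_on (Domain \<alpha>) = \<rho>" using assms(3) by auto
    finally show ?thesis .
  qed
  moreover have "insert (a'', a') \<alpha> \<in> \<Psi>"
  proof -
    have "(insert (a', a'') (\<alpha>\<inverse>))\<inverse> = insert (a'', a') \<alpha>" by auto
    then show ?thesis using iso_converse[OF iso a''(1)] by simp
  qed
  ultimately show ?thesis using that a''(2) by simp
qed

text \<open>Here both extensions are given, typically because the strategy plays \<open>a\<close>
  and picks its copy, and the new pair of \<alpha> is their quotient. The quotient is only known to
  lie in \<open>symm A\<close>; the polarity of \<open>a\<close> puts it back into \<Psi>.\<close>

lemma sub_symm_cancel:
  assumes "sub_symm A p \<Psi>" "\<alpha> \<in> \<Psi>" "Range \<rho> = Domain \<alpha>" "insert (a, a') (\<rho> O \<alpha>) \<in> symm A"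
    and "insert (a, a'') \<rho> \<in> symm A" "a \<notin> Domain \<rho>" "pol A a = p"
  shows "insert (a'', a') \<alpha> \<in> \<Psi>"
proof -
  let ?\<rho> = "insert (a, a'') \<rho>"
  have "?\<rho>\<inverse> O insert (a, a') (\<rho> O \<alpha>) = insert (a'', a') ((\<rho>\<inverse> O \<rho>) O \<alpha>)"
    using assms(6) by auto
  also have "\<rho>\<inverse> O \<rho> = Id_on (Range \<rho>)"
    using iso_fun[OF tcg_iso assms(5)] by auto
  also have "Id_on (Range \<rho>) O \<alpha> = \<alpha>" using assms(3) by auto
  finally have eq: "?\<rho>\<inverse> O insert (a, a') (\<rho> O \<alpha>) = insert (a'', a') \<alpha>" .
  have "?\<rho>\<inverse> O insert (a, a') (\<rho> O \<alpha>) \<in> symm A"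
    using assms(3-5) by (intro iso_comp[OF tcg_iso] iso_converse[OF tcg_iso]) auto
  then have "insert (a'', a') \<alpha> \<in> symm A" by (simp only: eq)
  moreover have "pol A a'' = p" using tcg_pol[OF assms(5), of a a''] assms(7) by simp
  ultimately show ?thesis using sub_symm_insert[OF assms(1,2)] by blast
qed

end

lemma insert_relcomp_insert:
  "b \<notin> Range \<rho> \<Longrightarrow> b \<notin> Domain \<alpha> \<Longrightarrow> insert (a, b) \<rho> O insert (b, c) \<alpha> = insert (a, c) (\<rho> O \<alpha>)"
  by auto

section \<open>Strategies\<close>

lemma rel_par_iff [simp]:
  "(Inl a, Inl a') \<in> rel_par r s \<longleftrightarrow> (a, a') \<in> r"
  "(Inr b, Inr b') \<in> rel_par r s \<longleftrightarrow> (b, b') \<in> s"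
  "(Inl a, Inr b) \<notin> rel_par r s"
  "(Inr b, Inl a) \<notin> rel_par r s"
  by (auto simp: rel_par_def)

lemma conf_par_iff: "z \<in> conf (A \<parallel> B) \<longleftrightarrow> Inl -` z \<in> conf A \<and> Inr -` z \<in> conf B"
proof -
  have z: "z = Inl -` z <+> Inr -` z"
  proof (rule set_eqI)
    show "e \<in> z \<longleftrightarrow> e \<in> Inl -` z <+> Inr -` z" for e by (cases e) auto
  qed
  have "z \<in> consis (A \<parallel> B) \<longleftrightarrow> Inl -` z \<in> consis A \<and> Inr -` z \<in> consis B"
  proof
    assume "z \<in> consis (A \<parallel> B)"
    then obtain x y where "z = x <+> y" "x \<in> consis A" "y \<in> consis B" by (auto simp: par_def)
    moreover from this have "Inl -` z = x" "Inr -` z = y" by auto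
    ultimately show "Inl -` z \<in> consis A \<and> Inr -` z \<in> consis B" by simp
  next
    assume "Inl -` z \<in> consis A \<and> Inr -` z \<in> consis B"
    then show "z \<in> consis (A \<parallel> B)" using z by (auto simp: par_def)
  qed
  moreover have "(\<forall>e\<in>z. \<forall>e'. (e', e) \<in> causal (A \<parallel> B) \<longrightarrow> e' \<in> z) \<longleftrightarrow>
    (\<forall>a\<in>Inl -` z. \<forall>a'. (a', a) \<in> causal A \<longrightarrow> a' \<in> Inl -` z) \<and>
    (\<forall>b\<in>Inr -` z. \<forall>b'. (b', b) \<in> causal B \<longrightarrow> b' \<in> Inr -` z)"
    by (simp add: par_def Ball_def split_sum_all)
  ultimately show ?thesis by (auto simp: conf_def)
qed

lemma conf_arrow_iff: "z \<in> conf (arrow_game A B) \<longleftrightarrow> Inl -` z \<in> conf A \<and> Inr -` z \<in> conf B"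
  using conf_par_iff[of z A B] by (simp add: conf_def arrow_game_def)

section \<open>Displays of symmetries on the two components of the game\<close>

definition lrel :: "('s, 'a + 'b) strat \<Rightarrow> ('s \<times> 's) set \<Rightarrow> ('a \<times> 'a) set" where
  "lrel \<sigma> \<phi> = {(a, a'). \<exists>s s'. (s, s') \<in> \<phi> \<and> disp \<sigma> s = Inl a \<and> disp \<sigma> s' = Inl a'}"

definition rrel :: "('s, 'a + 'b) strat \<Rightarrow> ('s \<times> 's) set \<Rightarrow> ('b \<times> 'b) set" where
  "rrel \<sigma> \<phi> = {(b, b'). \<exists>s s'. (s, s') \<in> \<phi> \<and> disp \<sigma> s = Inr b \<and> disp \<sigma> s' = Inr b'}"

lemma lrel_empty [simp]: "lrel \<sigma> {} = {}" and rrel_empty [simp]: "rrel \<sigma> {} = {}"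
  by (auto simp: lrel_def rrel_def)

lemma lrel_converse: "lrel \<sigma> (\<phi>\<inverse>) = (lrel \<sigma> \<phi>)\<inverse>" and rrel_converse: "rrel \<sigma> (\<phi>\<inverse>) = (rrel \<sigma> \<phi>)\<inverse>"
  by (auto simp: lrel_def rrel_def)

lemma rel_insert_Inl:
  assumes "disp \<sigma> s = Inl a" "disp \<sigma> s' = Inl a'"
  shows "lrel \<sigma> (insert (s, s') \<phi>) = insert (a, a') (lrel \<sigma> \<phi>)"
    and "rrel \<sigma> (insert (s, s') \<phi>) = rrel \<sigma> \<phi>"
  using assms by (auto simp: lrel_def rrel_def)

lemma rel_insert_Inr:
  assumes "disp \<sigma> s = Inr b" "disp \<sigma> s' = Inr b'"
  shows "lrel \<sigma> (insert (s, s') \<phi>) = lrel \<sigma> \<phi>"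
    and "rrel \<sigma> (insert (s, s') \<phi>) = insert (b, b') (rrel \<sigma> \<phi>)"
  using assms by (auto simp: lrel_def rrel_def)

lemma left_right_empty [simp]: "left \<sigma> {} = {}" "right \<sigma> {} = {}"
  by (auto simp: left_def right_def)

lemma left_iff: "a \<in> left \<sigma> x \<longleftrightarrow> (\<exists>s\<in>x. disp \<sigma> s = Inl a)"
  and right_iff: "b \<in> right \<sigma> x \<longleftrightarrow> (\<exists>s\<in>x. disp \<sigma> s = Inr b)"
  by (auto simp: left_def right_def image_iff Bex_def eq_commute)

lemma left_right_insert_Inl:
  assumes "disp \<sigma> s = Inl a"
  shows "left \<sigma> (insert s x) = insert a (left \<sigma> x)" "right \<sigma> (insert s x) = right \<sigma> x"
  using assms by (auto simp: left_iff right_iff)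

lemma left_right_insert_Inr:
  assumes "disp \<sigma> s = Inr b"
  shows "left \<sigma> (insert s x) = left \<sigma> x" "right \<sigma> (insert s x) = insert b (right \<sigma> x)"
  using assms by (auto simp: left_iff right_iff)

locale strategy =
  fixes A :: "'a tcg" and B :: "'b tcg" and \<sigma> :: "('s, 'a + 'b) strat"
  assumes tcg_left: "thin_concurrent_game A" and tcg_right: "thin_concurrent_game B"
    and strategy: "sim_strategy A B \<sigma>"
begin

abbreviation S :: "'s essp" where
  "S \<equiv> supp \<sigma>"

lemma ess: "ess_with_polarity S"
  using strategy by (simp add: sim_strategy_def)

lemma es: "event_structure S"
  using ess by (simp add: ess_with_polarity_def)

lemma iso: "iso_family S (symm S)"
  using ess by (simp add: ess_with_polarity_def)

lemmas isoA = tcg_iso[OF tcg_left] and isoB = tcg_iso[OF tcg_right]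
  and isoA_neg = tcg_iso_neg[OF tcg_left] and isoB_pos = tcg_iso_pos[OF tcg_right]

lemma symm_pol: "\<phi> \<in> symm S \<Longrightarrow> (s, s') \<in> \<phi> \<Longrightarrow> pol S s = pol S s'"
  using ess by (auto simp: ess_with_polarity_def)

lemma map: "is_map S (arrow_game A B) (disp \<sigma>)"
  using strategy by (simp add: sim_strategy_def)

lemma disp_inj: "x \<in> conf S \<Longrightarrow> s \<in> x \<Longrightarrow> s' \<in> x \<Longrightarrow> disp \<sigma> s = disp \<sigma> s' \<Longrightarrow> s = s'"
  using map by (auto simp: is_map_def dest: inj_onD)

lemma left_conf: "x \<in> conf S \<Longrightarrow> left \<sigma> x \<in> conf A"
  and right_conf: "x \<in> conf S \<Longrightarrow> right \<sigma> x \<in> conf B"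
  using map by (auto simp: is_map_def conf_arrow_iff left_def right_def)

lemma pol_Inl: "s \<in> events S \<Longrightarrow> disp \<sigma> s = Inl a \<Longrightarrow> pol S s = flip (pol A a)"
  and pol_Inr: "s \<in> events S \<Longrightarrow> disp \<sigma> s = Inr b \<Longrightarrow> pol S s = pol B b"
  using map by (auto simp: is_map_def arrow_game_def dest!: bspec[where x = s])

lemma conf_events: "x \<in> conf S \<Longrightarrow> s \<in> x \<Longrightarrow> s \<in> events S"
  using conf_subset_events[OF es] by blast

lemma disp_symm:
  assumes "\<phi> \<in> symm S"
  shows "map_prod (disp \<sigma>) (disp \<sigma>) ` \<phi> = rel_par (lrel \<sigma> \<phi>) (rrel \<sigma> \<phi>)"
    and "lrel \<sigma> \<phi> \<in> symm A" and "rrel \<sigma> \<phi> \<in> symm B"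
proof -
  have "map_prod (disp \<sigma>) (disp \<sigma>) ` \<phi> \<in> symm (arrow_game A B)"
    using map assms by (simp add: is_map_def)
  then obtain \<theta> \<theta>' where \<theta>: "map_prod (disp \<sigma>) (disp \<sigma>) ` \<phi> = rel_par \<theta> \<theta>'" "\<theta> \<in> symm A" "\<theta>' \<in> symm B"
    by (auto simp: arrow_game_def par_def)
  have mem: "(disp \<sigma> s, disp \<sigma> s') \<in> rel_par \<theta> \<theta>'" if "(s, s') \<in> \<phi>" for s s'
    using that unfolding \<theta>(1)[symmetric] by force
  have ex: "\<exists>s s'. (s, s') \<in> \<phi> \<and> disp \<sigma> s = p \<and> disp \<sigma> s' = q" if "(p, q) \<in> rel_par \<theta> \<theta>'" for p q
    using that unfolding \<theta>(1)[symmetric] by auto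
  have "lrel \<sigma> \<phi> = \<theta>"
    using mem ex[of "Inl _" "Inl _"] by (fastforce simp: lrel_def)
  moreover have "rrel \<sigma> \<phi> = \<theta>'"
    using mem ex[of "Inr _" "Inr _"] by (fastforce simp: rrel_def)
  ultimately show "map_prod (disp \<sigma>) (disp \<sigma>) ` \<phi> = rel_par (lrel \<sigma> \<phi>) (rrel \<sigma> \<phi>)"
    "lrel \<sigma> \<phi> \<in> symm A" "rrel \<sigma> \<phi> \<in> symm B" using \<theta> by simp_all
qed

lemma disp_pair:
  assumes "\<phi> \<in> symm S" "(s, s') \<in> \<phi>"
  shows "(\<exists>a a'. disp \<sigma> s = Inl a \<and> disp \<sigma> s' = Inl a') \<or> (\<exists>b b'. disp \<sigma> s = Inr b \<and> disp \<sigma> s' = Inr b')"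
proof -
  have "(disp \<sigma> s, disp \<sigma> s') \<in> rel_par (lrel \<sigma> \<phi>) (rrel \<sigma> \<phi>)"
    using assms(2) unfolding disp_symm(1)[OF assms(1), symmetric] by force
  then show ?thesis by (auto simp: rel_par_def)
qed

lemma disp_pair_Inl: "\<phi> \<in> symm S \<Longrightarrow> (s, s') \<in> \<phi> \<Longrightarrow> disp \<sigma> s = Inl a \<Longrightarrow> \<exists>a'. disp \<sigma> s' = Inl a'"
  and disp_pair_Inr: "\<phi> \<in> symm S \<Longrightarrow> (s, s') \<in> \<phi> \<Longrightarrow> disp \<sigma> s = Inr b \<Longrightarrow> \<exists>b'. disp \<sigma> s' = Inr b'"
  by (drule (1) disp_pair, simp)+

lemma Domain_lrel:
  assumes "\<phi> \<in> symm S"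
  shows "Domain (lrel \<sigma> \<phi>) = left \<sigma> (Domain \<phi>)"
proof (intro set_eqI iffI)
  fix a assume "a \<in> left \<sigma> (Domain \<phi>)"
  then obtain s s' where "(s, s') \<in> \<phi>" "disp \<sigma> s = Inl a" by (auto simp: left_iff)
  moreover obtain a' where "disp \<sigma> s' = Inl a'" using disp_pair_Inl[OF assms calculation] by blast
  ultimately show "a \<in> Domain (lrel \<sigma> \<phi>)" by (auto simp: lrel_def)
qed (auto simp: lrel_def left_iff)

lemma Domain_rrel:
  assumes "\<phi> \<in> symm S"
  shows "Domain (rrel \<sigma> \<phi>) = right \<sigma> (Domain \<phi>)"
proof (intro set_eqI iffI)
  fix a assume "a \<in> right \<sigma> (Domain \<phi>)"
  then obtain s s' where "(s, s') \<in> \<phi>" "disp \<sigma> s = Inr a" by (auto simp: right_iff)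
  moreover obtain a' where "disp \<sigma> s' = Inr a'" using disp_pair_Inr[OF assms calculation] by blast
  ultimately show "a \<in> Domain (rrel \<sigma> \<phi>)" by (auto simp: rrel_def)
qed (auto simp: rrel_def right_iff)

lemma Range_lrel: "\<phi> \<in> symm S \<Longrightarrow> Range (lrel \<sigma> \<phi>) = left \<sigma> (Range \<phi>)"
  using Domain_lrel[OF iso_converse[OF iso]] by (simp add: lrel_converse)

lemma Range_rrel: "\<phi> \<in> symm S \<Longrightarrow> Range (rrel \<sigma> \<phi>) = right \<sigma> (Range \<phi>)"
  using Domain_rrel[OF iso_converse[OF iso]] by (simp add: rrel_converse)

text \<open>One inclusion needs local injectivity of the display: pairs that can be composed after
  display already meet in the same event of the strategy.\<close>

lemma rel_comp:
  assumes "\<phi> \<in> symm S" "\<psi> \<in> symm S" "Range \<phi> = Domain \<psi>"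
  shows "lrel \<sigma> (\<phi> O \<psi>) = lrel \<sigma> \<phi> O lrel \<sigma> \<psi>" and "rrel \<sigma> (\<phi> O \<psi>) = rrel \<sigma> \<phi> O rrel \<sigma> \<psi>"
proof -
  have inj: "s = s'" if "s \<in> Range \<phi>" "s' \<in> Domain \<psi>" "disp \<sigma> s = disp \<sigma> s'" for s s'
    using that assms(3) disp_inj[OF iso_Range[OF iso assms(1)]] by blast
  have mid: "\<exists>a'. disp \<sigma> s' = Inl a'" if "(s, s') \<in> \<phi>" "disp \<sigma> s = Inl a" for s s' a
    using disp_pair_Inl[OF assms(1) that] .
  have mid': "\<exists>b'. disp \<sigma> s' = Inr b'" if "(s, s') \<in> \<phi>" "disp \<sigma> s = Inr b" for s s' b
    using disp_pair_Inr[OF assms(1) that] .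
  show "lrel \<sigma> (\<phi> O \<psi>) = lrel \<sigma> \<phi> O lrel \<sigma> \<psi>"
  proof (intro equalityI subrelI)
    show "(a, c) \<in> lrel \<sigma> \<phi> O lrel \<sigma> \<psi>" if "(a, c) \<in> lrel \<sigma> (\<phi> O \<psi>)" for a c
      using that mid unfolding lrel_def by blast
    show "(a, c) \<in> lrel \<sigma> (\<phi> O \<psi>)" if "(a, c) \<in> lrel \<sigma> \<phi> O lrel \<sigma> \<psi>" for a c
      using that inj unfolding lrel_def by clarsimp (metis DomainI RangeI relcompI)
  qed
  show "rrel \<sigma> (\<phi> O \<psi>) = rrel \<sigma> \<phi> O rrel \<sigma> \<psi>"
  proof (intro equalityI subrelI)
    show "(b, c) \<in> rrel \<sigma> \<phi> O rrel \<sigma> \<psi>" if "(b, c) \<in> rrel \<sigma> (\<phi> O \<psi>)" for b c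
      using that mid' unfolding rrel_def by blast
    show "(b, c) \<in> rrel \<sigma> (\<phi> O \<psi>)" if "(b, c) \<in> rrel \<sigma> \<phi> O rrel \<sigma> \<psi>" for b c
      using that inj unfolding rrel_def by clarsimp (metis DomainI RangeI relcompI)
  qed
qed

section \<open>Extending a symmetry of a strategy by one event\<close>

lemma notin_left: "insert s x \<in> conf S \<Longrightarrow> s \<notin> x \<Longrightarrow> disp \<sigma> s = Inl a \<Longrightarrow> a \<notin> left \<sigma> x"
  and notin_right: "insert s x \<in> conf S \<Longrightarrow> s \<notin> x \<Longrightarrow> disp \<sigma> s = Inr b \<Longrightarrow> b \<notin> right \<sigma> x"
  by (auto simp: left_iff right_iff) (metis disp_inj insertCI)+

text \<open>\<open>sim_receptive\<close> yields a pair with the required display, but says nothing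
  about which event is its first component. Plain receptivity identifies that component with
  \<open>s\<close>, since both extend the same configuration over the same negative event.\<close>

lemma step_neg:
  assumes "\<phi> \<in> symm S" "insert s (Domain \<phi>) \<in> conf S" "s \<notin> Domain \<phi>"
    and "pol S s = Neg" "pol (arrow_game A B) g = Neg"
    and "insert (disp \<sigma> s, g) (rel_par (lrel \<sigma> \<phi>) (rrel \<sigma> \<phi>)) \<in> symm (arrow_game A B)"
  obtains s' where "insert (s, s') \<phi> \<in> symm S" "disp \<sigma> s' = g"
proof -
  have s: "s \<in> events S" using conf_events[OF assms(2)] by simp
  have pol: "pol (arrow_game A B) (disp \<sigma> s) = Neg"
    using map s assms(4) by (simp add: is_map_def)
  have new: "disp \<sigma> s \<notin> disp \<sigma> ` Domain \<phi>"
    using disp_inj[OF assms(2)] assms(3) by auto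
  have "sim_receptive S (arrow_game A B) (disp \<sigma>)" using strategy by (simp add: sim_strategy_def)
  then obtain p where p: "insert p \<phi> \<in> symm S" "map_prod (disp \<sigma>) (disp \<sigma>) p = (disp \<sigma> s, g)"
    using assms(1,5,6) pol new disp_symm(1)[OF assms(1)] unfolding sim_receptive_def by metis
  obtain t s' where [simp]: "p = (t, s')" by fastforce
  have "insert t (Domain \<phi>) \<in> conf S" using iso_Domain[OF iso p(1)] by simp
  moreover have "disp \<sigma> t = disp \<sigma> s" using p(2) by simp
  moreover have "receptive S (arrow_game A B) (disp \<sigma>)" using strategy by (simp add: sim_strategy_def)
  moreover have "insert (disp \<sigma> s) (disp \<sigma> ` Domain \<phi>) \<in> conf (arrow_game A B)"
    using map assms(2) unfolding is_map_def by (metis image_insert)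
  ultimately have "t = s"
    using assms(2) iso_Domain[OF iso assms(1)] new pol unfolding receptive_def by metis
  then show ?thesis using p that by simp
qed

lemma rel_par_insert:
  "rel_par (insert (a, a') r) s = insert (Inl a, Inl a') (rel_par r s)"
  "rel_par r (insert (b, b') s) = insert (Inr b, Inr b') (rel_par r s)"
  by (auto simp: rel_par_def)

text \<open>The game is played in the dual of \<open>A\<close>, so the negative events of the
  strategy over \<open>A\<close> are those with polarity \<open>Pos\<close> in \<open>A\<close>;
  over \<open>B\<close> in \<open>step_neg_right\<close> there is no such reversal.\<close>

lemma step_neg_left:
  assumes "\<phi> \<in> symm S" "insert s (Domain \<phi>) \<in> conf S" "s \<notin> Domain \<phi>"
    and "disp \<sigma> s = Inl a" "pol A a = Pos" "insert (a, a') (lrel \<sigma> \<phi>) \<in> symm A"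
  obtains s' where "insert (s, s') \<phi> \<in> symm S" "disp \<sigma> s' = Inl a'"
proof (rule step_neg[OF assms(1-3)])
  show "pol S s = Neg" using pol_Inl[OF conf_events[OF assms(2)] assms(4)] assms(5) by simp
  show "pol (arrow_game A B) (Inl a') = Neg"
    using tcg_pol[OF tcg_left assms(6), of a a'] assms(5) by (simp add: arrow_game_def)
  show "insert (disp \<sigma> s, Inl a') (rel_par (lrel \<sigma> \<phi>) (rrel \<sigma> \<phi>)) \<in> symm (arrow_game A B)"
    using assms(4,6) disp_symm(3)[OF assms(1)] by (auto simp: arrow_game_def par_def rel_par_insert[symmetric])
qed (rule that)

lemma step_neg_right:
  assumes "\<phi> \<in> symm S" "insert s (Domain \<phi>) \<in> conf S" "s \<notin> Domain \<phi>"
    and "disp \<sigma> s = Inr b" "pol B b = Neg" "insert (b, b') (rrel \<sigma> \<phi>) \<in> symm B"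
  obtains s' where "insert (s, s') \<phi> \<in> symm S" "disp \<sigma> s' = Inr b'"
proof (rule step_neg[OF assms(1-3)])
  show "pol S s = Neg" using pol_Inr[OF conf_events[OF assms(2)] assms(4)] assms(5) by simp
  show "pol (arrow_game A B) (Inr b') = Neg"
    using tcg_pol[OF tcg_right assms(6), of b b'] assms(5) by (simp add: arrow_game_def)
  show "insert (disp \<sigma> s, Inr b') (rel_par (lrel \<sigma> \<phi>) (rrel \<sigma> \<phi>)) \<in> symm (arrow_game A B)"
    using assms(4,6) disp_symm(2)[OF assms(1)] by (auto simp: arrow_game_def par_def rel_par_insert[symmetric])
qed (rule that)

text \<open>Nothing is prescribed about the copy: this is for events that the strategy plays itself,
  where the display has to accept whatever \<open>symm S\<close> offers.\<close>

lemma step_left: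
  assumes "\<phi> \<in> symm S" "insert s (Domain \<phi>) \<in> conf S" "s \<notin> Domain \<phi>" "disp \<sigma> s = Inl a"
  obtains s' a' where "insert (s, s') \<phi> \<in> symm S" "disp \<sigma> s' = Inl a'"
proof -
  obtain s' where "insert (s, s') \<phi> \<in> symm S" using iso_extend[OF iso assms(1-3)] by blast
  then show ?thesis using disp_pair_Inl[of _ s s'] assms(4) that by blast
qed

lemma step_right:
  assumes "\<phi> \<in> symm S" "insert s (Domain \<phi>) \<in> conf S" "s \<notin> Domain \<phi>" "disp \<sigma> s = Inr b"
  obtains s' b' where "insert (s, s') \<phi> \<in> symm S" "disp \<sigma> s' = Inr b'"
proof -
  obtain s' where "insert (s, s') \<phi> \<in> symm S" using iso_extend[OF iso assms(1-3)] by blast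
  then show ?thesis using disp_pair_Inr[of _ s s'] assms(4) that by blast
qed

text \<open>A negative \<open>s\<close> is determined by receptivity, a positive one by thinness.\<close>

lemma step_unique:
  assumes "insert (s, s') (Id_on x) \<in> symm S" "x \<in> conf S" "s \<notin> x"
    and "pol S s = Neg \<Longrightarrow> disp \<sigma> s = disp \<sigma> s'"
  shows "s' = s"
proof (cases "pol S s")
  case Pos
  have "thin S" using strategy by (simp add: sim_strategy_def)
  then show ?thesis using assms Pos unfolding thin_def by blast
next
  case Neg
  have c: "insert s x \<in> conf S" using iso_Domain[OF iso assms(1)] by simp
  have c': "insert s' x \<in> conf S" using iso_Range[OF iso assms(1)] by simp
  have "receptive S (arrow_game A B) (disp \<sigma>)" using strategy by (simp add: sim_strategy_def)
  moreover have "insert (disp \<sigma> s) (disp \<sigma> ` x) \<in> conf (arrow_game A B)"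
    using map c unfolding is_map_def by (metis image_insert)
  moreover have "disp \<sigma> s \<notin> disp \<sigma> ` x" using disp_inj[OF c] assms(3) by auto
  moreover have "pol (arrow_game A B) (disp \<sigma> s) = Neg"
    using map conf_events[OF c, of s] Neg by (simp add: is_map_def)
  ultimately show ?thesis using assms(2) c c' assms(4)[OF Neg] unfolding receptive_def by metis
qed

end

section \<open>Rigidity and factorization\<close>

context strategy
begin

text \<open>Takes a given symmetry apart where the steps above build one. Restriction preserves
  membership in the polarized family, so the hypotheses of the inductions on uniqueness pass to
  \<omega>'.\<close>

lemma split_left:
  assumes "\<omega> \<in> symm S" "Domain \<omega> = insert s x" "s \<notin> x" "x \<in> conf S" "disp \<sigma> s = Inl a"
  obtains s' a' \<omega>' where "\<omega> = insert (s, s') \<omega>'" "\<omega>' \<in> symm S" "Domain \<omega>' = x" "disp \<sigma> s' = Inl a'"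
    "lrel \<sigma> \<omega> = insert (a, a') (lrel \<sigma> \<omega>')" "rrel \<sigma> \<omega> = rrel \<sigma> \<omega>'"
    "lrel \<sigma> \<omega> \<in> symm_neg A \<Longrightarrow> lrel \<sigma> \<omega>' \<in> symm_neg A"
proof -
  obtain s' \<omega>' where \<omega>: "\<omega> = insert (s, s') \<omega>'" "\<omega>' \<in> symm S" "Domain \<omega>' = x"
    using iso_split[OF iso assms(1-4)] by metis
  obtain a' where a': "disp \<sigma> s' = Inl a'" using disp_pair_Inl[OF assms(1) _ assms(5)] \<omega>(1) by blast
  have l: "lrel \<sigma> \<omega> = insert (a, a') (lrel \<sigma> \<omega>')" "rrel \<sigma> \<omega> = rrel \<sigma> \<omega>'"
    using rel_insert_Inl[where \<phi> = \<omega>', OF assms(5) a'] \<omega>(1) by simp_all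
  have "insert s x \<in> conf S" using iso_Domain[OF iso assms(1)] assms(2) by simp
  then have "a \<notin> Domain (lrel \<sigma> \<omega>')" using notin_left[OF _ assms(3,5)] Domain_lrel[OF \<omega>(2)] \<omega>(3) by simp
  moreover have "Domain (lrel \<sigma> \<omega>') \<in> conf A" using iso_Domain[OF isoA disp_symm(2)[OF \<omega>(2)]] .
  ultimately have "lrel \<sigma> \<omega> \<in> symm_neg A \<Longrightarrow> lrel \<sigma> \<omega>' \<in> symm_neg A"
    unfolding l using iso_remove[OF isoA_neg] by blast
  then show ?thesis using that \<omega> a' l by blast
qed

lemma split_right:
  assumes "\<omega> \<in> symm S" "Domain \<omega> = insert s x" "s \<notin> x" "x \<in> conf S" "disp \<sigma> s = Inr b"
  obtains s' b' \<omega>' where "\<omega> = insert (s, s') \<omega>'" "\<omega>' \<in> symm S" "Domain \<omega>' = x" "disp \<sigma> s' = Inr b'"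
    "lrel \<sigma> \<omega> = lrel \<sigma> \<omega>'" "rrel \<sigma> \<omega> = insert (b, b') (rrel \<sigma> \<omega>')"
    "rrel \<sigma> \<omega> \<in> symm_pos B \<Longrightarrow> rrel \<sigma> \<omega>' \<in> symm_pos B"
proof -
  obtain s' \<omega>' where \<omega>: "\<omega> = insert (s, s') \<omega>'" "\<omega>' \<in> symm S" "Domain \<omega>' = x"
    using iso_split[OF iso assms(1-4)] by metis
  obtain b' where b': "disp \<sigma> s' = Inr b'" using disp_pair_Inr[OF assms(1) _ assms(5)] \<omega>(1) by blast
  have l: "lrel \<sigma> \<omega> = lrel \<sigma> \<omega>'" "rrel \<sigma> \<omega> = insert (b, b') (rrel \<sigma> \<omega>')"
    using rel_insert_Inr[where \<phi> = \<omega>', OF assms(5) b'] \<omega>(1) by simp_all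
  have "insert s x \<in> conf S" using iso_Domain[OF iso assms(1)] assms(2) by simp
  then have "b \<notin> Domain (rrel \<sigma> \<omega>')" using notin_right[OF _ assms(3,5)] Domain_rrel[OF \<omega>(2)] \<omega>(3) by simp
  moreover have "Domain (rrel \<sigma> \<omega>') \<in> conf B" using iso_Domain[OF isoB disp_symm(3)[OF \<omega>(2)]] .
  ultimately have "rrel \<sigma> \<omega> \<in> symm_pos B \<Longrightarrow> rrel \<sigma> \<omega>' \<in> symm_pos B"
    unfolding l using iso_remove[OF isoB_pos] by blast
  then show ?thesis using that \<omega> b' l by blast
qed

lemma rel_Id_on: "lrel \<sigma> (Id_on x) = Id_on (left \<sigma> x)" "rrel \<sigma> (Id_on x) = Id_on (right \<sigma> x)"
  by (auto simp: lrel_def rrel_def left_iff right_iff Id_on_iff)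

text \<open>If \<open>s\<close> is negative in the strategy, \<open>a\<close> is positive in
  \<open>A\<close>, and a negative symmetry cannot move it when it extends an identity. The displays
  then agree, as uniqueness by receptivity demands.\<close>

lemma step_unique_left:
  assumes "insert (s, s') (Id_on x) \<in> symm S" "x \<in> conf S" "s \<notin> x" "disp \<sigma> s = Inl a"
    and "lrel \<sigma> (insert (s, s') (Id_on x)) \<in> symm_neg A"
  shows "s' = s"
proof (rule step_unique[OF assms(1-3)])
  assume "pol S s = Neg"
  moreover have "s \<in> events S" using conf_events[OF iso_Domain[OF iso assms(1)]] by simp
  ultimately have "pol A a = Pos" using pol_Inl[OF _ assms(4)] by (cases "pol A a") auto
  obtain a' where a': "disp \<sigma> s' = Inl a'" using disp_pair_Inl[OF assms(1) _ assms(4)] by blast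
  have "insert (a, a') (Id_on (left \<sigma> x)) \<in> symm_neg A"
    using assms(5) by (simp add: rel_insert_Inl[OF assms(4) a'] rel_Id_on)
  then show "disp \<sigma> s = disp \<sigma> s'"
    using tcg_neg_id[OF tcg_left _ left_conf[OF assms(2)] \<open>pol A a = Pos\<close>] assms(4) a' by simp
qed

lemma step_unique_right:
  assumes "insert (s, s') (Id_on x) \<in> symm S" "x \<in> conf S" "s \<notin> x" "disp \<sigma> s = Inr b"
    and "rrel \<sigma> (insert (s, s') (Id_on x)) \<in> symm_pos B"
  shows "s' = s"
proof (rule step_unique[OF assms(1-3)])
  assume "pol S s = Neg"
  moreover have "s \<in> events S" using conf_events[OF iso_Domain[OF iso assms(1)]] by simp
  ultimately have "pol B b = Neg" using pol_Inr[OF _ assms(4)] by simp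
  obtain b' where b': "disp \<sigma> s' = Inr b'" using disp_pair_Inr[OF assms(1) _ assms(4)] by blast
  have "insert (b, b') (Id_on (right \<sigma> x)) \<in> symm_pos B"
    using assms(5) by (simp add: rel_insert_Inr[OF assms(4) b'] rel_Id_on)
  then show "disp \<sigma> s = disp \<sigma> s'"
    using tcg_pos_id[OF tcg_right _ right_conf[OF assms(2)] \<open>pol B b = Neg\<close>] assms(4) b' by simp
qed

text \<open>Thinness speaks only of identities extended by one event. Splitting off a last event and
  applying the induction hypothesis to the rest brings every symmetry of this kind into that
  form.\<close>

lemma rigid:
  assumes "\<omega> \<in> symm S" "lrel \<sigma> \<omega> \<in> symm_neg A" "rrel \<sigma> \<omega> \<in> symm_pos B"
  shows "\<omega> = Id_on (Domain \<omega>)"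
proof -
  have "\<forall>\<omega>\<in>symm S. Domain \<omega> = x \<and> lrel \<sigma> \<omega> \<in> symm_neg A \<and> rrel \<sigma> \<omega> \<in> symm_pos B \<longrightarrow>
      \<omega> = Id_on x" if "x \<in> conf S" for x
    using es that
  proof (induction x rule: conf_induct)
    case empty
    then show ?case by auto
  next
    case (insert s x)
    show ?case
    proof (intro ballI impI, elim conjE)
      fix \<omega> assume \<omega>: "\<omega> \<in> symm S" "Domain \<omega> = insert s x" "lrel \<sigma> \<omega> \<in> symm_neg A" "rrel \<sigma> \<omega> \<in> symm_pos B"
      show "\<omega> = Id_on (insert s x)"
      proof (cases "disp \<sigma> s")
        case (Inl a)
        obtain s' a' \<omega>' where *: "\<omega> = insert (s, s') \<omega>'" "\<omega>' \<in> symm S" "Domain \<omega>' = x"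
          "rrel \<sigma> \<omega> = rrel \<sigma> \<omega>'" "lrel \<sigma> \<omega> \<in> symm_neg A \<Longrightarrow> lrel \<sigma> \<omega>' \<in> symm_neg A"
          using split_left[OF \<omega>(1,2) \<open>s \<notin> x\<close> \<open>x \<in> conf S\<close> Inl] by metis
        then have "\<omega>' = Id_on x" using insert(4) \<omega> by auto
        then show ?thesis using step_unique_left[OF _ \<open>x \<in> conf S\<close> \<open>s \<notin> x\<close> Inl, of s'] \<omega> * by auto
      next
        case (Inr b)
        obtain s' b' \<omega>' where *: "\<omega> = insert (s, s') \<omega>'" "\<omega>' \<in> symm S" "Domain \<omega>' = x"
          "lrel \<sigma> \<omega> = lrel \<sigma> \<omega>'" "rrel \<sigma> \<omega> \<in> symm_pos B \<Longrightarrow> rrel \<sigma> \<omega>' \<in> symm_pos B"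
          using split_right[OF \<omega>(1,2) \<open>s \<notin> x\<close> \<open>x \<in> conf S\<close> Inr] by metis
        then have "\<omega>' = Id_on x" using insert(4) \<omega> by auto
        then show ?thesis using step_unique_right[OF _ \<open>x \<in> conf S\<close> \<open>s \<notin> x\<close> Inr, of s'] \<omega> * by auto
      qed
    qed
  qed
  then show ?thesis using assms iso_Domain[OF iso assms(1)] by blast
qed

text \<open>Built one event at a time. When the environment plays the last event, the middle copy is
  chosen first by \<open>sub_symm_lift\<close>, and the strategy follows by receptivity. When the
  strategy plays it, the strategy chooses the copy, and the remainder stays polarized by
  \<open>sub_symm_cancel\<close>, because it grows by an event of its own polarity.\<close>

lemma factor:
  assumes "x \<in> conf S" "\<theta>A \<in> symm A" "Domain \<theta>A = left \<sigma> x" "\<theta>B \<in> symm B" "Domain \<theta>B = right \<sigma> x"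
  shows "\<exists>\<phi> \<alpha> \<beta>. \<phi> \<in> symm S \<and> Domain \<phi> = x \<and>
    \<alpha> \<in> symm_neg A \<and> Domain \<alpha> = left \<sigma> (Range \<phi>) \<and> \<theta>A = lrel \<sigma> \<phi> O \<alpha> \<and>
    \<beta> \<in> symm_pos B \<and> Domain \<beta> = right \<sigma> (Range \<phi>) \<and> \<theta>B = rrel \<sigma> \<phi> O \<beta>"
  using es assms
proof (induction x arbitrary: \<theta>A \<theta>B rule: conf_induct)
  case empty
  have "{} \<in> symm S" "{} \<in> symm_neg A" "{} \<in> symm_pos B"
    using iso_Id_on[OF iso conf_empty[OF es]]
      iso_Id_on[OF tcg_iso_neg conf_empty[OF tcg_es]] iso_Id_on[OF tcg_iso_pos conf_empty[OF tcg_es]]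
      tcg_left tcg_right by auto
  moreover have "\<theta>A = {}" "\<theta>B = {}" using empty by auto
  ultimately show ?case by (intro exI[of _ "{}"]) simp
next
  case (insert s x)
  note x = \<open>x \<in> conf S\<close> and sx = \<open>insert s x \<in> conf S\<close> and s = \<open>s \<notin> x\<close>
  show ?case
  proof (cases "disp \<sigma> s")
    case (Inl a)
    note left = left_right_insert_Inl[OF Inl]
    have a: "a \<notin> left \<sigma> x" using notin_left[OF sx s Inl] .
    have D: "Domain \<theta>A = insert a (left \<sigma> x)" using insert(6) left by simp
    obtain a' \<theta>A' where \<theta>A: "\<theta>A = insert (a, a') \<theta>A'" "\<theta>A' \<in> symm A" "Domain \<theta>A' = left \<sigma> x" "a' \<notin> Range \<theta>A'"
      using iso_split[OF isoA \<open>\<theta>A \<in> symm A\<close> D a left_conf[OF x]] by metis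
    obtain \<phi> \<alpha> \<beta> where IH: "\<phi> \<in> symm S" "Domain \<phi> = x"
      "\<alpha> \<in> symm_neg A" "Domain \<alpha> = left \<sigma> (Range \<phi>)" "\<theta>A' = lrel \<sigma> \<phi> O \<alpha>"
      "\<beta> \<in> symm_pos B" "Domain \<beta> = right \<sigma> (Range \<phi>)" "\<theta>B = rrel \<sigma> \<phi> O \<beta>"
      using insert(4)[OF \<theta>A(2,3) insert(7)] insert(8) left by auto
    have R: "Range (lrel \<sigma> \<phi>) = Domain \<alpha>" using Range_lrel[OF IH(1)] IH(4) by simp
    then have a': "a' \<notin> Range \<alpha>" using \<theta>A(4) IH(5) by blast
    have new: "insert s (Domain \<phi>) \<in> conf S" "s \<notin> Domain \<phi>" using IH(2) sx s by auto
    have ext: "insert (a, a') (lrel \<sigma> \<phi> O \<alpha>) \<in> symm A" using insert(5) \<theta>A(1) IH(5) by simp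
    have aD: "a \<notin> Domain (lrel \<sigma> \<phi>)" using a Domain_lrel[OF IH(1)] IH(2) by simp
    have "\<exists>s' a''. insert (s, s') \<phi> \<in> symm S \<and> disp \<sigma> s' = Inl a'' \<and>
      insert (a'', a') \<alpha> \<in> symm_neg A \<and> a'' \<notin> Domain \<alpha>"
    proof (cases "pol A a")
      case Pos
      obtain a'' where "insert (a, a'') (lrel \<sigma> \<phi>) \<in> symm A" "insert (a'', a') \<alpha> \<in> symm_neg A" "a'' \<notin> Domain \<alpha>"
        using sub_symm_lift[OF tcg_left sub_symm_neg[OF tcg_left] IH(3) R ext a'] .
      then show ?thesis using step_neg_left[OF IH(1) new Inl Pos] by metis
    next
      case Neg
      obtain s' a'' where s': "insert (s, s') \<phi> \<in> symm S" "disp \<sigma> s' = Inl a''"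
        using step_left[OF IH(1) new Inl] by metis
      have i: "insert (a, a'') (lrel \<sigma> \<phi>) \<in> symm A"
        using disp_symm(2)[OF s'(1)] rel_insert_Inl[OF Inl s'(2)] by metis
      have "insert (a'', a') \<alpha> \<in> symm_neg A"
        using sub_symm_cancel[OF tcg_left sub_symm_neg[OF tcg_left] IH(3) R ext i aD Neg] .
      moreover have "a'' \<notin> Domain \<alpha>"
        using iso_inj[OF isoA i, of a a''] aD unfolding R[symmetric] by blast
      ultimately show ?thesis using s' by blast
    qed
    then obtain s' a'' where s': "insert (s, s') \<phi> \<in> symm S" "disp \<sigma> s' = Inl a''"
      "insert (a'', a') \<alpha> \<in> symm_neg A" "a'' \<notin> Domain \<alpha>" by blast
    have "lrel \<sigma> (insert (s, s') \<phi>) O insert (a'', a') \<alpha> = \<theta>A"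
      using insert_relcomp_insert[of a'' "lrel \<sigma> \<phi>" \<alpha> a a'] s'(4) R
      by (simp add: rel_insert_Inl[OF Inl s'(2)] \<theta>A(1) IH(5))
    then show ?thesis using IH s' left_right_insert_Inl[OF s'(2)] rel_insert_Inl[OF Inl s'(2)]
      by (intro exI[of _ "insert (s, s') \<phi>"] exI[of _ "insert (a'', a') \<alpha>"] exI[of _ \<beta>]) simp
  next
    case (Inr b)
    note right = left_right_insert_Inr[OF Inr]
    have b: "b \<notin> right \<sigma> x" using notin_right[OF sx s Inr] .
    have D: "Domain \<theta>B = insert b (right \<sigma> x)" using insert(8) right by simp
    obtain b' \<theta>B' where \<theta>B: "\<theta>B = insert (b, b') \<theta>B'" "\<theta>B' \<in> symm B" "Domain \<theta>B' = right \<sigma> x" "b' \<notin> Range \<theta>B'"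
      using iso_split[OF isoB \<open>\<theta>B \<in> symm B\<close> D b right_conf[OF x]] by metis
    obtain \<phi> \<alpha> \<beta> where IH: "\<phi> \<in> symm S" "Domain \<phi> = x"
      "\<alpha> \<in> symm_neg A" "Domain \<alpha> = left \<sigma> (Range \<phi>)" "\<theta>A = lrel \<sigma> \<phi> O \<alpha>"
      "\<beta> \<in> symm_pos B" "Domain \<beta> = right \<sigma> (Range \<phi>)" "\<theta>B' = rrel \<sigma> \<phi> O \<beta>"
      using insert(4)[OF insert(5) _ \<theta>B(2,3)] insert(6) right by auto
    have R: "Range (rrel \<sigma> \<phi>) = Domain \<beta>" using Range_rrel[OF IH(1)] IH(7) by simp
    then have b': "b' \<notin> Range \<beta>" using \<theta>B(4) IH(8) by blast
    have new: "insert s (Domain \<phi>) \<in> conf S" "s \<notin> Domain \<phi>" using IH(2) sx s by auto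
    have ext: "insert (b, b') (rrel \<sigma> \<phi> O \<beta>) \<in> symm B" using insert(7) \<theta>B(1) IH(8) by simp
    have bD: "b \<notin> Domain (rrel \<sigma> \<phi>)" using b Domain_rrel[OF IH(1)] IH(2) by simp
    have "\<exists>s' b''. insert (s, s') \<phi> \<in> symm S \<and> disp \<sigma> s' = Inr b'' \<and>
      insert (b'', b') \<beta> \<in> symm_pos B \<and> b'' \<notin> Domain \<beta>"
    proof (cases "pol B b")
      case Neg
      obtain b'' where "insert (b, b'') (rrel \<sigma> \<phi>) \<in> symm B" "insert (b'', b') \<beta> \<in> symm_pos B" "b'' \<notin> Domain \<beta>"
        using sub_symm_lift[OF tcg_right sub_symm_pos[OF tcg_right] IH(6) R ext b'] .
      then show ?thesis using step_neg_right[OF IH(1) new Inr Neg] by metis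
    next
      case Pos
      obtain s' b'' where s': "insert (s, s') \<phi> \<in> symm S" "disp \<sigma> s' = Inr b''"
        using step_right[OF IH(1) new Inr] by metis
      have i: "insert (b, b'') (rrel \<sigma> \<phi>) \<in> symm B"
        using disp_symm(3)[OF s'(1)] rel_insert_Inr[OF Inr s'(2)] by metis
      have "insert (b'', b') \<beta> \<in> symm_pos B"
        using sub_symm_cancel[OF tcg_right sub_symm_pos[OF tcg_right] IH(6) R ext i bD Pos] .
      moreover have "b'' \<notin> Domain \<beta>"
        using iso_inj[OF isoB i, of b b''] bD unfolding R[symmetric] by blast
      ultimately show ?thesis using s' by blast
    qed
    then obtain s' b'' where s': "insert (s, s') \<phi> \<in> symm S" "disp \<sigma> s' = Inr b''"
      "insert (b'', b') \<beta> \<in> symm_pos B" "b'' \<notin> Domain \<beta>" by blast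
    have "rrel \<sigma> (insert (s, s') \<phi>) O insert (b'', b') \<beta> = \<theta>B"
      using insert_relcomp_insert[of b'' "rrel \<sigma> \<phi>" \<beta> b b'] s'(4) R
      by (simp add: rel_insert_Inr[OF Inr s'(2)] \<theta>B(1) IH(8))
    then show ?thesis using IH s' left_right_insert_Inr[OF s'(2)] rel_insert_Inr[OF Inr s'(2)]
      by (intro exI[of _ "insert (s, s') \<phi>"] exI[of _ \<alpha>] exI[of _ "insert (b'', b') \<beta>"]) simp
  qed
qed

text \<open>Symmetries preserve causality and polarity, hence maximal events and their sign.\<close>

lemma pos_covered_symm:
  assumes "\<phi> \<in> symm S" "Domain \<phi> \<in> pos_covered S"
  shows "Range \<phi> \<in> pos_covered S"
  unfolding pos_covered_def
proof (intro CollectI conjI ballI impI)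
  show "Range \<phi> \<in> conf S" by (rule iso_Range[OF iso assms(1)])
  fix s' assume "s' \<in> Range \<phi>" and max: "\<forall>u'\<in>Range \<phi>. (s', u') \<in> causal S \<longrightarrow> u' = s'"
  then obtain s where s: "(s, s') \<in> \<phi>" by blast
  have "u = s" if uD: "u \<in> Domain \<phi>" and su: "(s, u) \<in> causal S" for u
  proof -
    obtain u' where u: "(u, u') \<in> \<phi>" using uD by blast
    then have "u' = s'" using max iso_causal[OF es iso assms(1) s u su] by blast
    then show ?thesis using iso_inj[OF iso assms(1)] s u by blast
  qed
  then have "pol S s = Pos" using assms(2) s unfolding pos_covered_def by blast
  then show "pol S s' = Pos" using symm_pol[OF assms(1) s] by simp
qed

end

section \<open>Synchronization up to symmetry\<close>

locale composition = L: strategy A B \<sigma> + R: strategy B C \<tau>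
  for A :: "'a tcg" and B :: "'b tcg" and C :: "'c tcg"
    and \<sigma> :: "('s, 'a + 'b) strat" and \<tau> :: "('t, 'b + 'c) strat" +
  assumes no_deadlock: "no_deadlock A B C \<sigma> \<tau>"
begin

abbreviation S :: "'s essp" where
  "S \<equiv> supp \<sigma>"

abbreviation T :: "'t essp" where
  "T \<equiv> supp \<tau>"

definition sync :: "('b \<times> 'b) set \<Rightarrow> 's set \<Rightarrow> 't set \<Rightarrow> (('s + 'c) \<times> ('a + 't)) set" where
  "sync \<theta> x y = bij_via (disp_par_id \<sigma>) (id_par_disp \<tau>)
     (rel_par (Id_on (left \<sigma> x)) (rel_par \<theta> (Id_on (right \<tau> y))))
     (x <+> right \<tau> y) (left \<sigma> x <+> y)"

lemma sync_iff:
  "(Inl s, Inl a) \<in> sync \<theta> x y \<longleftrightarrow> s \<in> x \<and> disp \<sigma> s = Inl a"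
  "(Inl s, Inr t) \<in> sync \<theta> x y \<longleftrightarrow>
     s \<in> x \<and> t \<in> y \<and> (\<exists>b b'. disp \<sigma> s = Inr b \<and> disp \<tau> t = Inl b' \<and> (b, b') \<in> \<theta>)"
  "(Inr c, Inr t) \<in> sync \<theta> x y \<longleftrightarrow> t \<in> y \<and> disp \<tau> t = Inr c"
  "(Inr c, Inl a) \<notin> sync \<theta> x y"
  by (cases "disp \<sigma> s"; cases "disp \<tau> t";
    auto simp: sync_def bij_via_def disp_par_id_def id_par_disp_def left_iff right_iff)+

lemma sync_secured:
  assumes "x \<in> conf S" "y \<in> conf T" "\<theta> \<in> symm B" "Domain \<theta> = right \<sigma> x" "Range \<theta> = left \<tau> y"
  shows "secured (S \<parallel> C) (A \<parallel> T) (sync \<theta> x y)"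
  using no_deadlock assms unfolding no_deadlock_def sync_def by blast

lemma sync_total:
  assumes "Domain \<theta> = right \<sigma> x" "Range \<theta> = left \<tau> y"
  shows "s \<in> x \<Longrightarrow> \<exists>e. (Inl s, e) \<in> sync \<theta> x y" and "t \<in> y \<Longrightarrow> \<exists>d. (d, Inr t) \<in> sync \<theta> x y"
proof -
  show "\<exists>e. (Inl s, e) \<in> sync \<theta> x y" if "s \<in> x"
  proof (cases "disp \<sigma> s")
    case (Inl a)
    then show ?thesis using that sync_iff(1) by blast
  next
    case (Inr b)
    then have "b \<in> Domain \<theta>" using assms(1) that by (auto simp: right_iff)
    then obtain b' where b': "(b, b') \<in> \<theta>" by blast
    then have "b' \<in> left \<tau> y" using assms(2) by blast
    then show ?thesis using that Inr b' sync_iff(2) by (metis left_iff)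
  qed
  show "\<exists>d. (d, Inr t) \<in> sync \<theta> x y" if "t \<in> y"
  proof (cases "disp \<tau> t")
    case (Inl b')
    then have "b' \<in> Range \<theta>" using assms(2) that by (auto simp: left_iff)
    then obtain b where b: "(b, b') \<in> \<theta>" by blast
    then have "b \<in> right \<sigma> x" using assms(1) by blast
    then show ?thesis using that Inl b sync_iff(2) by (metis right_iff)
  next
    case (Inr c)
    then show ?thesis using that sync_iff(3) by blast
  qed
qed

lemma strict_par_iff [simp]:
  "(Inl s, Inl s') \<in> strict (causal (D \<parallel> E)) \<longleftrightarrow> (s, s') \<in> strict (causal D)"
  "(Inr t, Inr t') \<in> strict (causal (D \<parallel> E)) \<longleftrightarrow> (t, t') \<in> strict (causal E)"
  "(Inl s, Inr t) \<notin> strict (causal (D \<parallel> E))"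
  "(Inr t, Inl s) \<notin> strict (causal (D \<parallel> E))"
  by (auto simp: strict_def par_def)

lemma sync_finite:
  assumes "x \<in> conf S" "y \<in> conf T"
  shows "finite (sync \<theta> x y)"
proof (rule finite_subset)
  show "sync \<theta> x y \<subseteq> (x <+> right \<tau> y) \<times> (left \<sigma> x <+> y)" by (auto simp: sync_def bij_via_def)
  show "finite ((x <+> right \<tau> y) \<times> (left \<sigma> x <+> y))"
    using conf_finite[OF L.es assms(1)] conf_finite[OF R.es assms(2)]
      conf_finite[OF tcg_es[OF L.tcg_left] L.left_conf[OF assms(1)]]
      conf_finite[OF tcg_es[OF R.tcg_right] R.right_conf[OF assms(2)]] by simp
qed

text \<open>Acyclicity of \<open>sync \<theta> x y\<close> provides a maximal pair, whose events in
  \<open>x\<close> and \<open>y\<close> are then maximal there, and dropping it leaves a smaller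
  instance. As \<open>no_deadlock\<close> quantifies over all configurations and symmetries, the
  smaller instance is again secured without further argument.\<close>

lemma interaction_induct [consumes 5, case_names empty left right both]:
  assumes "x \<in> conf S" "y \<in> conf T" "\<theta> \<in> symm B" "Domain \<theta> = right \<sigma> x" "Range \<theta> = left \<tau> y"
    and empty: "P {} {} {}"
    and left: "\<And>x y \<theta> s a. \<lbrakk>x \<in> conf S; insert s x \<in> conf S; s \<notin> x; disp \<sigma> s = Inl a;
      y \<in> conf T; \<theta> \<in> symm B; Domain \<theta> = right \<sigma> x; Range \<theta> = left \<tau> y; P x y \<theta>\<rbrakk>
      \<Longrightarrow> P (insert s x) y \<theta>"
    and right: "\<And>x y \<theta> t c. \<lbrakk>x \<in> conf S; y \<in> conf T; insert t y \<in> conf T; t \<notin> y;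
      disp \<tau> t = Inr c; \<theta> \<in> symm B; Domain \<theta> = right \<sigma> x; Range \<theta> = left \<tau> y; P x y \<theta>\<rbrakk>
      \<Longrightarrow> P x (insert t y) \<theta>"
    and both: "\<And>x y \<theta> s t b b'. \<lbrakk>x \<in> conf S; insert s x \<in> conf S; s \<notin> x; disp \<sigma> s = Inr b;
      y \<in> conf T; insert t y \<in> conf T; t \<notin> y; disp \<tau> t = Inl b';
      \<theta> \<in> symm B; insert (b, b') \<theta> \<in> symm B; Domain \<theta> = right \<sigma> x; Range \<theta> = left \<tau> y; P x y \<theta>\<rbrakk>
      \<Longrightarrow> P (insert s x) (insert t y) (insert (b, b') \<theta>)"
  shows "P x y \<theta>"
  using assms(1-5)
proof (induction "card x + card y" arbitrary: x y \<theta> rule: less_induct)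
  case less
  note x = less(2) and y = less(3) and \<theta> = less(4-6)
  have fin: "finite x" "finite y" using conf_finite[OF L.es x] conf_finite[OF R.es y] .
  show ?case
  proof (cases "sync \<theta> x y = {}")
    case True
    then have "x = {}" "y = {}" using sync_total[OF \<theta>(2,3)] by auto
    moreover from this have "\<theta> = {}" using \<theta>(2) by auto
    ultimately show ?thesis using empty by simp
  next
    case False
    let ?D = "S \<parallel> C" and ?E = "A \<parallel> T"
    have "acyclic (bij_causal ?D ?E (sync \<theta> x y))"
      using sync_secured[OF x y \<theta>] by (simp add: secured_def)
    then have "acyclic (bij_causal ?D ?E (sync \<theta> x y) \<inter> sync \<theta> x y \<times> sync \<theta> x y)"
      by (rule acyclic_subset) simp
    then obtain m where m: "m \<in> sync \<theta> x y" "\<And>q. q \<in> sync \<theta> x y \<Longrightarrow> (m, q) \<notin> bij_causal ?D ?E (sync \<theta> x y)"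
      using finite_acyclic_maximal[OF sync_finite[OF x y] False] by metis
    \<comment> \<open>A later event of \<open>x\<close> occurs in some pair of
      \<open>sync \<theta> x y\<close>, and \<open>bij_causal\<close> would place that pair above
      \<open>m\<close>.\<close>
    have maxl: "x - {s} \<in> conf S" if "m = (Inl s, e)" for s e
    proof (rule conf_remove_maximal[OF L.es x])
      fix s' assume "s' \<in> x" "(s, s') \<in> causal S"
      obtain e' where e': "(Inl s', e') \<in> sync \<theta> x y" using sync_total(1)[OF \<theta>(2,3) \<open>s' \<in> x\<close>] by blast
      have "(Inl s, Inl s') \<notin> strict (causal ?D)"
        using m(2)[OF e'] m(1) e' that by (simp add: bij_causal_def del: strict_par_iff)
      then show "s' = s" using \<open>(s, s') \<in> causal _\<close> by (simp, simp add: strict_def)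
    qed
    have maxr: "y - {t} \<in> conf T" if "m = (d, Inr t)" for t d
    proof (rule conf_remove_maximal[OF R.es y])
      fix t' assume "t' \<in> y" "(t, t') \<in> causal T"
      obtain d' where d': "(d', Inr t') \<in> sync \<theta> x y" using sync_total(2)[OF \<theta>(2,3) \<open>t' \<in> y\<close>] by blast
      have "(Inr t, Inr t') \<notin> strict (causal ?E)"
        using m(2)[OF d'] m(1) d' that by (simp add: bij_causal_def del: strict_par_iff)
      then show "t' = t" using \<open>(t, t') \<in> causal _\<close> by (simp, simp add: strict_def)
    qed
    consider (1) s a where "m = (Inl s, Inl a)" | (2) s t where "m = (Inl s, Inr t)"
      | (3) c t where "m = (Inr c, Inr t)"
      using m(1) sync_iff(4) by (metis surj_pair sum.exhaust)
    then show ?thesis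
    proof cases
      case 1
      then have s: "s \<in> x" "disp \<sigma> s = Inl a" using m(1) sync_iff by auto
      have ins: "insert s (x - {s}) = x" using s by blast
      have r: "right \<sigma> (x - {s}) = right \<sigma> x" using left_right_insert_Inl(2)[OF s(2), of "x - {s}"] ins by simp
      have "card (x - {s}) < card x" using card_Diff1_less[OF fin(1) s(1)] .
      then have "P (x - {s}) y \<theta>" using less(1)[of "x - {s}" y \<theta>] maxl[OF 1] y \<theta> r by simp
      then show ?thesis using left[of "x - {s}" s a y \<theta>] maxl[OF 1] x y \<theta> r ins s by simp
    next
      case 3
      then have t: "t \<in> y" "disp \<tau> t = Inr c" using m(1) sync_iff by auto
      have ins: "insert t (y - {t}) = y" using t by blast
      have l: "left \<tau> (y - {t}) = left \<tau> y" using left_right_insert_Inr(1)[OF t(2), of "y - {t}"] ins by simp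
      have "card (y - {t}) < card y" using card_Diff1_less[OF fin(2) t(1)] .
      then have "P x (y - {t}) \<theta>" using less(1)[of x "y - {t}" \<theta>] maxr[OF 3] x \<theta> l by simp
      then show ?thesis using right[of x "y - {t}" t c \<theta>] maxr[OF 3] x y \<theta> l ins t by simp
    next
      case 2
      then obtain b b' where st: "s \<in> x" "t \<in> y" "disp \<sigma> s = Inr b" "disp \<tau> t = Inl b'" "(b, b') \<in> \<theta>"
        using m(1) sync_iff by auto
      have ins: "insert s (x - {s}) = x" "insert t (y - {t}) = y" using st by blast+
      have r: "right \<sigma> x = insert b (right \<sigma> (x - {s}))" "b \<notin> right \<sigma> (x - {s})"
        using left_right_insert_Inr(2)[OF st(3), of "x - {s}"] L.notin_right[of s "x - {s}", OF _ _ st(3)] ins x by auto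
      have l: "left \<tau> y = insert b' (left \<tau> (y - {t}))" "b' \<notin> left \<tau> (y - {t})"
        using left_right_insert_Inl(1)[OF st(4), of "y - {t}"] R.notin_left[of t "y - {t}", OF _ _ st(4)] ins y by auto
      obtain b'' \<theta>' where \<theta>': "\<theta> = insert (b, b'') \<theta>'" "\<theta>' \<in> symm B" "Domain \<theta>' = right \<sigma> (x - {s})" "b'' \<notin> Range \<theta>'"
        using iso_split[OF L.isoB \<theta>(1) \<theta>(2)[unfolded r(1)] r(2) L.right_conf[OF maxl[OF 2]]] by metis
      have b'': "b'' = b'" using iso_fun[OF L.isoB \<theta>(1)] \<theta>'(1) st(5) by blast
      have "insert b' (Range \<theta>') = insert b' (left \<tau> (y - {t}))" using \<theta>(3) l(1) \<theta>'(1) b'' by simp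
      then have R': "Range \<theta>' = left \<tau> (y - {t})" using \<theta>'(4) l(2) b'' by (metis insert_ident)
      have "card (x - {s}) < card x" "card (y - {t}) < card y" 
        using card_Diff1_less[OF fin(1) st(1)] card_Diff1_less[OF fin(2) st(2)] .
      then have "P (x - {s}) (y - {t}) \<theta>'" using less(1)[of "x - {s}" "y - {t}" \<theta>'] maxl[OF 2] maxr[OF 2] \<theta>' R' by simp
      then show ?thesis
        using both[of "x - {s}" s b "y - {t}" t b' \<theta>'] maxl[OF 2] maxr[OF 2] x y \<theta> \<theta>' R' ins st b'' by simp
    qed
  qed
qed

section \<open>Existence and uniqueness of synchronization\<close>

lemma symm_B_sub: "sub_symm B p (symm B)"
  using L.isoB by (simp add: sub_symm_def)

text \<open>Over \<open>A\<close> and \<open>C\<close>, a move of the environment is copied along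
  some extension of the polarized symmetry, and a move of the strategy extends that symmetry because
  of its polarity. Over \<open>B\<close>, the strategy that plays the event chooses its copy, and
  for the other one the same event is a move of the environment. The equation on \<open>B\<close>
  makes the ranges of \<phi> and \<psi> agree there exactly, no longer up to symmetry.\<close>

lemma sync_exists:
  assumes "x \<in> conf S" "y \<in> conf T" "\<theta> \<in> symm B" "Domain \<theta> = right \<sigma> x" "Range \<theta> = left \<tau> y"
  shows "\<exists>\<phi> \<psi>. \<phi> \<in> symm S \<and> Domain \<phi> = x \<and> \<psi> \<in> symm T \<and> Domain \<psi> = y \<and>
    lrel \<sigma> \<phi> \<in> symm_neg A \<and> rrel \<tau> \<psi> \<in> symm_pos C \<and> rrel \<sigma> \<phi> = \<theta> O lrel \<tau> \<psi>"
  using assms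
proof (induction rule: interaction_induct)
  case empty
  have "{} \<in> symm S" "{} \<in> symm T" "{} \<in> symm_neg A" "{} \<in> symm_pos C"
    using iso_Id_on[OF L.iso conf_empty[OF L.es]] iso_Id_on[OF R.iso conf_empty[OF R.es]]
      iso_Id_on[OF tcg_iso_neg conf_empty[OF tcg_es]] iso_Id_on[OF tcg_iso_pos conf_empty[OF tcg_es]]
      L.tcg_left R.tcg_right by auto
  then show ?case by (intro exI[of _ "{}"]) simp
next
  case (left x y \<theta> s a)
  then obtain \<phi> \<psi> where IH: "\<phi> \<in> symm S" "Domain \<phi> = x" "\<psi> \<in> symm T" "Domain \<psi> = y"
    "lrel \<sigma> \<phi> \<in> symm_neg A" "rrel \<tau> \<psi> \<in> symm_pos C" "rrel \<sigma> \<phi> = \<theta> O lrel \<tau> \<psi>" by blast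
  have new: "insert s (Domain \<phi>) \<in> conf S" "s \<notin> Domain \<phi>" using IH(2) left by auto
  have "\<exists>s' a'. insert (s, s') \<phi> \<in> symm S \<and> disp \<sigma> s' = Inl a' \<and> insert (a, a') (lrel \<sigma> \<phi>) \<in> symm_neg A"
  proof (cases "pol A a")
    case Pos
    have "insert a (Domain (lrel \<sigma> \<phi>)) \<in> conf A" "a \<notin> Domain (lrel \<sigma> \<phi>)"
      using L.left_conf[OF new(1)] L.notin_left[OF new left(4)]
      by (simp_all add: L.Domain_lrel[OF IH(1)] left_right_insert_Inl[OF left(4)])
    then obtain a' where a': "insert (a, a') (lrel \<sigma> \<phi>) \<in> symm_neg A"
      using iso_extend[OF L.isoA_neg IH(5)] by metis
    then show ?thesis using L.step_neg_left[OF IH(1) new left(4) Pos] tcg_neg_sub[OF L.tcg_left a'] by metis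
  next
    case Neg
    obtain s' a' where s': "insert (s, s') \<phi> \<in> symm S" "disp \<sigma> s' = Inl a'"
      using L.step_left[OF IH(1) new left(4)] by metis
    have "insert (a, a') (lrel \<sigma> \<phi>) \<in> symm A"
      using L.disp_symm(2)[OF s'(1)] by (simp add: rel_insert_Inl[OF left(4) s'(2)])
    then show ?thesis using s' sub_symm_insert[OF sub_symm_neg[OF L.tcg_left] IH(5) _ Neg] by blast
  qed
  then obtain s' a' where s': "insert (s, s') \<phi> \<in> symm S" "disp \<sigma> s' = Inl a'"
    "insert (a, a') (lrel \<sigma> \<phi>) \<in> symm_neg A" by blast
  then show ?case using IH rel_insert_Inl[OF left(4) s'(2)]
    by (intro exI[of _ "insert (s, s') \<phi>"] exI[of _ \<psi>]) simp
next
  case (right x y \<theta> t c)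
  then obtain \<phi> \<psi> where IH: "\<phi> \<in> symm S" "Domain \<phi> = x" "\<psi> \<in> symm T" "Domain \<psi> = y"
    "lrel \<sigma> \<phi> \<in> symm_neg A" "rrel \<tau> \<psi> \<in> symm_pos C" "rrel \<sigma> \<phi> = \<theta> O lrel \<tau> \<psi>" by blast
  have new: "insert t (Domain \<psi>) \<in> conf T" "t \<notin> Domain \<psi>" using IH(4) right by auto
  have "\<exists>t' c'. insert (t, t') \<psi> \<in> symm T \<and> disp \<tau> t' = Inr c' \<and> insert (c, c') (rrel \<tau> \<psi>) \<in> symm_pos C"
  proof (cases "pol C c")
    case Neg
    have "insert c (Domain (rrel \<tau> \<psi>)) \<in> conf C" "c \<notin> Domain (rrel \<tau> \<psi>)"
      using R.right_conf[OF new(1)] R.notin_right[OF new right(5)]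
      by (simp_all add: R.Domain_rrel[OF IH(3)] left_right_insert_Inr[OF right(5)])
    then obtain c' where c': "insert (c, c') (rrel \<tau> \<psi>) \<in> symm_pos C"
      using iso_extend[OF R.isoB_pos IH(6)] by metis
    then show ?thesis using R.step_neg_right[OF IH(3) new right(5) Neg] tcg_pos_sub[OF R.tcg_right c'] by metis
  next
    case Pos
    obtain t' c' where t': "insert (t, t') \<psi> \<in> symm T" "disp \<tau> t' = Inr c'"
      using R.step_right[OF IH(3) new right(5)] by metis
    have "insert (c, c') (rrel \<tau> \<psi>) \<in> symm C"
      using R.disp_symm(3)[OF t'(1)] by (simp add: rel_insert_Inr[OF right(5) t'(2)])
    then show ?thesis using t' sub_symm_insert[OF sub_symm_pos[OF R.tcg_right] IH(6) _ Pos] by blast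
  qed
  then obtain t' c' where t': "insert (t, t') \<psi> \<in> symm T" "disp \<tau> t' = Inr c'"
    "insert (c, c') (rrel \<tau> \<psi>) \<in> symm_pos C" by blast
  then show ?case using IH rel_insert_Inr[OF right(5) t'(2)]
    by (intro exI[of _ \<phi>] exI[of _ "insert (t, t') \<psi>"]) simp
next
  case (both x y \<theta> s t b b')
  then obtain \<phi> \<psi> where IH: "\<phi> \<in> symm S" "Domain \<phi> = x" "\<psi> \<in> symm T" "Domain \<psi> = y"
    "lrel \<sigma> \<phi> \<in> symm_neg A" "rrel \<tau> \<psi> \<in> symm_pos C" "rrel \<sigma> \<phi> = \<theta> O lrel \<tau> \<psi>" by blast
  note s = both(4) and t = both(8) and \<theta> = both(9-12)
  have news: "insert s (Domain \<phi>) \<in> conf S" "s \<notin> Domain \<phi>" using IH(2) both by auto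
  have newt: "insert t (Domain \<psi>) \<in> conf T" "t \<notin> Domain \<psi>" using IH(4) both by auto
  have b: "b \<notin> Domain \<theta>" using L.notin_right[OF both(2,3) s] \<theta>(3) by simp
  have b': "b' \<notin> Range \<theta>" "b' \<notin> Domain (lrel \<tau> \<psi>)"
    using R.notin_left[OF both(6,7) t] \<theta>(4) R.Domain_lrel[OF IH(3)] IH(4) by auto
  have R: "Range \<theta> = Domain (lrel \<tau> \<psi>)" using \<theta>(4) R.Domain_lrel[OF IH(3)] IH(4) by simp
  have pol: "pol B b' = pol B b" using tcg_pol[OF L.tcg_right \<theta>(2), of b b'] by simp
  have comp: "insert (b, b') \<theta> O insert (b', b'') (lrel \<tau> \<psi>) = insert (b, b'') (rrel \<sigma> \<phi>)" for b''
    using insert_relcomp_insert[OF b'] IH(7) by simp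
  have "\<exists>s' t' b''. insert (s, s') \<phi> \<in> symm S \<and> disp \<sigma> s' = Inr b'' \<and>
    insert (t, t') \<psi> \<in> symm T \<and> disp \<tau> t' = Inl b''"
  proof (cases "pol B b")
    case Pos
    obtain s' b'' where s': "insert (s, s') \<phi> \<in> symm S" "disp \<sigma> s' = Inr b''"
      using L.step_right[OF IH(1) news s] by metis
    have "insert (b, b'') (\<theta> O lrel \<tau> \<psi>) \<in> symm B"
      using L.disp_symm(3)[OF s'(1)] IH(7) by (simp add: rel_insert_Inr[OF s s'(2)])
    \<comment> \<open>Dividing the choice of \<sigma> by \<theta> gives the pair that \<tau> has to
      follow. No polarization is wanted here, so the family is all of \<open>symm B\<close>.\<close>
    then have "insert (b', b'') (lrel \<tau> \<psi>) \<in> symm B"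
      using sub_symm_cancel[OF L.tcg_right symm_B_sub R.disp_symm(2)[OF IH(3)] R _ \<theta>(2) b Pos] by blast
    then obtain t' where "insert (t, t') \<psi> \<in> symm T" "disp \<tau> t' = Inl b''"
      using R.step_neg_left[OF IH(3) newt t] pol Pos by metis
    then show ?thesis using s' by blast
  next
    case Neg
    obtain t' b'' where t': "insert (t, t') \<psi> \<in> symm T" "disp \<tau> t' = Inl b''"
      using R.step_left[OF IH(3) newt t] by metis
    have i: "insert (b', b'') (lrel \<tau> \<psi>) \<in> symm B"
      using R.disp_symm(2)[OF t'(1)] by (simp add: rel_insert_Inl[OF t t'(2)])
    have "Range (insert (b, b') \<theta>) = Domain (insert (b', b'') (lrel \<tau> \<psi>))" using R by simp
    from iso_comp[OF L.isoB \<theta>(2) i this] have "insert (b, b'') (rrel \<sigma> \<phi>) \<in> symm B"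
      unfolding comp .
    then obtain s' where "insert (s, s') \<phi> \<in> symm S" "disp \<sigma> s' = Inr b''"
      using L.step_neg_right[OF IH(1) news s Neg] by metis
    then show ?thesis using t' by blast
  qed
  then obtain s' t' b'' where st: "insert (s, s') \<phi> \<in> symm S" "disp \<sigma> s' = Inr b''"
    "insert (t, t') \<psi> \<in> symm T" "disp \<tau> t' = Inl b''" by blast
  then show ?case using IH comp rel_insert_Inr[OF s st(2)] rel_insert_Inl[OF t st(4)]
    by (intro exI[of _ "insert (s, s') \<phi>"] exI[of _ "insert (t, t') \<psi>"]) simp
qed

text \<open>\<open>rigid\<close> does not apply to either strategy alone, as the symmetry on
  \<open>B\<close> is not polarized. Rigidity is a joint effect: each event over \<open>B\<close> is
  positive for one strategy, where thinness fixes it, and the agreement on \<open>B\<close> then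
  gives the other strategy the equality of displays that receptivity needs.\<close>

lemma sync_unique:
  assumes "\<omega> \<in> symm S" "\<chi> \<in> symm T" "right \<sigma> (Domain \<omega>) = left \<tau> (Domain \<chi>)"
    and "lrel \<sigma> \<omega> \<in> symm_neg A" "rrel \<tau> \<chi> \<in> symm_pos C" "rrel \<sigma> \<omega> = lrel \<tau> \<chi>"
  shows "\<omega> = Id_on (Domain \<omega>) \<and> \<chi> = Id_on (Domain \<chi>)"
proof -
  \<comment> \<open>\<open>interaction_induct\<close> ranges over the symmetries linking the two
    sides. Exact agreement on \<open>B\<close> is the case \<theta> \<subseteq> Id, a condition that
    passes to smaller \<theta>.\<close>
  have key: "\<theta> \<subseteq> Id \<longrightarrow> (\<forall>\<omega>\<in>symm S. \<forall>\<chi>\<in>symm T. Domain \<omega> = x \<and> Domain \<chi> = y \<and>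
      lrel \<sigma> \<omega> \<in> symm_neg A \<and> rrel \<tau> \<chi> \<in> symm_pos C \<and> rrel \<sigma> \<omega> = lrel \<tau> \<chi> \<longrightarrow> \<omega> = Id_on x \<and> \<chi> = Id_on y)"
    if "x \<in> conf S" "y \<in> conf T" "\<theta> \<in> symm B" "Domain \<theta> = right \<sigma> x" "Range \<theta> = left \<tau> y"
    for x y \<theta> using that
  proof (induction rule: interaction_induct)
    case empty
    then show ?case by auto
  next
    case (left x y \<theta> s a)
    show ?case
    proof (intro impI ballI, elim conjE)
      fix \<omega> \<chi> assume \<theta>: "\<theta> \<subseteq> Id" and \<omega>: "\<omega> \<in> symm S" "\<chi> \<in> symm T" "Domain \<omega> = insert s x" "Domain \<chi> = y"
        "lrel \<sigma> \<omega> \<in> symm_neg A" "rrel \<tau> \<chi> \<in> symm_pos C" "rrel \<sigma> \<omega> = lrel \<tau> \<chi>"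
      obtain s' a' \<omega>' where *: "\<omega> = insert (s, s') \<omega>'" "\<omega>' \<in> symm S" "Domain \<omega>' = x"
        "rrel \<sigma> \<omega> = rrel \<sigma> \<omega>'" "lrel \<sigma> \<omega> \<in> symm_neg A \<Longrightarrow> lrel \<sigma> \<omega>' \<in> symm_neg A"
        using L.split_left[OF \<omega>(1,3) left(3,1,4)] by metis
      then have "\<omega>' = Id_on x" "\<chi> = Id_on y" using left(9) \<theta> \<omega> by auto
      then show "\<omega> = Id_on (insert s x) \<and> \<chi> = Id_on y"
        using L.step_unique_left[OF _ left(1,3,4), of s'] \<omega> * by auto
    qed
  next
    case (right x y \<theta> t c)
    show ?case
    proof (intro impI ballI, elim conjE)
      fix \<omega> \<chi> assume \<theta>: "\<theta> \<subseteq> Id" and \<omega>: "\<omega> \<in> symm S" "\<chi> \<in> symm T" "Domain \<omega> = x" "Domain \<chi> = insert t y"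
        "lrel \<sigma> \<omega> \<in> symm_neg A" "rrel \<tau> \<chi> \<in> symm_pos C" "rrel \<sigma> \<omega> = lrel \<tau> \<chi>"
      obtain t' c' \<chi>' where *: "\<chi> = insert (t, t') \<chi>'" "\<chi>' \<in> symm T" "Domain \<chi>' = y"
        "lrel \<tau> \<chi> = lrel \<tau> \<chi>'" "rrel \<tau> \<chi> \<in> symm_pos C \<Longrightarrow> rrel \<tau> \<chi>' \<in> symm_pos C"
        using R.split_right[OF \<omega>(2,4) right(4,2,5)] by metis
      then have "\<omega> = Id_on x" "\<chi>' = Id_on y" using right(9) \<theta> \<omega> by auto
      then show "\<omega> = Id_on x \<and> \<chi> = Id_on (insert t y)"
        using R.step_unique_right[OF _ right(2,4,5), of t'] \<omega> * by auto
    qed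
  next
    case (both x y \<theta> s t b b')
    note s = both(4) and t = both(8)
    show ?case
    proof (intro impI ballI, elim conjE)
      fix \<omega> \<chi> assume \<theta>: "insert (b, b') \<theta> \<subseteq> Id" and \<omega>: "\<omega> \<in> symm S" "\<chi> \<in> symm T"
        "Domain \<omega> = insert s x" "Domain \<chi> = insert t y"
        "lrel \<sigma> \<omega> \<in> symm_neg A" "rrel \<tau> \<chi> \<in> symm_pos C" "rrel \<sigma> \<omega> = lrel \<tau> \<chi>"
      have bb: "b' = b" using \<theta> by auto
      obtain s' b1 \<omega>' where w: "\<omega> = insert (s, s') \<omega>'" "\<omega>' \<in> symm S" "Domain \<omega>' = x" "disp \<sigma> s' = Inr b1"
        "lrel \<sigma> \<omega> = lrel \<sigma> \<omega>'" "rrel \<sigma> \<omega> = insert (b, b1) (rrel \<sigma> \<omega>')"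
        using L.split_right[OF \<omega>(1,3) both(3,1) s] by metis
      obtain t' b2 \<chi>' where v: "\<chi> = insert (t, t') \<chi>'" "\<chi>' \<in> symm T" "Domain \<chi>' = y" "disp \<tau> t' = Inl b2"
        "lrel \<tau> \<chi> = insert (b, b2) (lrel \<tau> \<chi>')" "rrel \<tau> \<chi> = rrel \<tau> \<chi>'"
        using R.split_left[OF \<omega>(2,4) both(7,5) t] bb by metis
      have "b \<notin> Domain (rrel \<sigma> \<omega>')" using L.notin_right[OF both(2,3) s] L.Domain_rrel[OF w(2)] w(3) by simp
      moreover have "b \<notin> Domain (lrel \<tau> \<chi>')" using R.notin_left[OF both(6,7) t] R.Domain_lrel[OF v(2)] v(3) bb by simp
      moreover have eq: "insert (b, b1) (rrel \<sigma> \<omega>') = insert (b, b2) (lrel \<tau> \<chi>')" using w(6) v(5) \<omega>(7) by simp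
      \<comment> \<open>Since \<open>b\<close> lies in neither domain, the equality of the two
        insertions splits into one for the new pairs and one for the rests.\<close>
      ultimately have "b1 = b2" "rrel \<sigma> \<omega>' = lrel \<tau> \<chi>'" by (blast, metis Domain.DomainI insert_ident insertE insertI1 prod.inject)
      then have IH: "\<omega>' = Id_on x" "\<chi>' = Id_on y" using both(13) \<theta> \<omega>(5,6) w v by auto
      have ev: "s \<in> events S" "t \<in> events T" using L.conf_events[OF both(2)] R.conf_events[OF both(6)] by auto
      have ww: "insert (s, s') (Id_on x) \<in> symm S" "insert (t, t') (Id_on y) \<in> symm T"
        using \<omega>(1,2) w(1) v(1) IH by auto
      have "s' = s \<and> t' = t"
      proof (cases "pol B b")
        case Pos
        then have "s' = s" using L.step_unique[OF ww(1) both(1,3)] L.pol_Inr[OF ev(1) s] by simp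
        then have "disp \<tau> t = disp \<tau> t'" using w(4) s v(4) t bb \<open>b1 = b2\<close> by simp
        then show ?thesis using R.step_unique[OF ww(2) both(5,7)] \<open>s' = s\<close> by simp
      next
        case Neg
        then have "t' = t" using R.step_unique[OF ww(2) both(5,7)] R.pol_Inl[OF ev(2) t] bb by simp
        then have "disp \<sigma> s = disp \<sigma> s'" using w(4) s v(4) t bb \<open>b1 = b2\<close> by simp
        then show ?thesis using L.step_unique[OF ww(1) both(1,3)] \<open>t' = t\<close> by simp
      qed
      then show "\<omega> = Id_on (insert s x) \<and> \<chi> = Id_on (insert t y)" using w(1) v(1) IH by auto
    qed
  qed
  have c: "Domain \<omega> \<in> conf S" "Domain \<chi> \<in> conf T"
    using iso_Domain[OF L.iso assms(1)] iso_Domain[OF R.iso assms(2)] by auto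
  let ?I = "Id_on (right \<sigma> (Domain \<omega>))"
  have I: "?I \<in> symm B" using iso_Id_on[OF L.isoB L.right_conf[OF c(1)]] .
  have R: "Range ?I = left \<tau> (Domain \<chi>)" using assms(3) by auto
  have "?I \<subseteq> Id" by auto
  from key[OF c I Domain_Id_on R, THEN mp, OF this] show ?thesis using assms by blast
qed

end

section \<open>Interaction and hiding\<close>

text \<open>The assumptions speak of configurations only. For parallel compositions they are checked
  component by component, without establishing the event structure axioms for the composite.\<close>

locale sync_pullback =
  fixes D :: "('d, 'm) ess_scheme" and E :: "('e, 'n) ess_scheme" and f :: "'d \<Rightarrow> 'g" and g :: "'e \<Rightarrow> 'g"
  assumes fin_left: "x \<in> conf D \<Longrightarrow> finite x" and fin_right: "y \<in> conf E \<Longrightarrow> finite y"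
    and sub_left: "x \<in> conf D \<Longrightarrow> x' \<subseteq> x \<Longrightarrow> (\<And>d d'. d \<in> x' \<Longrightarrow> (d', d) \<in> causal D \<Longrightarrow> d' \<in> x') \<Longrightarrow> x' \<in> conf D"
    and sub_right: "y \<in> conf E \<Longrightarrow> y' \<subseteq> y \<Longrightarrow> (\<And>e e'. e \<in> y' \<Longrightarrow> (e', e) \<in> causal E \<Longrightarrow> e' \<in> y') \<Longrightarrow> y' \<in> conf E"
    and inj_right: "y \<in> conf E \<Longrightarrow> inj_on g y"
begin

text \<open>For a state \<phi> and a pair \<open>p\<close> in it, this is the prime state generated
  by \<open>p\<close>: the event of the pullback that stands for \<open>p\<close>.\<close>

definition cone :: "('d \<times> 'e) set \<Rightarrow> 'd \<times> 'e \<Rightarrow> ('d \<times> 'e) set" where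
  "cone \<phi> p = {q \<in> \<phi>. (q, p) \<in> (bij_causal D E \<phi>)\<^sup>*}"

definition maximal :: "('d \<times> 'e) set \<Rightarrow> 'd \<times> 'e \<Rightarrow> bool" where
  "maximal \<phi> p \<longleftrightarrow> p \<in> \<phi> \<and> (\<forall>q. (p, q) \<notin> bij_causal D E \<phi>)"

text \<open>A state is recovered from its graph alone: as \<open>g\<close> is injective on
  configurations, commutation over the two projections leaves no further pair to add.\<close>

lemma sync_states_iff:
  "\<phi> \<in> sync_states D E f g \<longleftrightarrow> fst ` \<phi> \<in> conf D \<and> snd ` \<phi> \<in> conf E \<and> (\<forall>(d, e)\<in>\<phi>. f d = g e) \<and> secured D E \<phi>"
proof
  assume "\<phi> \<in> sync_states D E f g"
  then obtain x y where \<phi>: "\<phi> = bij_via f g Id x y" "x \<in> conf D" "y \<in> conf E" "f ` x = g ` y" "secured D E \<phi>"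
    unfolding sync_states_def by auto
  have "d \<in> fst ` \<phi>" if "d \<in> x" for d
  proof -
    have "f d \<in> g ` y" using that \<phi>(4) by auto
    then show ?thesis using that unfolding \<phi>(1) bij_via_def by force
  qed
  moreover have "e \<in> snd ` \<phi>" if "e \<in> y" for e
  proof -
    have "g e \<in> f ` x" using that \<phi>(4) by auto
    then show ?thesis using that unfolding \<phi>(1) bij_via_def by force
  qed
  moreover have "fst ` \<phi> \<subseteq> x" "snd ` \<phi> \<subseteq> y" "\<forall>(d, e)\<in>\<phi>. f d = g e"
    unfolding \<phi>(1) bij_via_def by auto
  ultimately have "fst ` \<phi> = x" "snd ` \<phi> = y" by auto
  then show "fst ` \<phi> \<in> conf D \<and> snd ` \<phi> \<in> conf E \<and> (\<forall>(d, e)\<in>\<phi>. f d = g e) \<and> secured D E \<phi>"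
    using \<phi> \<open>\<forall>(d, e)\<in>\<phi>. f d = g e\<close> by simp
next
  assume \<phi>: "fst ` \<phi> \<in> conf D \<and> snd ` \<phi> \<in> conf E \<and> (\<forall>(d, e)\<in>\<phi>. f d = g e) \<and> secured D E \<phi>"
  have fg: "f d = g e" if "(d, e) \<in> \<phi>" for d e using \<phi> that by auto
  have "\<phi> = bij_via f g Id (fst ` \<phi>) (snd ` \<phi>)"
  proof (intro equalityI subsetI)
    fix p assume "p \<in> \<phi>"
    then show "p \<in> bij_via f g Id (fst ` \<phi>) (snd ` \<phi>)"
      using fg by (cases p) (force simp: bij_via_def)
  next
    fix p assume "p \<in> bij_via f g Id (fst ` \<phi>) (snd ` \<phi>)"
    then obtain d e where p: "p = (d, e)" "d \<in> fst ` \<phi>" "e \<in> snd ` \<phi>" "f d = g e"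
      by (auto simp: bij_via_def)
    from p(2) obtain e' where e': "(d, e') \<in> \<phi>" by force
    have "g e' = g e" using fg[OF e'] p(4) by simp
    then have "e' = e" using inj_onD[OF inj_right, of "snd ` \<phi>" e' e] \<phi> p(3) e' by force
    then show "p \<in> \<phi>" using e' p(1) by simp
  qed
  moreover have "f ` fst ` \<phi> = g ` snd ` \<phi>"
    using fg unfolding image_image by (intro image_cong refl) auto
  ultimately show "\<phi> \<in> sync_states D E f g"
    using \<phi> unfolding sync_states_def by (intro CollectI exI[of _ "fst ` \<phi>"] exI[of _ "snd ` \<phi>"]) auto
qed

context
  fixes \<phi> assumes state: "\<phi> \<in> sync_states D E f g"
begin

lemma state_conf: "fst ` \<phi> \<in> conf D" "snd ` \<phi> \<in> conf E"
  using state by (auto simp: sync_states_iff)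

lemma state_finite: "finite \<phi>"
proof (rule finite_subset)
  show "\<phi> \<subseteq> fst ` \<phi> \<times> snd ` \<phi>" by force
  show "finite (fst ` \<phi> \<times> snd ` \<phi>)" using fin_left fin_right state_conf by simp
qed

lemma state_fun: "(d, e) \<in> \<phi> \<Longrightarrow> (d, e') \<in> \<phi> \<Longrightarrow> e = e'"
  and state_inj: "(d, e) \<in> \<phi> \<Longrightarrow> (d', e) \<in> \<phi> \<Longrightarrow> d = d'"
  using state unfolding sync_states_iff secured_def single_valued_def by blast+

lemma state_acyclic: "acyclic (bij_causal D E \<phi>)"
  using state unfolding sync_states_iff secured_def by blast

lemma state_antisym:
  "(p, q) \<in> (bij_causal D E \<phi>)\<^sup>* \<Longrightarrow> (q, p) \<in> (bij_causal D E \<phi>)\<^sup>* \<Longrightarrow> p = q"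
  using acyclic_impl_antisym_rtrancl[OF state_acyclic] by (auto dest: antisymD)

lemma below_maximal:
  assumes "p \<in> \<phi>"
  obtains m where "maximal \<phi> m" "(p, m) \<in> (bij_causal D E \<phi>)\<^sup>*"
proof -
  let ?X = "{m \<in> \<phi>. (p, m) \<in> (bij_causal D E \<phi>)\<^sup>*}"
  have "p \<in> ?X" using assms by simp
  then have "finite ?X" "?X \<noteq> {}" using state_finite by (simp, blast)
  moreover have "acyclic (bij_causal D E \<phi> \<inter> ?X \<times> ?X)"
    using state_acyclic by (rule acyclic_subset) blast
  ultimately obtain m where m: "m \<in> ?X" "\<And>q. q \<in> ?X \<Longrightarrow> (m, q) \<notin> bij_causal D E \<phi>"
    by (rule finite_acyclic_maximal) blast
  have "(m, q) \<notin> bij_causal D E \<phi>" for q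
  proof
    assume mq: "(m, q) \<in> bij_causal D E \<phi>"
    then have "q \<in> ?X" using m(1) rtrancl_into_rtrancl[of p m _ q] by (auto simp: bij_causal_def)
    then show False using m(2) mq by blast
  qed
  then show ?thesis using that m(1) unfolding maximal_def by blast
qed

text \<open>A causal step into \<psi> comes from one of the two sides, where the projection of
  \<psi> is down-closed. The event found there has the same partner in \<psi> as in \<phi>, because
  \<phi> is a bijection.\<close>

lemma substate_closed:
  assumes "\<psi> \<in> sync_states D E f g" "\<psi> \<subseteq> \<phi>" "(q, p) \<in> (bij_causal D E \<phi>)\<^sup>*" "p \<in> \<psi>"
  shows "q \<in> \<psi> \<and> (q, p) \<in> (bij_causal D E \<psi>)\<^sup>*"
  using assms(3)
proof (induction rule: converse_rtrancl_induct)
  case base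
  then show ?case using assms(4) by simp
next
  case (step q r)
  obtain d e d' e' where [simp]: "q = (d, e)" "r = (d', e')" by fastforce
  have qr: "(d, e) \<in> \<phi>" "(d', e') \<in> \<psi>" "(d, d') \<in> strict (causal D) \<or> (e, e') \<in> strict (causal E)"
    using step by (auto simp: bij_causal_def)
  have cl: "fst ` \<psi> \<in> conf D" "snd ` \<psi> \<in> conf E" using assms(1) by (auto simp: sync_states_iff)
  have "(d, e) \<in> \<psi>" using qr(3)
  proof
    assume "(d, d') \<in> strict (causal D)"
    then have "d \<in> fst ` \<psi>" using conf_downD[OF cl(1), of d' d] qr(2) by (force simp: strict_def)
    then show ?thesis using state_fun[OF qr(1)] assms(2) by force
  next
    assume "(e, e') \<in> strict (causal E)"
    then have "e \<in> snd ` \<psi>" using conf_downD[OF cl(2), of e' e] qr(2) by (force simp: strict_def)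
    then show ?thesis using state_inj[OF qr(1)] assms(2) by force
  qed
  moreover have "(q, r) \<in> bij_causal D E \<psi>" using qr calculation by (auto simp: bij_causal_def)
  ultimately show ?case using step.IH by (auto intro: converse_rtrancl_into_rtrancl)
qed

lemma cone_subset: "cone \<phi> p \<subseteq> \<phi>"
  by (auto simp: cone_def)

lemma cone_state: "cone \<phi> p \<in> sync_states D E f g"
proof -
  have closed: "q \<in> cone \<phi> p" if "(q, r) \<in> bij_causal D E \<phi>" "r \<in> cone \<phi> p" for q r
    using that by (auto simp: cone_def bij_causal_def intro: converse_rtrancl_into_rtrancl)
  have "fst ` cone \<phi> p \<in> conf D"
  proof (rule sub_left[OF state_conf(1)])
    show "fst ` cone \<phi> p \<subseteq> fst ` \<phi>" by (auto simp: cone_def)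
    fix d d' assume "d \<in> fst ` cone \<phi> p" and le: "(d', d) \<in> causal D"
    then obtain e where e: "(d, e) \<in> cone \<phi> p" by force
    then have "d \<in> fst ` \<phi>" by (force simp: cone_def)
    then have "d' \<in> fst ` \<phi>" using conf_downD[OF state_conf(1) _ le] by blast
    then obtain e' where e': "(d', e') \<in> \<phi>" by force
    show "d' \<in> fst ` cone \<phi> p"
    proof (cases "d' = d")
      case False
      then have "((d', e'), (d, e)) \<in> bij_causal D E \<phi>"
        using le e e' by (auto simp: bij_causal_def strict_def cone_def)
      then show ?thesis using closed e by force
    qed (use e in force)
  qed
  moreover have "snd ` cone \<phi> p \<in> conf E"
  proof (rule sub_right[OF state_conf(2)])
    show "snd ` cone \<phi> p \<subseteq> snd ` \<phi>" by (auto simp: cone_def)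
    fix e e' assume "e \<in> snd ` cone \<phi> p" and le: "(e', e) \<in> causal E"
    then obtain d where d: "(d, e) \<in> cone \<phi> p" by force
    then have "e \<in> snd ` \<phi>" by (force simp: cone_def)
    then have "e' \<in> snd ` \<phi>" using conf_downD[OF state_conf(2) _ le] by blast
    then obtain d' where d': "(d', e') \<in> \<phi>" by force
    show "e' \<in> snd ` cone \<phi> p"
    proof (cases "e' = e")
      case False
      then have "((d', e'), (d, e)) \<in> bij_causal D E \<phi>"
        using le d d' by (auto simp: bij_causal_def strict_def cone_def)
      then show ?thesis using closed d by force
    qed (use d in force)
  qed
  moreover have "secured D E (cone \<phi> p)"
  proof -
    have "bij_causal D E (cone \<phi> p) \<subseteq> bij_causal D E \<phi>"
      using cone_subset[of p] by (auto simp: bij_causal_def)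
    then have "acyclic (bij_causal D E (cone \<phi> p))" by (rule acyclic_subset[OF state_acyclic])
    moreover have "single_valued (cone \<phi> p)" "single_valued ((cone \<phi> p)\<inverse>)"
      using state_fun state_inj cone_subset[of p] unfolding single_valued_def by blast+
    ultimately show ?thesis by (simp add: secured_def)
  qed
  moreover have "\<forall>(d, e)\<in>cone \<phi> p. f d = g e"
    using state by (auto simp: sync_states_iff cone_def)
  ultimately show ?thesis by (simp add: sync_states_iff)
qed

lemma cone_is_top: "p \<in> \<phi> \<Longrightarrow> is_top D E (cone \<phi> p) p"
  using substate_closed[OF cone_state cone_subset] by (auto simp: is_top_def cone_def)

lemma top_pair_eq:
  assumes "is_top D E \<phi> p"
  shows "top_pair D E \<phi> = p"
  unfolding top_pair_def using assms
proof (rule the_equality)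
  fix q assume "is_top D E \<phi> q"
  then show "q = p" using assms state_antisym unfolding is_top_def by blast
qed

text \<open>An event of the pullback inside \<phi> is therefore determined by its top, which makes
  the events inside \<phi> correspond to its pairs.\<close>

lemma substate_cone:
  assumes "\<psi> \<in> sync_states D E f g" "\<psi> \<subseteq> \<phi>" "is_top D E \<psi> p"
  shows "\<psi> = cone \<phi> p"
proof
  have "bij_causal D E \<psi> \<subseteq> bij_causal D E \<phi>" using assms(2) by (auto simp: bij_causal_def)
  then show "\<psi> \<subseteq> cone \<phi> p"
    using assms(2,3) rtrancl_mono unfolding is_top_def cone_def by blast
  show "cone \<phi> p \<subseteq> \<psi>"
    using substate_closed[OF assms(1,2)] assms(3) unfolding is_top_def cone_def by blast
qed

end

lemma top_pair_cone: "\<phi> \<in> sync_states D E f g \<Longrightarrow> p \<in> \<phi> \<Longrightarrow> top_pair D E (cone \<phi> p) = p"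
  by (rule top_pair_eq[OF cone_state cone_is_top])

lemma cone_mono:
  "(p, q) \<in> (bij_causal D E \<phi>)\<^sup>* \<Longrightarrow> cone \<phi> p \<subseteq> cone \<phi> q"
  by (auto simp: cone_def)

section \<open>Hiding in the pullback\<close>

context
  fixes v :: "'d \<times> 'e \<Rightarrow> bool"
begin

abbreviation hidden :: "('d \<times> 'e) set ess" where
  "hidden \<equiv> hide (pullback D E f g) {\<psi>. v (top_pair D E \<psi>)}"

lemma hidden_consis_iff:
  "X \<in> consis hidden \<longleftrightarrow> finite X \<and> \<Union>X \<in> sync_states D E f g \<and>
     (\<forall>\<psi>\<in>X. \<psi> \<in> sync_states D E f g \<and> (\<exists>p. is_top D E \<psi> p) \<and> v (top_pair D E \<psi>))"
  by (auto simp: hide_def hide_es_def pullback_def pullback_es_def Let_def)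

lemma hidden_causal_iff:
  "(\<psi>, \<psi>') \<in> causal hidden \<longleftrightarrow> \<psi> \<subseteq> \<psi>' \<and>
     \<psi> \<in> sync_states D E f g \<and> (\<exists>p. is_top D E \<psi> p) \<and> v (top_pair D E \<psi>) \<and>
     \<psi>' \<in> sync_states D E f g \<and> (\<exists>p. is_top D E \<psi>' p) \<and> v (top_pair D E \<psi>')"
  by (auto simp: hide_def hide_es_def pullback_def pullback_es_def Let_def)

text \<open>The configuration left of the state \<phi> after hiding. It is inverse to
  \<open>Union\<close> on the states whose maximal pairs are visible.\<close>

definition visible_cones :: "('d \<times> 'e) set \<Rightarrow> ('d \<times> 'e) set set" where
  "visible_cones \<phi> = cone \<phi> ` {p \<in> \<phi>. v p}"

lemma visible_cone:
  assumes "\<phi> \<in> sync_states D E f g" "p \<in> \<phi>" "v p"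
  shows "cone \<phi> p \<in> sync_states D E f g \<and> (\<exists>q. is_top D E (cone \<phi> p) q) \<and> v (top_pair D E (cone \<phi> p))"
  using cone_state[OF assms(1)] cone_is_top[OF assms(1,2)] top_pair_cone[OF assms(1,2)] assms(3)
  by (simp del: split_paired_Ex) blast

context
  fixes X assumes conf: "X \<in> conf hidden"
begin

lemma hidden_state: "\<Union>X \<in> sync_states D E f g"
  using conf by (auto simp: conf_def hidden_consis_iff)

lemma hidden_member:
  assumes "\<psi> \<in> X"
  obtains p where "p \<in> \<Union>X" "v p" "\<psi> = cone (\<Union>X) p"
proof -
  have \<psi>: "\<psi> \<in> sync_states D E f g" "\<exists>p. is_top D E \<psi> p" "v (top_pair D E \<psi>)"
    using conf assms by (auto simp: conf_def hidden_consis_iff)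
  then obtain p where p: "is_top D E \<psi> p" by blast
  have "\<psi> = cone (\<Union>X) p" using substate_cone[OF hidden_state \<psi>(1) _ p] assms by blast
  moreover have "v p" using \<psi>(3) top_pair_eq[OF \<psi>(1) p] by simp
  moreover have "p \<in> \<Union>X" using p assms by (auto simp: is_top_def)
  ultimately show ?thesis using that by blast
qed

text \<open>A visible pair of the union lies in some member, which then includes its cone. Causality
  is inclusion, so down-closure puts the cone into \<open>X\<close>.\<close>

lemma hidden_visible_cones: "X = visible_cones (\<Union>X)"
proof (intro equalityI subsetI)
  fix \<psi> assume "\<psi> \<in> X"
  then show "\<psi> \<in> visible_cones (\<Union>X)"
    using hidden_member unfolding visible_cones_def by blast
next
  fix \<psi> assume "\<psi> \<in> visible_cones (\<Union>X)"
  then obtain p where p: "p \<in> \<Union>X" "v p" "\<psi> = cone (\<Union>X) p" by (auto simp: visible_cones_def)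
  then obtain \<chi> where \<chi>: "\<chi> \<in> X" "p \<in> \<chi>" by blast
  have c: "\<chi> \<in> sync_states D E f g" "\<exists>p. is_top D E \<chi> p" "v (top_pair D E \<chi>)"
    using conf \<chi>(1) by (auto simp: conf_def hidden_consis_iff)
  have "cone (\<Union>X) p \<subseteq> \<chi>"
    using substate_closed[OF hidden_state c(1) _ _ \<chi>(2)] \<chi>(1) by (auto simp: cone_def)
  then have "(\<psi>, \<chi>) \<in> causal hidden"
    using visible_cone[OF hidden_state p(1,2)] c p(3) by (auto simp: hidden_causal_iff)
  then show "\<psi> \<in> X" by (rule conf_downD[OF conf \<chi>(1)])
qed

text \<open>Each member of \<open>X\<close> is a cone with a visible top, and a maximal pair can
  belong to a cone only as its top.\<close>

lemma hidden_maximal_visible: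
  assumes "maximal (\<Union>X) m"
  shows "v m"
proof -
  obtain \<chi> where "\<chi> \<in> X" "m \<in> \<chi>" using assms by (auto simp: maximal_def)
  then obtain p where p: "p \<in> \<Union>X" "v p" "\<chi> = cone (\<Union>X) p" using hidden_member by blast
  then have "(m, p) \<in> (bij_causal D E (\<Union>X))\<^sup>*" using \<open>m \<in> \<chi>\<close> by (auto simp: cone_def)
  then have "m = p" using assms unfolding maximal_def by (meson converse_rtranclE)
  then show ?thesis using p(2) by simp
qed

text \<open>Above a visible pair there is a maximal one, again visible, so its cone is a member of
  \<open>X\<close> lying above the cone of the given pair. Since cones determine their tops, the two
  coincide exactly when the pair is maximal.\<close>

lemma hidden_maximal_iff:
  assumes "p \<in> \<Union>X" "v p"
  shows "(\<forall>\<psi>\<in>X. (cone (\<Union>X) p, \<psi>) \<in> causal hidden \<longrightarrow> \<psi> = cone (\<Union>X) p) \<longleftrightarrow> maximal (\<Union>X) p"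
proof
  assume L: "\<forall>\<psi>\<in>X. (cone (\<Union>X) p, \<psi>) \<in> causal hidden \<longrightarrow> \<psi> = cone (\<Union>X) p"
  obtain m where m: "maximal (\<Union>X) m" "(p, m) \<in> (bij_causal D E (\<Union>X))\<^sup>*"
    using below_maximal[OF hidden_state assms(1)] .
  then have vm: "m \<in> \<Union>X" "v m" using hidden_maximal_visible by (auto simp: maximal_def)
  then have "cone (\<Union>X) m \<in> X" using hidden_visible_cones by (auto simp: visible_cones_def)
  moreover have "(cone (\<Union>X) p, cone (\<Union>X) m) \<in> causal hidden"
    using visible_cone[OF hidden_state assms] visible_cone[OF hidden_state vm] cone_mono[OF m(2)]
    by (simp add: hidden_causal_iff)
  ultimately have "cone (\<Union>X) m = cone (\<Union>X) p" using L by blast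
  then have "m = p" using top_pair_cone[OF hidden_state] vm(1) assms(1) by metis
  then show "maximal (\<Union>X) p" using m(1) by simp
next
  assume R: "maximal (\<Union>X) p"
  show "\<forall>\<psi>\<in>X. (cone (\<Union>X) p, \<psi>) \<in> causal hidden \<longrightarrow> \<psi> = cone (\<Union>X) p"
  proof (intro ballI impI)
    fix \<psi> assume "\<psi> \<in> X" and le: "(cone (\<Union>X) p, \<psi>) \<in> causal hidden"
    then obtain q where q: "\<psi> = cone (\<Union>X) q" using hidden_member by blast
    have "p \<in> cone (\<Union>X) p" using assms(1) by (simp add: cone_def)
    then have "(p, q) \<in> (bij_causal D E (\<Union>X))\<^sup>*" using le q by (auto simp: hidden_causal_iff cone_def)
    then have "p = q" using R unfolding maximal_def by (meson converse_rtranclE)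
    then show "\<psi> = cone (\<Union>X) p" using q by simp
  qed
qed

lemma hidden_tops: "top_pair D E ` X = {p \<in> \<Union>X. v p}"
proof -
  have "top_pair D E ` X = (\<lambda>p. top_pair D E (cone (\<Union>X) p)) ` {p \<in> \<Union>X. v p}"
    by (subst hidden_visible_cones) (simp add: visible_cones_def image_image)
  also have "\<dots> = (\<lambda>p. p) ` {p \<in> \<Union>X. v p}"
    using top_pair_cone[OF hidden_state] by (intro image_cong refl) simp
  finally show ?thesis by simp
qed

end

lemma visible_cones_conf:
  assumes "\<phi> \<in> sync_states D E f g" "\<And>m. maximal \<phi> m \<Longrightarrow> v m"
  shows "\<Union>(visible_cones \<phi>) = \<phi>" and "visible_cones \<phi> \<in> conf hidden"
proof -
  show U: "\<Union>(visible_cones \<phi>) = \<phi>"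
  proof
    show "\<Union>(visible_cones \<phi>) \<subseteq> \<phi>" by (auto simp: visible_cones_def cone_def)
    show "\<phi> \<subseteq> \<Union>(visible_cones \<phi>)"
    proof
      fix p assume "p \<in> \<phi>"
      then obtain m where "maximal \<phi> m" "(p, m) \<in> (bij_causal D E \<phi>)\<^sup>*"
        using below_maximal[OF assms(1)] by metis
      then show "p \<in> \<Union>(visible_cones \<phi>)"
        using assms(2)[of m] \<open>p \<in> \<phi>\<close> unfolding visible_cones_def cone_def maximal_def by blast
    qed
  qed
  have "visible_cones \<phi> \<in> consis hidden"
    unfolding hidden_consis_iff U using assms(1) state_finite[OF assms(1)] visible_cone[OF assms(1)]
    by (auto simp: visible_cones_def)
  moreover have "\<psi> \<in> visible_cones \<phi>" if "\<chi> \<in> visible_cones \<phi>" "(\<psi>, \<chi>) \<in> causal hidden" for \<psi> \<chi>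
  proof -
    have \<psi>: "\<psi> \<subseteq> \<chi>" "\<psi> \<in> sync_states D E f g" "v (top_pair D E \<psi>)"
      using that(2) by (auto simp: hidden_causal_iff)
    from that(2) obtain p where p: "is_top D E \<psi> p" by (auto simp: hidden_causal_iff)
    have "\<psi> \<subseteq> \<phi>" using \<psi>(1) that(1) U by blast
    then have "\<psi> = cone \<phi> p" "p \<in> \<phi>"
      using substate_cone[OF assms(1) \<psi>(2) _ p] p by (auto simp: is_top_def)
    moreover have "v p" using top_pair_eq[OF \<psi>(2) p] \<psi>(3) by simp
    ultimately show ?thesis by (auto simp: visible_cones_def)
  qed
  ultimately show "visible_cones \<phi> \<in> conf hidden" by (auto simp: conf_def)
qed

text \<open>States whose maximal pairs are visible are those generated by their visible pairs, so
  hiding loses nothing on them. \<open>Q\<close> will be positivity, which turns the left side into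
  the \<open>+\<close>-covered configurations of the composite.\<close>

lemma hidden_bij:
  "bij_betw Union
     {X \<in> conf hidden. \<forall>\<psi>\<in>X. (\<forall>\<psi>'\<in>X. (\<psi>, \<psi>') \<in> causal hidden \<longrightarrow> \<psi>' = \<psi>) \<longrightarrow> Q (top_pair D E \<psi>)}
     {\<phi> \<in> sync_states D E f g. \<forall>m. maximal \<phi> m \<longrightarrow> v m \<and> Q m}"
proof -
  have Q_iff: "(\<forall>\<psi>\<in>X. (\<forall>\<psi>'\<in>X. (\<psi>, \<psi>') \<in> causal hidden \<longrightarrow> \<psi>' = \<psi>) \<longrightarrow> Q (top_pair D E \<psi>)) \<longleftrightarrow>
      (\<forall>m. maximal (\<Union>X) m \<longrightarrow> Q m)" if X: "X \<in> conf hidden" for X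
  proof
    assume L: "\<forall>\<psi>\<in>X. (\<forall>\<psi>'\<in>X. (\<psi>, \<psi>') \<in> causal hidden \<longrightarrow> \<psi>' = \<psi>) \<longrightarrow> Q (top_pair D E \<psi>)"
    show "\<forall>m. maximal (\<Union>X) m \<longrightarrow> Q m"
    proof (intro allI impI)
      fix m assume m: "maximal (\<Union>X) m"
      have vm: "m \<in> \<Union>X" "v m" using m hidden_maximal_visible[OF X] by (auto simp: maximal_def)
      then have "cone (\<Union>X) m \<in> X" using hidden_visible_cones[OF X] by (auto simp: visible_cones_def)
      then have "Q (top_pair D E (cone (\<Union>X) m))" using L hidden_maximal_iff[OF X vm] m by blast
      then show "Q m" using top_pair_cone[OF hidden_state[OF X] vm(1)] by simp
    qed
  next
    assume R: "\<forall>m. maximal (\<Union>X) m \<longrightarrow> Q m"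
    show "\<forall>\<psi>\<in>X. (\<forall>\<psi>'\<in>X. (\<psi>, \<psi>') \<in> causal hidden \<longrightarrow> \<psi>' = \<psi>) \<longrightarrow> Q (top_pair D E \<psi>)"
    proof (intro ballI impI)
      fix \<psi> assume "\<psi> \<in> X" and max: "\<forall>\<psi>'\<in>X. (\<psi>, \<psi>') \<in> causal hidden \<longrightarrow> \<psi>' = \<psi>"
      then obtain p where p: "p \<in> \<Union>X" "v p" "\<psi> = cone (\<Union>X) p" using hidden_member[OF X] by blast
      then have "Q p" using max hidden_maximal_iff[OF X p(1,2)] R by blast
      then show "Q (top_pair D E \<psi>)" using top_pair_cone[OF hidden_state[OF X] p(1)] p(3) by simp
    qed
  qed
  show ?thesis
  proof (rule bij_betw_byWitness[where f' = visible_cones], goal_cases)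
    case 1
    show ?case using hidden_visible_cones[symmetric] by simp
  next
    case 2
    show ?case using visible_cones_conf(1) by (simp del: split_paired_All)
  next
    case 3
    show ?case using hidden_state hidden_maximal_visible Q_iff by auto
  next
    case 4
    show ?case
    proof (clarify, intro conjI)
      fix \<phi> assume \<phi>: "\<phi> \<in> sync_states D E f g" "\<forall>m. maximal \<phi> m \<longrightarrow> v m \<and> Q m"
      have "v m" if "maximal \<phi> m" for m using \<phi>(2) that by blast
      then have "visible_cones \<phi> \<in> conf hidden" "\<Union>(visible_cones \<phi>) = \<phi>"
        using visible_cones_conf[OF \<phi>(1)] by blast+
      then show "visible_cones \<phi> \<in> conf hidden"
        "\<forall>\<psi>\<in>visible_cones \<phi>. (\<forall>\<psi>'\<in>visible_cones \<phi>. (\<psi>, \<psi>') \<in> causal hidden \<longrightarrow> \<psi>' = \<psi>) \<longrightarrow> Q (top_pair D E \<psi>)"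
        using Q_iff \<phi>(2) by simp_all
    qed
  qed
qed

end

end

section \<open>Causality between a configuration and its display\<close>

lemma (in strategy) reflect_left:
  assumes "x \<in> conf S" "s \<in> x" "s' \<in> x" "disp \<sigma> s = Inl a" "disp \<sigma> s' = Inl a'" "(a, a') \<in> causal A"
  shows "(s, s') \<in> causal S"
proof -
  let ?z = "{e. (e, s') \<in> causal S}"
  have z: "?z \<in> conf S" by (rule conf_principal[OF es assms(1,3)])
  have "a' \<in> left \<sigma> ?z"
    using causal_refl[OF es conf_events[OF assms(1,3)]] assms(5) by (auto simp: left_iff)
  \<comment> \<open>The display of the causes of \<open>s'\<close> is down-closed in
    \<open>A\<close>, so one of these causes lies over \<open>a\<close>; local injectivity
    identifies it with \<open>s\<close>.\<close>
  then have "a \<in> left \<sigma> ?z" using conf_downD[OF left_conf[OF z]] assms(6) by blast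
  then obtain e where e: "(e, s') \<in> causal S" "disp \<sigma> e = Inl a" by (auto simp: left_iff)
  then have "e = s" using disp_inj[OF assms(1) conf_downD[OF assms(1,3) e(1)] assms(2)] assms(4) by simp
  then show ?thesis using e(1) by simp
qed

lemma (in strategy) reflect_right:
  assumes "x \<in> conf S" "s \<in> x" "s' \<in> x" "disp \<sigma> s = Inr b" "disp \<sigma> s' = Inr b'" "(b, b') \<in> causal B"
  shows "(s, s') \<in> causal S"
proof -
  let ?z = "{e. (e, s') \<in> causal S}"
  have z: "?z \<in> conf S" by (rule conf_principal[OF es assms(1,3)])
  have "b' \<in> right \<sigma> ?z"
    using causal_refl[OF es conf_events[OF assms(1,3)]] assms(5) by (auto simp: right_iff)
  then have "b \<in> right \<sigma> ?z" using conf_downD[OF right_conf[OF z]] assms(6) by blast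
  then obtain e where e: "(e, s') \<in> causal S" "disp \<sigma> e = Inr b" by (auto simp: right_iff)
  then have "e = s" using disp_inj[OF assms(1) conf_downD[OF assms(1,3) e(1)] assms(2)] assms(4) by simp
  then show ?thesis using e(1) by simp
qed

text \<open>A minimal strict successor of \<open>s\<close> within \<open>x\<close> is immediate in
  the whole structure, because \<open>x\<close> is down-closed and would contain anything in
  between.\<close>

lemma immediate_between:
  assumes "event_structure E" "x \<in> conf E" "s' \<in> x" "(s, s') \<in> strict (causal E)"
  obtains u where "u \<in> x" "(s, u) \<in> immediate E"
proof -
  let ?X = "{u \<in> x. (s, u) \<in> strict (causal E)}"
  have "finite ?X" "?X \<noteq> {}" using conf_finite[OF assms(1,2)] assms(3,4) by auto
  moreover have "acyclic ((strict (causal E))\<inverse> \<inter> ?X \<times> ?X)"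
    by (rule acyclic_subset[of "(strict (causal E))\<inverse>"]) (simp_all add: acyclic_strict[OF assms(1)])
  ultimately obtain u where u: "u \<in> ?X" "\<And>w. w \<in> ?X \<Longrightarrow> (u, w) \<notin> (strict (causal E))\<inverse>"
    by (rule finite_acyclic_maximal) blast
  have "\<not> ((s, w) \<in> strict (causal E) \<and> (w, u) \<in> strict (causal E))" for w
    using u conf_downD[OF assms(2), of u w] by (auto simp: strict_def)
  then have "(s, u) \<in> immediate E" using u(1) by (auto simp: immediate_def)
  then show ?thesis using that u(1) by blast
qed

text \<open>Courtesy preserves the immediate links out of a positive event, so the game itself shows
  that such an event is not maximal. This carries non-maximality over \<open>B\<close> from one
  strategy to the other.\<close>

lemma (in strategy) positive_successor:
  assumes "x \<in> conf S" "s' \<in> x" "(s, s') \<in> strict (causal S)" "pol S s = Pos"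
  obtains u where "u \<in> x" "(disp \<sigma> s, disp \<sigma> u) \<in> strict (rel_par (causal A) (causal B))"
proof -
  obtain u where u: "u \<in> x" "(s, u) \<in> immediate S"
    using immediate_between[OF es assms(1-3)] .
  have "courteous S (arrow_game A B) (disp \<sigma>)" using strategy by (simp add: sim_strategy_def)
  then have "(disp \<sigma> s, disp \<sigma> u) \<in> immediate (arrow_game A B)"
    using u(2) assms(4) by (auto simp: courteous_def)
  then have "(disp \<sigma> s, disp \<sigma> u) \<in> strict (rel_par (causal A) (causal B))"
    by (auto simp: immediate_def arrow_game_def par_def)
  then show ?thesis using that u(1) by blast
qed

section \<open>States of the interaction as matching pairs of configurations\<close>

context composition
begin

lemma id_right_symm:
  "x \<in> conf S \<Longrightarrow> Id_on (right \<sigma> x) \<in> symm B"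
  using iso_Id_on[OF L.isoB L.right_conf] .

abbreviation state :: "'s set \<Rightarrow> 't set \<Rightarrow> (('s + 'c) \<times> ('a + 't)) set" where
  "state x y \<equiv> sync (Id_on (right \<sigma> x)) x y"

sublocale P: sync_pullback "S \<parallel> C" "A \<parallel> T" "disp_par_id \<sigma>" "id_par_disp \<tau>"
proof
  have fin: "finite x" if "finite (Inl -` x)" "finite (Inr -` x)" for x :: "('u + 'v) set"
  proof (rule finite_subset)
    show "x \<subseteq> Inl ` (Inl -` x) \<union> Inr ` (Inr -` x)"
    proof
      fix e assume "e \<in> x"
      then show "e \<in> Inl ` (Inl -` x) \<union> Inr ` (Inr -` x)" by (cases e) auto
    qed
    show "finite (Inl ` (Inl -` x) \<union> Inr ` (Inr -` x))" using that by (intro finite_UnI finite_imageI)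
  qed
  have sub: "x' \<in> conf (F \<parallel> G)"
    if "event_structure F" "event_structure G" "x \<in> conf (F \<parallel> G)" "x' \<subseteq> x"
      "\<And>d d'. d \<in> x' \<Longrightarrow> (d', d) \<in> causal (F \<parallel> G) \<Longrightarrow> d' \<in> x'"
    for x x' and F :: "('u, 'x) ess_scheme" and G :: "('v, 'z) ess_scheme"
    unfolding conf_par_iff
  proof
    show "Inl -` x' \<in> conf F"
    proof (rule conf_subset[OF that(1)])
      show "Inl -` x \<in> conf F" using that(3) by (simp add: conf_par_iff)
    qed (use that(4) that(5)[of "Inl _" "Inl _"] in \<open>auto simp: par_def\<close>)
    show "Inr -` x' \<in> conf G"
    proof (rule conf_subset[OF that(2)])
      show "Inr -` x \<in> conf G" using that(3) by (simp add: conf_par_iff)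
    qed (use that(4) that(5)[of "Inr _" "Inr _"] in \<open>auto simp: par_def\<close>)
  qed
  note eS = L.es and eC = tcg_es[OF R.tcg_right] and eA = tcg_es[OF L.tcg_left] and eT = R.es
  show "finite x" if "x \<in> conf (S \<parallel> C)" for x
    using that conf_finite[OF eS] conf_finite[OF eC] by (intro fin) (auto simp: conf_par_iff)
  show "finite y" if "y \<in> conf (A \<parallel> T)" for y
    using that conf_finite[OF eA] conf_finite[OF eT] by (intro fin) (auto simp: conf_par_iff)
  show "x' \<in> conf (S \<parallel> C)" if "x \<in> conf (S \<parallel> C)" "x' \<subseteq> x"
      "\<And>d d'. d \<in> x' \<Longrightarrow> (d', d) \<in> causal (S \<parallel> C) \<Longrightarrow> d' \<in> x'" for x x'
    using sub[OF eS eC that] .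
  show "y' \<in> conf (A \<parallel> T)" if "y \<in> conf (A \<parallel> T)" "y' \<subseteq> y"
      "\<And>d d'. d \<in> y' \<Longrightarrow> (d', d) \<in> causal (A \<parallel> T) \<Longrightarrow> d' \<in> y'" for y y'
    using sub[OF eA eT that] .
  show "inj_on (id_par_disp \<tau>) y" if "y \<in> conf (A \<parallel> T)" for y
  proof (rule inj_onI)
    fix e e' assume "e \<in> y" "e' \<in> y" "id_par_disp \<tau> e = id_par_disp \<tau> e'"
    then show "e = e'" using that R.disp_inj[of "Inr -` y"]
      by (cases e; cases e') (auto simp: id_par_disp_def conf_par_iff)
  qed
qed

lemma state_proj:
  assumes "right \<sigma> x = left \<tau> y"
  shows "fst ` state x y = x <+> right \<tau> y" "snd ` state x y = left \<sigma> x <+> y"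
proof -
  note total = sync_total[of "Id_on (right \<sigma> x)" x y]
  have t: "\<And>s. s \<in> x \<Longrightarrow> \<exists>e. (Inl s, e) \<in> state x y" "\<And>t. t \<in> y \<Longrightarrow> \<exists>d. (d, Inr t) \<in> state x y"
    using total assms by auto
  show "fst ` state x y = x <+> right \<tau> y"
  proof (intro equalityI subsetI)
    show "d \<in> x <+> right \<tau> y" if "d \<in> fst ` state x y" for d
      using that by (auto simp: sync_def bij_via_def)
    show "d \<in> fst ` state x y" if d: "d \<in> x <+> right \<tau> y" for d
    proof (cases d)
      case (Inl s)
      then show ?thesis using d t(1)[of s] by force
    next
      case (Inr c)
      then obtain t where "t \<in> y" "disp \<tau> t = Inr c" using d by (auto simp: right_iff)
      then have "(Inr c, Inr t) \<in> state x y" by (simp add: sync_iff)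
      then show ?thesis using Inr by force
    qed
  qed
  show "snd ` state x y = left \<sigma> x <+> y"
  proof (intro equalityI subsetI)
    show "d \<in> left \<sigma> x <+> y" if "d \<in> snd ` state x y" for d
      using that by (auto simp: sync_def bij_via_def)
    show "d \<in> snd ` state x y" if d: "d \<in> left \<sigma> x <+> y" for d
    proof (cases d)
      case (Inr t)
      then show ?thesis using d t(2)[of t] by force
    next
      case (Inl a)
      then obtain s where "s \<in> x" "disp \<sigma> s = Inl a" using d by (auto simp: left_iff)
      then have "(Inl s, Inl a) \<in> state x y" by (simp add: sync_iff)
      then show ?thesis using Inl by force
    qed
  qed
qed

definition matching :: "('s set \<times> 't set) set" where
  "matching = {(x, y). x \<in> conf S \<and> y \<in> conf T \<and> right \<sigma> x = left \<tau> y}"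

abbreviation states :: "(('s + 'c) \<times> ('a + 't)) set set" where
  "states \<equiv> sync_states (S \<parallel> C) (A \<parallel> T) (disp_par_id \<sigma>) (id_par_disp \<tau>)"

lemma disp_eq_iff:
  "disp_par_id \<sigma> (Inl s) = id_par_disp \<tau> (Inl a) \<longleftrightarrow> disp \<sigma> s = Inl a"
  "disp_par_id \<sigma> (Inl s) = id_par_disp \<tau> (Inr t) \<longleftrightarrow> (\<exists>b. disp \<sigma> s = Inr b \<and> disp \<tau> t = Inl b)"
  "disp_par_id \<sigma> (Inr c) = id_par_disp \<tau> (Inr t) \<longleftrightarrow> disp \<tau> t = Inr c"
  "disp_par_id \<sigma> (Inr c) \<noteq> id_par_disp \<tau> (Inl a)"
  by (cases "disp \<sigma> s"; cases "disp \<tau> t"; auto simp: disp_par_id_def id_par_disp_def)+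

lemma state_iff:
  "(Inl s, Inl a) \<in> state x y \<longleftrightarrow> s \<in> x \<and> disp \<sigma> s = Inl a"
  "(Inl s, Inr t) \<in> state x y \<longleftrightarrow> s \<in> x \<and> t \<in> y \<and> (\<exists>b. disp \<sigma> s = Inr b \<and> disp \<tau> t = Inl b)"
  "(Inr c, Inr t) \<in> state x y \<longleftrightarrow> t \<in> y \<and> disp \<tau> t = Inr c"
  "(Inr c, Inl a) \<notin> state x y"
  by (auto simp: sync_iff right_iff) blast

lemma vimage_Plus: "Inl -` (u <+> w) = u" "Inr -` (u <+> w) = w"
  by auto

text \<open>\<open>no_deadlock\<close>, taken at the identity symmetry on \<open>B\<close>, supplies
  the securedness of every matching pair.\<close>

lemma state_in_sync_states:
  assumes "(x, y) \<in> matching"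
  shows "state x y \<in> states"
  unfolding P.sync_states_iff
proof (intro conjI)
  have m: "x \<in> conf S" "y \<in> conf T" "right \<sigma> x = left \<tau> y"
    using assms by (auto simp: matching_def)
  show "fst ` state x y \<in> conf (S \<parallel> C)"
    using m(1) R.right_conf[OF m(2)] by (simp add: state_proj(1)[OF m(3)] conf_par_iff vimage_Plus)
  show "snd ` state x y \<in> conf (A \<parallel> T)"
    using m(2) L.left_conf[OF m(1)] by (simp add: state_proj(2)[OF m(3)] conf_par_iff vimage_Plus)
  show "secured (S \<parallel> C) (A \<parallel> T) (state x y)"
    using sync_secured[OF m(1,2) id_right_symm[OF m(1)]] m(3) by auto
  show "\<forall>(d, e)\<in>state x y. disp_par_id \<sigma> d = id_par_disp \<tau> e"
  proof clarify
    fix d e assume "(d, e) \<in> state x y"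
    then show "disp_par_id \<sigma> d = id_par_disp \<tau> e"
      by (cases d; cases e) (auto simp: state_iff disp_eq_iff)
  qed
qed

lemma sync_state_projections:
  assumes "\<phi> \<in> states"
  defines "x \<equiv> Inl -` fst ` \<phi>" and "y \<equiv> Inr -` snd ` \<phi>"
  shows "(x, y) \<in> matching" and "state x y = \<phi>"
proof -
  have eq: "disp_par_id \<sigma> d = id_par_disp \<tau> e" if "(d, e) \<in> \<phi>" for d e
    using assms(1) that by (auto simp: P.sync_states_iff)
  have c: "x \<in> conf S" "y \<in> conf T"
    using assms(1) by (auto simp: P.sync_states_iff conf_par_iff x_def y_def)
  have xD: "\<exists>e. (Inl s, e) \<in> \<phi>" if "s \<in> x" for s using that by (force simp: x_def)
  have yD: "\<exists>d. (d, Inr t) \<in> \<phi>" if "t \<in> y" for t using that by (force simp: y_def)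
  have xI: "s \<in> x" if "(Inl s, e) \<in> \<phi>" for s e using that by (force simp: x_def)
  have yI: "t \<in> y" if "(d, Inr t) \<in> \<phi>" for t d using that by (force simp: y_def)
  have xb: "\<exists>t\<in>y. (Inl s, Inr t) \<in> \<phi> \<and> disp \<tau> t = Inl b" if "s \<in> x" "disp \<sigma> s = Inr b" for s b
  proof -
    obtain e where e: "(Inl s, e) \<in> \<phi>" using xD \<open>s \<in> x\<close> by blast
    then show ?thesis using eq[OF e] \<open>disp \<sigma> s = Inr b\<close> yI by (cases e) (auto simp: disp_eq_iff)
  qed
  have yb: "\<exists>s\<in>x. (Inl s, Inr t) \<in> \<phi> \<and> disp \<sigma> s = Inr b" if "t \<in> y" "disp \<tau> t = Inl b" for t b
  proof -
    obtain d where d: "(d, Inr t) \<in> \<phi>" using yD \<open>t \<in> y\<close> by blast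
    then show ?thesis using eq[OF d] \<open>disp \<tau> t = Inl b\<close> xI by (cases d) (auto simp: disp_eq_iff)
  qed
  have "right \<sigma> x = left \<tau> y"
    using xb yb by (auto simp: right_iff left_iff) blast+
  then show "(x, y) \<in> matching" using c by (simp add: matching_def)
  show "state x y = \<phi>"
  proof (intro equalityI subrelI)
    fix d e assume de: "(d, e) \<in> \<phi>"
    then show "(d, e) \<in> state x y"
      using eq[OF de] xI yI by (cases d; cases e) (auto simp: disp_eq_iff state_iff)
  next
    fix d e assume "(d, e) \<in> state x y"
    moreover have "(Inl s, Inl a) \<in> \<phi>" if sa: "s \<in> x" "disp \<sigma> s = Inl a" for s a
    proof -
      obtain e where e: "(Inl s, e) \<in> \<phi>" using xD sa by blast
      then show ?thesis using eq[OF e] sa by (cases e) (auto simp: disp_eq_iff)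
    qed
    moreover have "(Inr c, Inr t) \<in> \<phi>" if tc: "t \<in> y" "disp \<tau> t = Inr c" for t c
    proof -
      obtain d where d: "(d, Inr t) \<in> \<phi>" using yD tc by blast
      then show ?thesis using eq[OF d] tc by (cases d) (auto simp: disp_eq_iff)
    qed
    moreover have "(Inl s, Inr t) \<in> \<phi>" if st: "s \<in> x" "t \<in> y" "disp \<sigma> s = Inr b" "disp \<tau> t = Inl b" for s t b
    proof -
      obtain t' where t': "t' \<in> y" "(Inl s, Inr t') \<in> \<phi>" "disp \<tau> t' = Inl b" using xb[OF st(1,3)] by blast
      \<comment> \<open>The partner of \<open>s\<close> in \<phi> lies over the same
        \<open>b\<close> as \<open>t\<close>, and local injectivity of \<tau> makes it
        \<open>t\<close>.\<close>
      then show ?thesis using R.disp_inj[OF c(2) t'(1) st(2)] st(4) by simp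
    qed
    ultimately show "(d, e) \<in> \<phi>"
      by (cases d; cases e) (auto simp: state_iff)
  qed
qed

lemma state_bij:
  "bij_betw (\<lambda>(x, y). state x y) matching
     (states)"
proof (rule bij_betw_byWitness[where f' = "\<lambda>\<phi>. (Inl -` fst ` \<phi>, Inr -` snd ` \<phi>)"], goal_cases)
  case 1
  show ?case
  proof
    fix p assume "p \<in> matching"
    then obtain x y where p: "p = (x, y)" "right \<sigma> x = left \<tau> y" by (auto simp: matching_def)
    show "(Inl -` fst ` (case p of (x, y) \<Rightarrow> state x y), Inr -` snd ` (case p of (x, y) \<Rightarrow> state x y)) = p"
      unfolding p(1) prod.case state_proj[OF p(2)] vimage_Plus ..
  qed
qed (use sync_state_projections state_in_sync_states in auto)

section \<open>Positive coverage of matching pairs\<close>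

abbreviation uncovered :: "('s + 'c) \<times> ('a + 't) \<Rightarrow> bool" where
  "uncovered m \<equiv> \<nexists>b. disp_par_id \<sigma> (fst m) = Inr (Inl b)"

text \<open>On a pair over \<open>B\<close> this depends on the value \<open>undefined\<close> in
  \<open>forget_middle\<close>. The conditions imposed on states therefore always ask for
  \<open>uncovered\<close> as well.\<close>

abbreviation positive :: "('s + 'c) \<times> ('a + 't) \<Rightarrow> bool" where
  "positive m \<equiv> pol (arrow_game A C) (forget_middle (disp_par_id \<sigma> (fst m))) = Pos"

lemma maximal_state_left:
  assumes "(x, y) \<in> matching" "P.maximal (state x y) (Inl s, e)" "s' \<in> x" "(s, s') \<in> causal S"
  shows "s' = s"
proof -
  have "right \<sigma> x = left \<tau> y" using assms(1) by (simp add: matching_def)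
  then obtain e' where "(Inl s', e') \<in> state x y"
    using sync_total(1)[of "Id_on (right \<sigma> x)" x y s'] assms(3) by auto
  then have "(Inl s, Inl s') \<notin> strict (causal (S \<parallel> C))"
    using assms(2) by (auto simp: P.maximal_def bij_causal_def simp del: strict_par_iff)
  then show ?thesis using assms(4) by (simp, simp add: strict_def)
qed

lemma maximal_state_right:
  assumes "(x, y) \<in> matching" "P.maximal (state x y) (d, Inr t)" "t' \<in> y" "(t, t') \<in> causal T"
  shows "t' = t"
proof -
  have "right \<sigma> x = left \<tau> y" using assms(1) by (simp add: matching_def)
  then obtain d' where "(d', Inr t') \<in> state x y"
    using sync_total(2)[of "Id_on (right \<sigma> x)" x y t'] assms(3) by auto
  then have "(Inr t, Inr t') \<notin> strict (causal (A \<parallel> T))"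
    using assms(2) by (auto simp: P.maximal_def bij_causal_def simp del: strict_par_iff)
  then show ?thesis using assms(4) by (simp, simp add: strict_def)
qed

lemma strict_rel_par_iff:
  "(Inl a, u) \<in> strict (rel_par r r') \<longleftrightarrow> (\<exists>a'. u = Inl a' \<and> (a, a') \<in> strict r)"
  "(Inr b, u) \<in> strict (rel_par r r') \<longleftrightarrow> (\<exists>b'. u = Inr b' \<and> (b, b') \<in> strict r')"
  by (cases u; auto simp: strict_def)+

lemma causal_par: "causal (F \<parallel> G) = rel_par (causal F) (causal G)"
  by (simp add: par_def)

lemma not_maximal_state:
  assumes "(d, e) \<in> state x y" "\<not> P.maximal (state x y) (d, e)"
  obtains d' e' where "(d', e') \<in> state x y"
    "(d, d') \<in> strict (rel_par (causal S) (causal C)) \<or> (e, e') \<in> strict (rel_par (causal A) (causal T))"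
  using assms by (auto simp: P.maximal_def bij_causal_def causal_par)

text \<open>If \<open>x\<close> and \<open>y\<close> are covered, a maximal pair over
  \<open>B\<close> would consist of two maximal events, both positive, although the strategies see
  opposite polarities on \<open>B\<close>. In the other direction the danger is an event over
  \<open>B\<close> that is maximal and negative on its own side. Its pair is invisible, hence not
  maximal, so something follows on the other side, where the event is positive; courtesy turns this
  into a successor in \<open>B\<close>, whose counterpart on the first side is causally above the
  event by reflection.\<close>

lemma pos_covered_state_iff:
  assumes m: "(x, y) \<in> matching"
  shows "(\<forall>m. P.maximal (state x y) m \<longrightarrow> uncovered m \<and> positive m) \<longleftrightarrow>
    x \<in> pos_covered S \<and> y \<in> pos_covered T"
proof
  have c: "x \<in> conf S" "y \<in> conf T" and eq: "right \<sigma> x = left \<tau> y"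
    using m by (auto simp: matching_def)
  note ev = L.conf_events[OF c(1)] R.conf_events[OF c(2)]
  \<comment> \<open>This block settles the implication from coverage to visibility and positivity;
    the rest of the proof treats the other one.\<close>
  {
    assume cov: "x \<in> pos_covered S \<and> y \<in> pos_covered T"
    show "\<forall>m. P.maximal (state x y) m \<longrightarrow> uncovered m \<and> positive m"
    proof (intro allI impI)
      fix q assume q: "P.maximal (state x y) q"
      obtain d e where [simp]: "q = (d, e)" by fastforce
      have mem: "(d, e) \<in> state x y" using q by (simp add: P.maximal_def)
      have pl: "pol S s = Pos" if "d = Inl s" "s \<in> x" for s
        using cov that maximal_state_left[OF m, of s e] q unfolding pos_covered_def by auto
      have pr: "pol T t = Pos" if "e = Inr t" "t \<in> y" for t
        using cov that maximal_state_right[OF m, of d t] q unfolding pos_covered_def by auto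
      show "uncovered q \<and> positive q"
      proof (cases d)
        case (Inl s)
        then have s: "s \<in> x" using mem by (cases e) (auto simp: state_iff)
        show ?thesis
        proof (cases e)
          case (Inl a)
          then have "disp \<sigma> s = Inl a" using mem \<open>d = Inl s\<close> by (simp add: state_iff)
          then show ?thesis using pl[OF \<open>d = Inl s\<close> s] L.pol_Inl[OF ev(1)[OF s]] \<open>d = Inl s\<close>
            by (simp add: disp_par_id_def forget_middle_def arrow_game_def)
        next
          case (Inr t)
          then obtain b where "t \<in> y" "disp \<sigma> s = Inr b" "disp \<tau> t = Inl b"
            using mem \<open>d = Inl s\<close> by (auto simp: state_iff)
          then have "flip (pol B b) = Pos" "pol B b = Pos"
            using pl[OF \<open>d = Inl s\<close> s] pr[OF Inr] L.pol_Inr[OF ev(1)[OF s]] R.pol_Inl[OF ev(2)] by simp_all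
          then show ?thesis by simp
        qed
      next
        case (Inr c)
        then obtain t where "e = Inr t" "t \<in> y" "disp \<tau> t = Inr c"
          using mem by (cases e) (auto simp: state_iff)
        then show ?thesis using pr R.pol_Inr[OF ev(2)] Inr
          by (simp add: disp_par_id_def forget_middle_def arrow_game_def)
      qed
    qed
  }
  assume good: "\<forall>m. P.maximal (state x y) m \<longrightarrow> uncovered m \<and> positive m"
  have left: "pol S s = Pos" if s: "s \<in> x" and max: "\<forall>s'\<in>x. (s, s') \<in> causal S \<longrightarrow> s' = s" for s
  proof (cases "disp \<sigma> s")
    case (Inl a)
    have mem: "(Inl s, Inl a) \<in> state x y" using s Inl by (simp add: state_iff)
    have "P.maximal (state x y) (Inl s, Inl a)"
    proof (rule ccontr)
      assume "\<not> P.maximal (state x y) (Inl s, Inl a)"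
      then obtain d e where de: "(d, e) \<in> state x y" "(Inl s, d) \<in> strict (rel_par (causal S) (causal C)) \<or>
          (Inl a, e) \<in> strict (rel_par (causal A) (causal T))"
        using not_maximal_state[OF mem] by metis
      from de(2) show False
      proof
        assume "(Inl s, d) \<in> strict (rel_par (causal S) (causal C))"
        then obtain s' where "d = Inl s'" "(s, s') \<in> strict (causal S)" by (auto simp: strict_rel_par_iff)
        moreover have "s' \<in> x" using de(1) calculation(1) by (cases e) (auto simp: state_iff)
        ultimately show False using max by (auto simp: strict_def)
      next
        assume "(Inl a, e) \<in> strict (rel_par (causal A) (causal T))"
        then obtain a' where a': "e = Inl a'" "(a, a') \<in> strict (causal A)" by (auto simp: strict_rel_par_iff)
        obtain s' where s': "s' \<in> x" "disp \<sigma> s' = Inl a'" using de(1) a'(1) by (cases d) (auto simp: state_iff)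
        have "(s, s') \<in> causal S" using L.reflect_left[OF c(1) s s'(1) Inl s'(2)] a'(2) by (simp add: strict_def)
        then have "s' = s" using max s'(1) by blast
        then show False using a'(2) s'(2) Inl by (simp add: strict_def)
      qed
    qed
    then have "flip (pol A a) = Pos" using good Inl
      by (auto simp: disp_par_id_def forget_middle_def arrow_game_def)
    then show ?thesis using L.pol_Inl[OF ev(1)[OF s] Inl] by simp
  next
    case (Inr b)
    have "b \<in> left \<tau> y" unfolding eq[symmetric] right_iff using s Inr by blast
    then obtain t where t: "t \<in> y" "disp \<tau> t = Inl b" by (auto simp: left_iff)
    have mem: "(Inl s, Inr t) \<in> state x y" using s t Inr by (simp add: state_iff)
    have "\<not> uncovered (Inl s, Inr t)" using Inr by (simp add: disp_par_id_def)
    then have "\<not> P.maximal (state x y) (Inl s, Inr t)" using good by blast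
    then obtain d e where de: "(d, e) \<in> state x y" "(Inl s, d) \<in> strict (rel_par (causal S) (causal C)) \<or>
        (Inr t, e) \<in> strict (rel_par (causal A) (causal T))"
      using not_maximal_state[OF mem] by metis
    show ?thesis
    proof (rule ccontr)
      assume "pol S s \<noteq> Pos"
      then have "pol S s = Neg" by (cases "pol S s") auto
      then have tp: "pol T t = Pos" using L.pol_Inr[OF ev(1)[OF s] Inr] R.pol_Inl[OF ev(2)[OF t(1)] t(2)] by simp
      from de(2) show False
      proof
        assume "(Inl s, d) \<in> strict (rel_par (causal S) (causal C))"
        then obtain s' where "d = Inl s'" "(s, s') \<in> strict (causal S)" by (auto simp: strict_rel_par_iff)
        moreover have "s' \<in> x" using de(1) calculation(1) by (cases e) (auto simp: state_iff)
        ultimately show False using max by (auto simp: strict_def)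
      next
        assume "(Inr t, e) \<in> strict (rel_par (causal A) (causal T))"
        then obtain t' where t': "e = Inr t'" "(t, t') \<in> strict (causal T)" by (auto simp: strict_rel_par_iff)
        have "t' \<in> y" using de(1) t'(1) by (cases d) (auto simp: state_iff)
        then obtain u where u: "u \<in> y" "(disp \<tau> t, disp \<tau> u) \<in> strict (rel_par (causal B) (causal C))"
          using R.positive_successor[OF c(2) _ t'(2) tp] by blast
        then obtain b' where b': "disp \<tau> u = Inl b'" "(b, b') \<in> strict (causal B)" using t(2) by (auto simp: strict_rel_par_iff)
        have "b' \<in> right \<sigma> x" unfolding eq left_iff using u(1) b'(1) by blast
        then obtain s' where s': "s' \<in> x" "disp \<sigma> s' = Inr b'" by (auto simp: right_iff)
        have "(s, s') \<in> causal S" using L.reflect_right[OF c(1) s s'(1) Inr s'(2)] b'(2) by (simp add: strict_def)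
        then have "s' = s" using max s'(1) by blast
        then show False using b'(2) s'(2) Inr by (simp add: strict_def)
      qed
    qed
  qed
  have right: "pol T t = Pos" if t: "t \<in> y" and max: "\<forall>t'\<in>y. (t, t') \<in> causal T \<longrightarrow> t' = t" for t
  proof (cases "disp \<tau> t")
    case (Inr k)
    have mem: "(Inr k, Inr t) \<in> state x y" using t Inr by (simp add: state_iff)
    have "P.maximal (state x y) (Inr k, Inr t)"
    proof (rule ccontr)
      assume "\<not> P.maximal (state x y) (Inr k, Inr t)"
      then obtain d e where de: "(d, e) \<in> state x y" "(Inr k, d) \<in> strict (rel_par (causal S) (causal C)) \<or>
          (Inr t, e) \<in> strict (rel_par (causal A) (causal T))"
        using not_maximal_state[OF mem] by metis
      from de(2) show False
      proof
        assume "(Inr t, e) \<in> strict (rel_par (causal A) (causal T))"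
        then obtain t' where "e = Inr t'" "(t, t') \<in> strict (causal T)" by (auto simp: strict_rel_par_iff)
        moreover have "t' \<in> y" using de(1) calculation(1) by (cases d) (auto simp: state_iff)
        ultimately show False using max by (auto simp: strict_def)
      next
        assume "(Inr k, d) \<in> strict (rel_par (causal S) (causal C))"
        then obtain k' where k': "d = Inr k'" "(k, k') \<in> strict (causal C)" by (auto simp: strict_rel_par_iff)
        obtain t' where t': "t' \<in> y" "disp \<tau> t' = Inr k'" using de(1) k'(1) by (cases e) (auto simp: state_iff)
        have "(t, t') \<in> causal T" using R.reflect_right[OF c(2) t t'(1) Inr t'(2)] k'(2) by (simp add: strict_def)
        then have "t' = t" using max t'(1) by blast
        then show False using k'(2) t'(2) Inr by (simp add: strict_def)
      qed
    qed
    then have "pol C k = Pos" using good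
      by (auto simp: disp_par_id_def forget_middle_def arrow_game_def)
    then show ?thesis using R.pol_Inr[OF ev(2)[OF t] Inr] by simp
  next
    case (Inl b)
    have "b \<in> right \<sigma> x" unfolding eq left_iff using t Inl by blast
    then obtain s where s: "s \<in> x" "disp \<sigma> s = Inr b" by (auto simp: right_iff)
    have mem: "(Inl s, Inr t) \<in> state x y" using s t Inl by (simp add: state_iff)
    have "\<not> uncovered (Inl s, Inr t)" using s(2) by (simp add: disp_par_id_def)
    then have "\<not> P.maximal (state x y) (Inl s, Inr t)" using good by blast
    then obtain d e where de: "(d, e) \<in> state x y" "(Inl s, d) \<in> strict (rel_par (causal S) (causal C)) \<or>
        (Inr t, e) \<in> strict (rel_par (causal A) (causal T))"
      using not_maximal_state[OF mem] by metis
    show ?thesis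
    proof (rule ccontr)
      assume "pol T t \<noteq> Pos"
      then have sp: "pol S s = Pos"
        using L.pol_Inr[OF ev(1)[OF s(1)] s(2)] R.pol_Inl[OF ev(2)[OF t] Inl] by (cases "pol B b") auto
      from de(2) show False
      proof
        assume "(Inr t, e) \<in> strict (rel_par (causal A) (causal T))"
        then obtain t' where "e = Inr t'" "(t, t') \<in> strict (causal T)" by (auto simp: strict_rel_par_iff)
        moreover have "t' \<in> y" using de(1) calculation(1) by (cases d) (auto simp: state_iff)
        ultimately show False using max by (auto simp: strict_def)
      next
        assume "(Inl s, d) \<in> strict (rel_par (causal S) (causal C))"
        then obtain s' where s': "d = Inl s'" "(s, s') \<in> strict (causal S)" by (auto simp: strict_rel_par_iff)
        have "s' \<in> x" using de(1) s'(1) by (cases e) (auto simp: state_iff)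
        then obtain u where u: "u \<in> x" "(disp \<sigma> s, disp \<sigma> u) \<in> strict (rel_par (causal A) (causal B))"
          using L.positive_successor[OF c(1) _ s'(2) sp] by blast
        then obtain b' where b': "disp \<sigma> u = Inr b'" "(b, b') \<in> strict (causal B)" using s(2) by (auto simp: strict_rel_par_iff)
        have "b' \<in> left \<tau> y" unfolding eq[symmetric] right_iff using u(1) b'(1) by blast
        then obtain t' where t': "t' \<in> y" "disp \<tau> t' = Inl b'" by (auto simp: left_iff)
        have "(t, t') \<in> causal T" using R.reflect_left[OF c(2) t t'(1) Inl t'(2)] b'(2) by (simp add: strict_def)
        then have "t' = t" using max t'(1) by blast
        then show False using b'(2) t'(2) Inl by (simp add: strict_def)
      qed
    qed
  qed
  show "x \<in> pos_covered S \<and> y \<in> pos_covered T"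
    using c left right unfolding pos_covered_def by auto
qed

definition covered_matching :: "('s set \<times> 't set) set" where
  "covered_matching = {(x, y). x \<in> pos_covered S \<and> y \<in> pos_covered T \<and> right \<sigma> x = left \<tau> y}"

lemma covered_state_bij:
  "bij_betw (\<lambda>(x, y). state x y) covered_matching
     {\<phi> \<in> states.
       \<forall>m. P.maximal \<phi> m \<longrightarrow> uncovered m \<and> positive m}" (is "bij_betw ?f _ ?T")
proof -
  have sub: "covered_matching \<subseteq> matching" by (auto simp: covered_matching_def matching_def pos_covered_def)
  have cm: "p \<in> covered_matching \<longleftrightarrow> ?f p \<in> ?T" if "p \<in> matching" for p
  proof -
    obtain x y where [simp]: "p = (x, y)" by fastforce
    show ?thesis using that pos_covered_state_iff[of x y] state_in_sync_states[of x y]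
      by (auto simp: covered_matching_def matching_def)
  qed
  have "?f ` covered_matching = ?T"
  proof (intro equalityI subsetI)
    fix \<phi> assume \<phi>: "\<phi> \<in> ?T"
    then have "\<phi> \<in> ?f ` matching" using bij_betw_imp_surj_on[OF state_bij] by simp
    then obtain p where "p \<in> matching" "\<phi> = ?f p" by (rule imageE)
    then have "p \<in> covered_matching" using cm[of p] \<phi> by simp
    then show "\<phi> \<in> ?f ` covered_matching" using \<open>\<phi> = ?f p\<close> by (rule rev_image_eqI)
  next
    fix \<phi> assume "\<phi> \<in> ?f ` covered_matching"
    then obtain p where p: "p \<in> covered_matching" "\<phi> = ?f p" by (rule imageE)
    then show "\<phi> \<in> ?T" using cm[of p] sub by (simp add: subsetD)
  qed
  then show ?thesis using bij_betw_subset[OF state_bij sub] by simp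
qed

end

section \<open>Witnesses and displays of the composite strategy\<close>

context composition
begin

text \<open>\<open>visible\<close> tests the display of the top pair, so the support of the
  composite has the configurations and causality of \<open>hidden\<close> at the predicate
  \<open>uncovered\<close>, and the results on abstract pullbacks apply.\<close>

lemma conf_comp_strat: "conf (supp (comp_strat A C \<tau> \<sigma>)) = conf (P.hidden uncovered)"
  and causal_comp_strat: "causal (supp (comp_strat A C \<tau> \<sigma>)) = causal (P.hidden uncovered)"
  and pol_comp_strat: "pol (supp (comp_strat A C \<tau> \<sigma>)) \<psi> = Pos \<longleftrightarrow>
    positive (top_pair (S \<parallel> C) (A \<parallel> T) \<psi>)"
  and disp_comp_strat: "disp (comp_strat A C \<tau> \<sigma>) \<psi> =
    forget_middle (disp_par_id \<sigma> (fst (top_pair (S \<parallel> C) (A \<parallel> T) \<psi>)))"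
  by (simp_all add: comp_strat_def conf_def Let_def interaction_def visible_def interaction_disp_def)

lemma pos_covered_comp_strat:
  "bij_betw Union (pos_covered (supp (comp_strat A C \<tau> \<sigma>)))
     {\<phi> \<in> states.
       \<forall>m. P.maximal \<phi> m \<longrightarrow> uncovered m \<and> positive m}"
  using P.hidden_bij[of uncovered positive]
  by (simp only: pos_covered_def conf_comp_strat causal_comp_strat pol_comp_strat)

text \<open>The visibility conjunct excludes the \<open>undefined\<close> branch, which might
  coincide with any value.\<close>

lemma forget_middle_iff:
  "(\<nexists>b. u = Inr (Inl b)) \<and> forget_middle u = Inl a \<longleftrightarrow> u = Inl a"
  "(\<nexists>b. u = Inr (Inl b)) \<and> forget_middle u = Inr c \<longleftrightarrow> u = Inr (Inr c)"
  by (cases u; auto simp: forget_middle_def split: sum.splits)+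

lemma disp_par_id_iff:
  "disp_par_id \<sigma> d = Inl a \<longleftrightarrow> (\<exists>s. d = Inl s \<and> disp \<sigma> s = Inl a)"
  "disp_par_id \<sigma> d = Inr (Inr c) \<longleftrightarrow> d = Inr c"
proof -
  show "disp_par_id \<sigma> d = Inl a \<longleftrightarrow> (\<exists>s. d = Inl s \<and> disp \<sigma> s = Inl a)"
  proof (cases d)
    case (Inl s)
    then show ?thesis by (cases "disp \<sigma> s") (auto simp: disp_par_id_def)
  qed (auto simp: disp_par_id_def)
  show "disp_par_id \<sigma> d = Inr (Inr c) \<longleftrightarrow> d = Inr c"
  proof (cases d)
    case (Inl s)
    then show ?thesis by (cases "disp \<sigma> s") (auto simp: disp_par_id_def)
  qed (auto simp: disp_par_id_def)
qed

text \<open>The composite displays only the tops of the members of \<open>X\<close>. These are the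
  visible pairs of the state, and every pair over \<open>A\<close> or \<open>C\<close> is
  visible.\<close>

lemma display_comp_strat:
  assumes "X \<in> conf (P.hidden uncovered)" "\<Union>X = state x y"
  shows "left (comp_strat A C \<tau> \<sigma>) X = left \<sigma> x" "right (comp_strat A C \<tau> \<sigma>) X = right \<tau> y"
proof -
  have tops: "(\<exists>\<psi>\<in>X. R (top_pair (S \<parallel> C) (A \<parallel> T) \<psi>)) \<longleftrightarrow> (\<exists>p\<in>state x y. uncovered p \<and> R p)" for R
  proof -
    have "(\<exists>\<psi>\<in>X. R (top_pair (S \<parallel> C) (A \<parallel> T) \<psi>)) \<longleftrightarrow>
        (\<exists>p\<in>top_pair (S \<parallel> C) (A \<parallel> T) ` X. R p)" by simp
    then show ?thesis unfolding P.hidden_tops[OF assms(1)] assms(2) by blast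
  qed
  show "left (comp_strat A C \<tau> \<sigma>) X = left \<sigma> x"
  proof (rule set_eqI)
    fix a
    have "a \<in> left (comp_strat A C \<tau> \<sigma>) X \<longleftrightarrow>
        (\<exists>p\<in>state x y. uncovered p \<and> forget_middle (disp_par_id \<sigma> (fst p)) = Inl a)"
      unfolding left_iff disp_comp_strat using tops .
    also have "\<dots> \<longleftrightarrow> (\<exists>p\<in>state x y. disp_par_id \<sigma> (fst p) = Inl a)"
      by (simp only: forget_middle_iff)
    also have "\<dots> \<longleftrightarrow> a \<in> left \<sigma> x"
    proof
      assume "\<exists>p\<in>state x y. disp_par_id \<sigma> (fst p) = Inl a"
      then obtain s e where "(Inl s, e) \<in> state x y" "disp \<sigma> s = Inl a" by (auto simp: disp_par_id_iff)
      then show "a \<in> left \<sigma> x" by (cases e) (auto simp: state_iff left_iff)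
    next
      assume "a \<in> left \<sigma> x"
      then obtain s where "s \<in> x" "disp \<sigma> s = Inl a" by (auto simp: left_iff)
      then show "\<exists>p\<in>state x y. disp_par_id \<sigma> (fst p) = Inl a"
        by (intro bexI[of _ "(Inl s, Inl a)"]) (auto simp: state_iff disp_par_id_iff)
    qed
    finally show "a \<in> left (comp_strat A C \<tau> \<sigma>) X \<longleftrightarrow> a \<in> left \<sigma> x" .
  qed
  show "right (comp_strat A C \<tau> \<sigma>) X = right \<tau> y"
  proof (rule set_eqI)
    fix c
    have "c \<in> right (comp_strat A C \<tau> \<sigma>) X \<longleftrightarrow>
        (\<exists>p\<in>state x y. uncovered p \<and> forget_middle (disp_par_id \<sigma> (fst p)) = Inr c)"
      unfolding right_iff disp_comp_strat using tops .
    also have "\<dots> \<longleftrightarrow> (\<exists>p\<in>state x y. disp_par_id \<sigma> (fst p) = Inr (Inr c))"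
      by (simp only: forget_middle_iff)
    also have "\<dots> \<longleftrightarrow> c \<in> right \<tau> y"
    proof
      assume "\<exists>p\<in>state x y. disp_par_id \<sigma> (fst p) = Inr (Inr c)"
      then obtain e where "(Inr c, e) \<in> state x y" by (auto simp: disp_par_id_iff)
      then show "c \<in> right \<tau> y" by (cases e) (auto simp: state_iff right_iff)
    next
      assume "c \<in> right \<tau> y"
      then obtain t where "t \<in> y" "disp \<tau> t = Inr c" by (auto simp: right_iff)
      then show "\<exists>p\<in>state x y. disp_par_id \<sigma> (fst p) = Inr (Inr c)"
        by (intro bexI[of _ "(Inr c, Inr t)"]) (auto simp: state_iff disp_par_id_iff)
    qed
    finally show "c \<in> right (comp_strat A C \<tau> \<sigma>) X \<longleftrightarrow> c \<in> right \<tau> y" .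
  qed
qed

end

section \<open>Counting\<close>

lemma ecard_image: "inj_on f X \<Longrightarrow> ecard (f ` X) = ecard X"
  by (simp add: ecard_def card_image finite_image_iff)

lemma ecard_bij_betw: "bij_betw f X Y \<Longrightarrow> ecard X = ecard Y"
  using ecard_image[of f X] by (simp add: bij_betw_def)

lemma ecard_times: "ecard (X \<times> Y) = ecard X * ecard Y"
proof (cases "X = {} \<or> Y = {}")
  case True
  then show ?thesis by (auto simp: ecard_def zero_enat_def[symmetric])
next
  case False
  then show ?thesis
    by (auto simp: ecard_def finite_cartesian_product_iff card_cartesian_product card_gt_0_iff)
qed

text \<open>The bijections may vary with \<open>x\<close>. For symmetries to a representative no
  choice among them is natural, so an arbitrary one is taken on each fibre.\<close>

lemma ecard_Sigma:
  assumes "\<And>x. x \<in> X \<Longrightarrow> \<exists>h. bij_betw h (F x) K"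
  shows "ecard (Sigma X F) = ecard X * ecard K"
proof -
  obtain h where h: "\<And>x. x \<in> X \<Longrightarrow> bij_betw (h x) (F x) K" using assms by metis
  have "bij_betw (\<lambda>(x, k). (x, h x k)) (Sigma X F) (X \<times> K)"
    unfolding bij_betw_def
  proof
    show "inj_on (\<lambda>(x, k). (x, h x k)) (Sigma X F)"
      using h by (auto simp: inj_on_def bij_betw_def)
    show "(\<lambda>(x, k). (x, h x k)) ` Sigma X F = X \<times> K"
    proof (intro equalityI subsetI)
      show "p \<in> X \<times> K" if "p \<in> (\<lambda>(x, k). (x, h x k)) ` Sigma X F" for p
        using that h by (auto simp: bij_betw_def)
      fix p assume "p \<in> X \<times> K"
      then obtain x l where p: "p = (x, l)" "x \<in> X" "l \<in> h x ` F x"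
        using h by (auto simp: bij_betw_def)
      then show "p \<in> (\<lambda>(x, k). (x, h x k)) ` Sigma X F" by force
    qed
  qed
  then have "ecard (Sigma X F) = ecard (X \<times> K)" by (rule ecard_bij_betw)
  then show ?thesis by (simp add: ecard_times)
qed

text \<open>Intended for correspondences that are not presented as functions, such as
  \<open>transport\<close>, where existence and uniqueness are proved separately in each
  direction.\<close>

lemma ecard_eqI_rel:
  assumes "\<And>a. a \<in> X \<Longrightarrow> \<exists>!b. b \<in> Y \<and> R a b" "\<And>b. b \<in> Y \<Longrightarrow> \<exists>!a. a \<in> X \<and> R a b"
  shows "ecard X = ecard Y"
proof -
  obtain f where f: "\<And>a. a \<in> X \<Longrightarrow> f a \<in> Y \<and> R a (f a)" using assms(1) by metis
  have "bij_betw f X Y" unfolding bij_betw_def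
  proof
    show "inj_on f X" using f assms(2) by (intro inj_onI) metis
    show "f ` X = Y" using f assms by (intro equalityI subsetI) (auto, metis rev_image_eqI)
  qed
  then show ?thesis by (rule ecard_bij_betw)
qed

text \<open>Cancellation in \<open>enat\<close> fails exactly for the factors 0 and \<infinity>,
  which a finite nonempty \<open>K\<close> avoids.\<close>

lemma ecard_mult_cancel:
  assumes "finite K" "K \<noteq> {}" "a * ecard K = b * ecard K"
  shows "a = b"
proof -
  have "ecard K = enat (card K)" "card K > 0" using assms by (auto simp: ecard_def card_gt_0_iff)
  then show ?thesis using assms(3) by (cases a; cases b) auto
qed

text \<open>Brings a cardinality into the form that \<open>infsum_enat\<close> gives to an infinite
  sum.\<close>

lemma ecard_eq_SUP: "ecard X = (SUP F\<in>{F. finite F \<and> F \<subseteq> X}. enat (card F))"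
proof (rule antisym)
  show "(SUP F\<in>{F. finite F \<and> F \<subseteq> X}. enat (card F)) \<le> ecard X"
    by (rule SUP_least) (auto simp: ecard_def card_mono)
  show "ecard X \<le> (SUP F\<in>{F. finite F \<and> F \<subseteq> X}. enat (card F))"
  proof (cases "finite X")
    case True
    then show ?thesis by (intro SUP_upper2[of X]) (auto simp: ecard_def)
  next
    case False
    have "enat n \<le> (SUP F\<in>{F. finite F \<and> F \<subseteq> X}. enat (card F))" for n
    proof -
      obtain F where "finite F" "F \<subseteq> X" "card F = n"
        using infinite_arbitrarily_large[OF False] by blast
      then show ?thesis by (intro SUP_upper2[of F]) auto
    qed
    \<comment> \<open>A finite value \<open>m\<close> of the supremum is refuted by a subset with
      \<open>m + 1\<close> elements.\<close>
    from this[of "Suc _"] have "(SUP F\<in>{F. finite F \<and> F \<subseteq> X}. enat (card F)) \<noteq> enat m" for m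
      by (metis enat_ord_simps(1) not_less_eq_eq order_refl)
    then have "(SUP F\<in>{F. finite F \<and> F \<subseteq> X}. enat (card F)) = \<infinity>"
      using not_infinity_eq by blast
    then show ?thesis by simp
  qed
qed

text \<open>Finitely many elements of \<open>P\<close> meet only finitely many fibres, and a finite
  sum over fibres is the cardinality of a subset of \<open>P\<close>. This compares the two suprema
  in both directions.\<close>

lemma ecard_partition:
  assumes "c ` P \<subseteq> I"
  shows "ecard P = (\<Sum>\<^sub>\<infinity>i\<in>I. ecard {p \<in> P. c p = i})"
proof -
  have fin: "(\<Sum>i\<in>F. ecard {p \<in> P. c p = i}) = ecard {p \<in> P. c p \<in> F}" if "finite F" for F
    using that
  proof (induction F)
    case empty
    then show ?case by (simp add: ecard_def zero_enat_def)
  next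
    case (insert i F)
    have eq: "{p \<in> P. c p \<in> insert i F} = {p \<in> P. c p = i} \<union> {p \<in> P. c p \<in> F}" by auto
    have "{p \<in> P. c p = i} \<inter> {p \<in> P. c p \<in> F} = {}" using insert(2) by auto
    then have "ecard {p \<in> P. c p \<in> insert i F} = ecard {p \<in> P. c p = i} + ecard {p \<in> P. c p \<in> F}"
      unfolding eq by (auto simp: ecard_def card_Un_disjoint)
    then show ?case using insert by simp
  qed
  show ?thesis unfolding infsum_enat
  proof (rule antisym)
    show "ecard P \<le> (SUP F\<in>{F. finite F \<and> F \<subseteq> I}. \<Sum>i\<in>F. ecard {p \<in> P. c p = i})"
      unfolding ecard_eq_SUP[of P]
    proof (rule SUP_mono)
      fix Q assume "Q \<in> {F. finite F \<and> F \<subseteq> P}"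
      then have Q: "finite Q" "Q \<subseteq> P" by auto
      have "enat (card Q) = ecard Q" using Q by (simp add: ecard_def)
      also have "\<dots> \<le> ecard {p \<in> P. c p \<in> c ` Q}"
        using Q by (auto simp: ecard_def intro!: card_mono)
      also have "\<dots> = (\<Sum>i\<in>c ` Q. ecard {p \<in> P. c p = i})" using fin[of "c ` Q"] Q by simp
      finally show "\<exists>F\<in>{F. finite F \<and> F \<subseteq> I}. enat (card Q) \<le> (\<Sum>i\<in>F. ecard {p \<in> P. c p = i})"
        using Q assms by (intro bexI[of _ "c ` Q"]) auto
    qed
    show "(SUP F\<in>{F. finite F \<and> F \<subseteq> I}. \<Sum>i\<in>F. ecard {p \<in> P. c p = i}) \<le> ecard P"
    proof (rule SUP_least)
      fix F assume "F \<in> {F. finite F \<and> F \<subseteq> I}"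
      then show "(\<Sum>i\<in>F. ecard {p \<in> P. c p = i}) \<le> ecard P"
        using fin[of F] by (auto simp: ecard_def intro!: card_mono elim: finite_subset[rotated])
    qed
  qed
qed

section \<open>Hom-sets of an isomorphism family as a groupoid\<close>

definition homs :: "('a \<times> 'a) set set \<Rightarrow> 'a set \<Rightarrow> 'a set \<Rightarrow> ('a \<times> 'a) set set" where
  "homs \<Theta> x y = {\<theta> \<in> \<Theta>. Domain \<theta> = x \<and> Range \<theta> = y}"

lemma related_by_homs: "related_by \<Theta> x y \<longleftrightarrow> homs \<Theta> x y \<noteq> {}"
  by (auto simp: related_by_def homs_def)

lemma homs_iff: "\<theta> \<in> homs \<Theta> x y \<longleftrightarrow> \<theta> \<in> \<Theta> \<and> Domain \<theta> = x \<and> Range \<theta> = y"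
  by (simp add: homs_def)

lemma homs_converse: "iso_family E \<Theta> \<Longrightarrow> \<theta> \<in> homs \<Theta> x y \<Longrightarrow> \<theta>\<inverse> \<in> homs \<Theta> y x"
  by (simp add: homs_def iso_converse)

lemma homs_comp: "iso_family E \<Theta> \<Longrightarrow> \<theta> \<in> homs \<Theta> x y \<Longrightarrow> \<theta>' \<in> homs \<Theta> y z \<Longrightarrow> \<theta> O \<theta>' \<in> homs \<Theta> x z"
  using iso_comp[of E \<Theta> \<theta> \<theta>'] unfolding homs_def by blast

lemma homs_cancel_left:
  assumes "iso_family E \<Theta>" "\<theta> \<in> homs \<Theta> x y" "Domain \<alpha> = y"
  shows "\<theta>\<inverse> O (\<theta> O \<alpha>) = \<alpha>"
proof -
  have "\<theta>\<inverse> O (\<theta> O \<alpha>) = (\<theta>\<inverse> O \<theta>) O \<alpha>" by (simp add: O_assoc)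
  also have "\<theta>\<inverse> O \<theta> = Id_on y" using iso_converse_comp[OF assms(1)] assms(2) by (simp add: homs_def)
  also have "Id_on y O \<alpha> = \<alpha>" using assms(3) by auto
  finally show ?thesis .
qed

lemma homs_cancel_right:
  assumes "iso_family E \<Theta>" "\<theta> \<in> homs \<Theta> x y" "Range \<alpha> = x"
  shows "(\<alpha> O \<theta>) O \<theta>\<inverse> = \<alpha>"
proof -
  have "(\<alpha> O \<theta>) O \<theta>\<inverse> = \<alpha> O (\<theta> O \<theta>\<inverse>)" by (simp add: O_assoc)
  also have "\<theta> O \<theta>\<inverse> = Id_on x" using iso_comp_converse[OF assms(1)] assms(2) by (simp add: homs_def)
  also have "\<alpha> O Id_on x = \<alpha>" using assms(3) by auto
  finally show ?thesis .
qed

text \<open>Turns a factorization of an identity into an inverse, which places \<rho> in the family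
  of \<alpha>.\<close>

lemma relcomp_eq_Id_on:
  assumes "iso_family E \<Theta>" "\<alpha> \<in> \<Theta>" "Range \<rho> = Domain \<alpha>" "Id_on z = \<rho> O \<alpha>"
  shows "\<rho> = \<alpha>\<inverse>"
proof -
  have "\<rho> = (\<rho> O \<alpha>) O \<alpha>\<inverse>"
    using homs_cancel_right[OF assms(1), of \<alpha> "Domain \<alpha>" "Range \<alpha>" \<rho>] assms(2,3) by (simp add: homs_iff)
  also have "\<dots> = Id_on z O \<alpha>\<inverse>" by (simp only: assms(4))
  also have "\<dots> = \<alpha>\<inverse>"
  proof -
    have "Range \<alpha> \<subseteq> z"
    proof
      fix a assume "a \<in> Range \<alpha>"
      then obtain w where w: "(w, a) \<in> \<alpha>" by blast
      then have "w \<in> Range \<rho>" using assms(3) by blast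
      then have "a \<in> Range (\<rho> O \<alpha>)" using w by blast
      then show "a \<in> z" unfolding assms(4)[symmetric] by auto
    qed
    then show ?thesis by blast
  qed
  finally show ?thesis .
qed

text \<open>A nonempty hom-set is a torsor: composing with the converse of a fixed member leads to
  the endosymmetries of \<open>y\<close>. The number of symmetries to the representative is thus the
  same for all sources.\<close>

lemma homs_endo_bij:
  assumes "iso_family E \<Theta>" "related_by \<Theta> x y"
  shows "\<exists>h. bij_betw h (homs \<Theta> x y) (homs \<Theta> y y)"
proof -
  obtain \<theta> where \<theta>: "\<theta> \<in> homs \<Theta> x y" using assms(2) by (auto simp: related_by_homs)
  have "bij_betw (\<lambda>\<alpha>. \<theta>\<inverse> O \<alpha>) (homs \<Theta> x y) (homs \<Theta> y y)"
  proof (rule bij_betw_byWitness[where f' = "\<lambda>\<alpha>. \<theta> O \<alpha>"])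
    show "\<forall>\<alpha>\<in>homs \<Theta> x y. \<theta> O \<theta>\<inverse> O \<alpha> = \<alpha>"
      by (intro ballI homs_cancel_left[OF assms(1) homs_converse[OF assms(1) \<theta>], unfolded converse_converse])
        (simp add: homs_iff)
    show "\<forall>\<alpha>\<in>homs \<Theta> y y. \<theta>\<inverse> O \<theta> O \<alpha> = \<alpha>"
      by (intro ballI homs_cancel_left[OF assms(1) \<theta>]) (simp add: homs_iff)
    show "(\<lambda>\<alpha>. \<theta>\<inverse> O \<alpha>) ` homs \<Theta> x y \<subseteq> homs \<Theta> y y"
      using homs_comp[OF assms(1) homs_converse[OF assms(1) \<theta>]] by blast
    show "(\<lambda>\<alpha>. \<theta> O \<alpha>) ` homs \<Theta> y y \<subseteq> homs \<Theta> x y"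
      using homs_comp[OF assms(1) \<theta>] by blast
  qed
  then show ?thesis by blast
qed

text \<open>Unique factorization through \<open>x\<close> itself says that composition is a
  bijection from pairs of polarized endosymmetries onto all of them. For an arbitrary representative
  the middle configuration could be a different one.\<close>

lemma canonical_homs:
  assumes "thin_concurrent_game A" "canonical A x"
  shows "ecard (homs (symm A) x x) = ecard (homs (symm_pos A) x x) * ecard (homs (symm_neg A) x x)"
proof -
  have fac: "\<exists>!p. fst p \<in> homs (symm_neg A) x x \<and> snd p \<in> homs (symm_pos A) x x \<and> \<theta> = fst p O snd p"
    if "\<theta> \<in> homs (symm A) x x" for \<theta>
    using assms(2) that unfolding canonical_def homs_iff by simp
  have in_homs: "fst p O snd p \<in> homs (symm A) x x" if "p \<in> homs (symm_neg A) x x \<times> homs (symm_pos A) x x" for p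
  proof (rule homs_comp[OF tcg_iso[OF assms(1)]])
    show "fst p \<in> homs (symm A) x x" "snd p \<in> homs (symm A) x x"
      using that tcg_neg_sub[OF assms(1)] tcg_pos_sub[OF assms(1)] unfolding homs_iff mem_Times_iff by blast+
  qed
  have "ecard (homs (symm_neg A) x x \<times> homs (symm_pos A) x x) = ecard (homs (symm A) x x)"
  proof (rule ecard_eqI_rel[where R = "\<lambda>p \<theta>. \<theta> = fst p O snd p"])
    show "\<exists>!\<theta>. \<theta> \<in> homs (symm A) x x \<and> \<theta> = fst p O snd p"
      if "p \<in> homs (symm_neg A) x x \<times> homs (symm_pos A) x x" for p
      using in_homs[OF that] by blast
    show "\<exists>!p. p \<in> homs (symm_neg A) x x \<times> homs (symm_pos A) x x \<and> \<theta> = fst p O snd p"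
      if "\<theta> \<in> homs (symm A) x x" for \<theta>
      using fac[OF that] by (simp add: mem_Times_iff)
  qed
  then show ?thesis by (simp add: ecard_times mult.commute)
qed

lemma related_by_equiv:
  assumes "iso_family E \<Theta>"
  shows "equiv (conf E) {(x, y). related_by \<Theta> x y}"
proof (rule equivI)
  show "{(x, y). related_by \<Theta> x y} \<subseteq> conf E \<times> conf E"
    using iso_Domain[OF assms] iso_Range[OF assms] by (auto simp: related_by_def)
  show "refl_on (conf E) {(x, y). related_by \<Theta> x y}"
  proof (rule refl_onI)
    fix x assume "x \<in> conf E"
    then have "Id_on x \<in> homs \<Theta> x x" using iso_Id_on[OF assms] by (auto simp: homs_iff)
    then show "(x, x) \<in> {(x, y). related_by \<Theta> x y}" by (auto simp: related_by_homs)
  qed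
  show "sym {(x, y). related_by \<Theta> x y}"
    using homs_converse[OF assms] by (auto simp: sym_def related_by_homs)
  show "trans {(x, y). related_by \<Theta> x y}"
    using homs_comp[OF assms] by (fastforce simp: trans_def related_by_homs)
qed

context strategy
begin

lemma lrel_homs: "\<phi> \<in> symm S \<Longrightarrow> lrel \<sigma> \<phi> \<in> \<Theta> \<Longrightarrow> lrel \<sigma> \<phi> \<in> homs \<Theta> (left \<sigma> (Domain \<phi>)) (left \<sigma> (Range \<phi>))"
  and rrel_homs: "\<phi> \<in> symm S \<Longrightarrow> rrel \<sigma> \<phi> \<in> \<Theta>' \<Longrightarrow> rrel \<sigma> \<phi> \<in> homs \<Theta>' (right \<sigma> (Domain \<phi>)) (right \<sigma> (Range \<phi>))"
  by (simp_all add: homs_iff Domain_lrel Range_lrel Domain_rrel Range_rrel)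

text \<open>The quotient \<open>\<phi>\<inverse> O \<phi>'\<close> displays to
  \<open>\<alpha> O \<alpha>'\<inverse>\<close> and \<open>\<beta> O \<beta>'\<inverse>\<close>,
  which are polarized since the remainders share their targets. By \<open>rigid\<close> it is an
  identity, and the remainders then agree by cancellation.\<close>

lemma factor_unique:
  assumes \<phi>: "\<phi> \<in> symm S" "\<phi>' \<in> symm S" "Domain \<phi> = Domain \<phi>'"
    and \<alpha>: "\<alpha> \<in> homs (symm_neg A) (left \<sigma> (Range \<phi>)) a" "\<alpha>' \<in> homs (symm_neg A) (left \<sigma> (Range \<phi>')) a"
      "lrel \<sigma> \<phi> O \<alpha> = lrel \<sigma> \<phi>' O \<alpha>'"
    and \<beta>: "\<beta> \<in> homs (symm_pos B) (right \<sigma> (Range \<phi>)) b" "\<beta>' \<in> homs (symm_pos B) (right \<sigma> (Range \<phi>')) b"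
      "rrel \<sigma> \<phi> O \<beta> = rrel \<sigma> \<phi>' O \<beta>'"
  shows "\<phi> = \<phi>' \<and> \<alpha> = \<alpha>' \<and> \<beta> = \<beta>'"
proof -
  note iA = isoA isoA_neg and iB = isoB isoB_pos
  have l: "lrel \<sigma> \<phi> \<in> homs (symm A) (left \<sigma> (Domain \<phi>)) (left \<sigma> (Range \<phi>))"
    "lrel \<sigma> \<phi>' \<in> homs (symm A) (left \<sigma> (Domain \<phi>')) (left \<sigma> (Range \<phi>'))"
    using lrel_homs \<phi> disp_symm(2) by blast+
  have r: "rrel \<sigma> \<phi> \<in> homs (symm B) (right \<sigma> (Domain \<phi>)) (right \<sigma> (Range \<phi>))"
    "rrel \<sigma> \<phi>' \<in> homs (symm B) (right \<sigma> (Domain \<phi>')) (right \<sigma> (Range \<phi>'))"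
    using rrel_homs \<phi> disp_symm(3) by blast+
  let ?\<omega> = "\<phi>\<inverse> O \<phi>'"
  have \<omega>: "?\<omega> \<in> symm S"
    using \<phi> by (intro iso_comp[OF iso] iso_converse[OF iso]) auto
  have a: "(lrel \<sigma> \<phi>)\<inverse> O lrel \<sigma> \<phi>' = \<alpha> O \<alpha>'\<inverse>"
  proof -
    have "(lrel \<sigma> \<phi>)\<inverse> O lrel \<sigma> \<phi>' = (lrel \<sigma> \<phi>)\<inverse> O ((lrel \<sigma> \<phi>' O \<alpha>') O \<alpha>'\<inverse>)"
      using homs_cancel_right[OF iA(2) \<alpha>(2), of "lrel \<sigma> \<phi>'"] l(2) by (simp add: homs_iff)
    also have "\<dots> = ((lrel \<sigma> \<phi>)\<inverse> O (lrel \<sigma> \<phi> O \<alpha>)) O \<alpha>'\<inverse>" by (simp add: \<alpha>(3) O_assoc)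
    also have "(lrel \<sigma> \<phi>)\<inverse> O (lrel \<sigma> \<phi> O \<alpha>) = \<alpha>"
      using homs_cancel_left[OF iA(1) l(1), of \<alpha>] \<alpha>(1) by (simp add: homs_iff)
    finally show ?thesis .
  qed
  have b: "(rrel \<sigma> \<phi>)\<inverse> O rrel \<sigma> \<phi>' = \<beta> O \<beta>'\<inverse>"
  proof -
    have "(rrel \<sigma> \<phi>)\<inverse> O rrel \<sigma> \<phi>' = (rrel \<sigma> \<phi>)\<inverse> O ((rrel \<sigma> \<phi>' O \<beta>') O \<beta>'\<inverse>)"
      using homs_cancel_right[OF iB(2) \<beta>(2), of "rrel \<sigma> \<phi>'"] r(2) by (simp add: homs_iff)
    also have "\<dots> = ((rrel \<sigma> \<phi>)\<inverse> O (rrel \<sigma> \<phi> O \<beta>)) O \<beta>'\<inverse>" by (simp add: \<beta>(3) O_assoc)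
    also have "(rrel \<sigma> \<phi>)\<inverse> O (rrel \<sigma> \<phi> O \<beta>) = \<beta>"
      using homs_cancel_left[OF iB(1) r(1), of \<beta>] \<beta>(1) by (simp add: homs_iff)
    finally show ?thesis .
  qed
  have rel: "lrel \<sigma> ?\<omega> = \<alpha> O \<alpha>'\<inverse>" "rrel \<sigma> ?\<omega> = \<beta> O \<beta>'\<inverse>"
    using rel_comp[OF iso_converse[OF iso \<phi>(1)] \<phi>(2)] \<phi>(3) a b by (simp_all add: lrel_converse rrel_converse)
  have "\<alpha> O \<alpha>'\<inverse> \<in> symm_neg A" "\<beta> O \<beta>'\<inverse> \<in> symm_pos B"
    using homs_comp[OF iA(2) \<alpha>(1) homs_converse[OF iA(2) \<alpha>(2)]] homs_comp[OF iB(2) \<beta>(1) homs_converse[OF iB(2) \<beta>(2)]]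
    by (simp_all add: homs_iff)
  then have "?\<omega> = Id_on (Domain ?\<omega>)" using rigid[OF \<omega>] rel by simp
  moreover have "Domain ?\<omega> = Range \<phi>"
  proof (intro equalityI subsetI)
    fix z assume "z \<in> Range \<phi>"
    then obtain w where w: "(w, z) \<in> \<phi>" by blast
    then have "w \<in> Domain \<phi>'" unfolding \<phi>(3)[symmetric] by blast
    then show "z \<in> Domain ?\<omega>" using w by blast
  qed blast
  ultimately have "?\<omega> = Id_on (Range \<phi>)" by simp
  moreover have "\<phi> O Id_on (Range \<phi>) = \<phi>" by auto
  ultimately have "\<phi> O ?\<omega> = \<phi>" by simp
  moreover have "\<phi> O ?\<omega> = \<phi>'"
  proof -
    have "\<phi>\<inverse> \<in> homs (symm S) (Range \<phi>) (Domain \<phi>)"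
      using iso_converse[OF iso \<phi>(1)] by (simp only: homs_iff Domain_converse Range_converse)
    from homs_cancel_left[OF iso this \<phi>(3)[symmetric]] show ?thesis by (simp only: converse_converse)
  qed
  ultimately have eq: "\<phi> = \<phi>'" by simp
  moreover have "\<alpha> = \<alpha>'"
  proof -
    have "\<alpha> = (lrel \<sigma> \<phi>)\<inverse> O (lrel \<sigma> \<phi> O \<alpha>)"
      using homs_cancel_left[OF iA(1) l(1), of \<alpha>] \<alpha>(1) by (simp add: homs_iff)
    also have "\<dots> = \<alpha>'"
      using homs_cancel_left[OF iA(1) l(2), of \<alpha>'] \<alpha>(2,3) eq by (simp add: homs_iff)
    finally show ?thesis .
  qed
  moreover have "\<beta> = \<beta>'"
  proof -
    have "\<beta> = (rrel \<sigma> \<phi>)\<inverse> O (rrel \<sigma> \<phi> O \<beta>)"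
      using homs_cancel_left[OF iB(1) r(1), of \<beta>] \<beta>(1) by (simp add: homs_iff)
    also have "\<dots> = \<beta>'"
      using homs_cancel_left[OF iB(1) r(2), of \<beta>'] \<beta>(2,3) eq by (simp add: homs_iff)
    finally show ?thesis .
  qed
  ultimately show ?thesis by simp
qed

end

section \<open>The correspondence between pairs of witnesses and witnesses of the composite\<close>

context composition
begin

context
  fixes rA :: "'a set set \<Rightarrow> 'a set" and rB :: "'b set set \<Rightarrow> 'b set" and rC :: "'c set set \<Rightarrow> 'c set"
    and XA :: "'a set set" and XC :: "'c set set"
begin

definition matching_wit :: "('s set \<times> 't set) set" where
  "matching_wit = {(x, y) \<in> covered_matching.
     related_by (symm_neg A) (left \<sigma> x) (rA XA) \<and> related_by (symm_pos C) (right \<tau> y) (rC XC)}"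

text \<open>\<open>Union\<close> embeds the witnesses of the composite into the states of the
  interaction, and \<open>state\<close> embeds the matching witnesses; both are injective and have
  the same image.\<close>

lemma coll_comp_strat: "coll A C rA rC (comp_strat A C \<tau> \<sigma>) XA XC = ecard matching_wit"
proof -
  let ?W = "pos_wit A C rA rC (comp_strat A C \<tau> \<sigma>) XA XC" and ?f = "\<lambda>(x, y). state x y"
  have sub: "?W \<subseteq> pos_covered (supp (comp_strat A C \<tau> \<sigma>))" by (auto simp: pos_wit_def)
  have wit: "X \<in> ?W \<longleftrightarrow> (x, y) \<in> matching_wit"
    if "X \<in> pos_covered (supp (comp_strat A C \<tau> \<sigma>))" "\<Union>X = state x y" "(x, y) \<in> covered_matching" for X x y
  proof -
    have "X \<in> conf (P.hidden uncovered)" using that(1) conf_comp_strat by (auto simp: pos_covered_def)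
    then show ?thesis using that display_comp_strat[OF _ that(2)] by (simp add: pos_wit_def matching_wit_def)
  qed
  have "Union ` ?W = ?f ` matching_wit"
  proof (intro equalityI subsetI)
    fix \<phi> assume "\<phi> \<in> Union ` ?W"
    then obtain X where X: "\<phi> = \<Union>X" "X \<in> ?W" by (rule imageE)
    then have "\<phi> \<in> ?f ` covered_matching"
      using sub bij_betw_imp_surj_on[OF covered_state_bij] bij_betw_imp_surj_on[OF pos_covered_comp_strat] by blast
    then obtain p where "p \<in> covered_matching" "\<phi> = ?f p" by (rule imageE)
    moreover obtain x y where "p = (x, y)" by fastforce
    ultimately have "(x, y) \<in> matching_wit" "\<phi> = ?f (x, y)" using wit[of X x y] X sub by auto
    then show "\<phi> \<in> ?f ` matching_wit" by blast
  next
    fix \<phi> assume "\<phi> \<in> ?f ` matching_wit"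
    then obtain p where "\<phi> = ?f p" "p \<in> matching_wit" by (rule imageE)
    moreover obtain x y where "p = (x, y)" by fastforce
    ultimately have p: "\<phi> = state x y" "(x, y) \<in> matching_wit" by auto
    then have cm: "(x, y) \<in> covered_matching" by (simp add: matching_wit_def)
    then have "\<phi> \<in> ?f ` covered_matching" using p(1) by force
    then have "\<phi> \<in> Union ` pos_covered (supp (comp_strat A C \<tau> \<sigma>))"
      unfolding bij_betw_imp_surj_on[OF covered_state_bij] bij_betw_imp_surj_on[OF pos_covered_comp_strat] .
    then obtain X where "\<phi> = \<Union>X" "X \<in> pos_covered (supp (comp_strat A C \<tau> \<sigma>))" by (rule imageE)
    then show "\<phi> \<in> Union ` ?W" using wit[of X x y] p cm by blast
  qed
  moreover have "inj_on Union ?W"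
    using bij_betw_imp_inj_on[OF pos_covered_comp_strat] sub by (rule inj_on_subset)
  moreover have "inj_on ?f matching_wit"
    using bij_betw_imp_inj_on[OF covered_state_bij] by (rule inj_on_subset) (auto simp: matching_wit_def)
  ultimately show ?thesis
    unfolding coll_def using ecard_image[of Union ?W] ecard_image[of ?f matching_wit] by simp
qed

text \<open>The elements of both sides of the bijection carry symmetries to the representative \<open>rB XB\<close>:
  along a fixed symmetry the transported configurations are unique, which they are not otherwise.\<close>

definition polarized_pairs :: "'b set set \<Rightarrow> (('s set \<times> ('b \<times> 'b) set) \<times> ('t set \<times> ('b \<times> 'b) set)) set" where
  "polarized_pairs XB =
     (SIGMA x:pos_wit A B rA rB \<sigma> XA XB. homs (symm_pos B) (right \<sigma> x) (rB XB)) \<times>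
     (SIGMA y:pos_wit B C rB rC \<tau> XB XC. homs (symm_neg B) (left \<tau> y) (rB XB))"

definition matching_pairs :: "'b set set \<Rightarrow> (('s set \<times> 't set) \<times> ('b \<times> 'b) set) set" where
  "matching_pairs XB =
     (SIGMA p:{(x, y) \<in> matching_wit. related_by (symm B) (right \<sigma> x) (rB XB)}. homs (symm B) (right \<sigma> (fst p)) (rB XB))"

text \<open>The symmetries run from the matching pair to the witnesses, against the direction of
  \<open>sync_exists\<close>. The two equations make \<theta> arrive as \<alpha> on the side of
  \<sigma> and as \<beta> on that of \<tau>; the polarities on \<open>A\<close> and \<open>C\<close>
  keep the witness conditions and determine the outcome in either direction.\<close>

definition transport ::
  "('s set \<times> ('b \<times> 'b) set) \<times> ('t set \<times> ('b \<times> 'b) set) \<Rightarrow> ('s set \<times> 't set) \<times> ('b \<times> 'b) set \<Rightarrow> bool" where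
  "transport = (\<lambda>((x, \<alpha>), (y, \<beta>)) ((x', y'), \<theta>). \<exists>\<phi>\<in>homs (symm S) x' x. \<exists>\<psi>\<in>homs (symm T) y' y.
     lrel \<sigma> \<phi> \<in> symm_neg A \<and> rrel \<tau> \<psi> \<in> symm_pos C \<and> \<theta> = rrel \<sigma> \<phi> O \<alpha> \<and> \<theta> = lrel \<tau> \<psi> O \<beta>)"

lemma matching_wit_iff:
  "(x, y) \<in> matching_wit \<longleftrightarrow> x \<in> pos_covered S \<and> y \<in> pos_covered T \<and> right \<sigma> x = left \<tau> y \<and>
     related_by (symm_neg A) (left \<sigma> x) (rA XA) \<and> related_by (symm_pos C) (right \<tau> y) (rC XC)"
  by (auto simp: matching_wit_def covered_matching_def)

lemma polarized_pairs_iff: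
  "((x, \<alpha>), (y, \<beta>)) \<in> polarized_pairs XB \<longleftrightarrow>
     x \<in> pos_covered S \<and> related_by (symm_neg A) (left \<sigma> x) (rA XA) \<and>
     y \<in> pos_covered T \<and> related_by (symm_pos C) (right \<tau> y) (rC XC) \<and>
     \<alpha> \<in> homs (symm_pos B) (right \<sigma> x) (rB XB) \<and> \<beta> \<in> homs (symm_neg B) (left \<tau> y) (rB XB)"
  by (auto simp: polarized_pairs_def pos_wit_def related_by_homs)

lemma matching_pairs_iff:
  "((x, y), \<theta>) \<in> matching_pairs XB \<longleftrightarrow> (x, y) \<in> matching_wit \<and> \<theta> \<in> homs (symm B) (right \<sigma> x) (rB XB)"
  by (auto simp: matching_pairs_def related_by_homs)

lemma related_trans:
  assumes "iso_family E \<Theta>" "\<theta> \<in> homs \<Theta> x y" "related_by \<Theta> x z"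
  shows "related_by \<Theta> y z"
  using homs_comp[OF assms(1) homs_converse[OF assms(1,2)]] assms(3) by (auto simp: related_by_homs)

lemmas game_isos =
  L.isoA_neg L.isoB L.isoB_pos tcg_iso_neg[OF L.tcg_right]
  R.isoB_pos

lemma pos_covered_homs:
  "x \<in> pos_covered S \<Longrightarrow> \<phi> \<in> homs (symm S) x x' \<Longrightarrow> x' \<in> pos_covered S"
  "y \<in> pos_covered T \<Longrightarrow> \<psi> \<in> homs (symm T) y y' \<Longrightarrow> y' \<in> pos_covered T"
  using L.pos_covered_symm[of \<phi>] R.pos_covered_symm[of \<psi>] by (auto simp: homs_iff)

text \<open>\<open>factor\<close> is applied to each strategy with \<theta> on \<open>B\<close> and
  an identity on the outer game. On \<open>B\<close> it leaves a positive remainder for \<sigma> and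
  a negative one for \<tau>, for which \<open>B\<close> is the dual component. On the outer game,
  having factored an identity makes the display the inverse of a polarized symmetry.\<close>

lemma polarized_exists:
  assumes "((x', y'), \<theta>) \<in> matching_pairs XB"
  shows "\<exists>q\<in>polarized_pairs XB. transport q ((x', y'), \<theta>)"
proof -
  have m: "x' \<in> pos_covered S" "y' \<in> pos_covered T" "right \<sigma> x' = left \<tau> y'"
    "related_by (symm_neg A) (left \<sigma> x') (rA XA)" "related_by (symm_pos C) (right \<tau> y') (rC XC)"
    and \<theta>: "\<theta> \<in> symm B" "Domain \<theta> = right \<sigma> x'" "Range \<theta> = rB XB"
    using assms by (auto simp: matching_pairs_iff matching_wit_iff homs_iff)
  have c: "x' \<in> conf S" "y' \<in> conf T" using m(1,2) by (auto simp: pos_covered_def)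
  obtain \<phi> \<alpha> \<beta> where \<phi>: "\<phi> \<in> symm S" "Domain \<phi> = x'"
    "\<alpha> \<in> symm_neg A" "Domain \<alpha> = left \<sigma> (Range \<phi>)" "Id_on (left \<sigma> x') = lrel \<sigma> \<phi> O \<alpha>"
    "\<beta> \<in> symm_pos B" "Domain \<beta> = right \<sigma> (Range \<phi>)" "\<theta> = rrel \<sigma> \<phi> O \<beta>"
    using L.factor[OF c(1) iso_Id_on[OF L.isoA L.left_conf[OF c(1)]] Domain_Id_on \<theta>(1,2)] by blast
  have \<theta>': "Domain \<theta> = left \<tau> y'" using \<theta>(2) m(3) by simp
  obtain \<psi> \<gamma> \<delta> where \<psi>: "\<psi> \<in> symm T" "Domain \<psi> = y'"
    "\<gamma> \<in> symm_neg B" "Domain \<gamma> = left \<tau> (Range \<psi>)" "\<theta> = lrel \<tau> \<psi> O \<gamma>"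
    "\<delta> \<in> symm_pos C" "Domain \<delta> = right \<tau> (Range \<psi>)" "Id_on (right \<tau> y') = rrel \<tau> \<psi> O \<delta>"
    using R.factor[OF c(2) \<theta>(1) \<theta>' iso_Id_on[OF R.isoB R.right_conf[OF c(2)]] Domain_Id_on] by blast
  have "lrel \<sigma> \<phi> = \<alpha>\<inverse>"
    using relcomp_eq_Id_on[OF game_isos(1) \<phi>(3) _ \<phi>(5)] L.Range_lrel[OF \<phi>(1)] \<phi>(4) by simp
  then have l: "lrel \<sigma> \<phi> \<in> symm_neg A" using iso_converse[OF game_isos(1) \<phi>(3)] by simp
  have "rrel \<tau> \<psi> = \<delta>\<inverse>"
    using relcomp_eq_Id_on[OF game_isos(5) \<psi>(6) _ \<psi>(8)] R.Range_rrel[OF \<psi>(1)] \<psi>(7) by simp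
  then have r: "rrel \<tau> \<psi> \<in> symm_pos C" using iso_converse[OF game_isos(5) \<psi>(6)] by simp
  have hom: "\<phi> \<in> homs (symm S) x' (Range \<phi>)" "\<psi> \<in> homs (symm T) y' (Range \<psi>)"
    using \<phi>(1,2) \<psi>(1,2) by (auto simp: homs_iff)
  have "Range \<beta> = rB XB"
  proof -
    have "Range \<theta> = Range \<beta>" using \<phi>(7) L.Range_rrel[OF \<phi>(1)] unfolding \<phi>(8) by blast
    then show ?thesis using \<theta>(3) by simp
  qed
  moreover have "Range \<gamma> = rB XB"
  proof -
    have "Range \<theta> = Range \<gamma>" using \<psi>(4) R.Range_lrel[OF \<psi>(1)] unfolding \<psi>(5) by blast
    then show ?thesis using \<theta>(3) by simp
  qed
  moreover have "related_by (symm_neg A) (left \<sigma> (Range \<phi>)) (rA XA)"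
    using related_trans[OF game_isos(1) L.lrel_homs[OF \<phi>(1) l]] \<phi>(2) m(4) by simp
  moreover have "related_by (symm_pos C) (right \<tau> (Range \<psi>)) (rC XC)"
    using related_trans[OF game_isos(5) R.rrel_homs[OF \<psi>(1) r]] \<psi>(2) m(5) by simp
  ultimately have "((Range \<phi>, \<beta>), (Range \<psi>, \<gamma>)) \<in> polarized_pairs XB"
    using pos_covered_homs(1)[OF m(1) hom(1)] pos_covered_homs(2)[OF m(2) hom(2)] \<phi>(6,7) \<psi>(3,4)
    by (simp add: polarized_pairs_iff homs_iff)
  moreover have "transport ((Range \<phi>, \<beta>), (Range \<psi>, \<gamma>)) ((x', y'), \<theta>)"
    unfolding transport_def prod.case using hom l r \<phi>(8) \<psi>(5) by blast
  ultimately show ?thesis by blast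
qed

text \<open>Read backwards, a transport is on each side a factorization of \<theta> together with an
  identity on the outer game, the converse of the outer display being the remainder. Hence
  \<open>factor_unique\<close> decides it.\<close>

lemma polarized_unique:
  assumes "q1 \<in> polarized_pairs XB" "q2 \<in> polarized_pairs XB" "transport q1 p" "transport q2 p"
  shows "q1 = q2"
proof -
  obtain x1 \<alpha>1 y1 \<beta>1 x2 \<alpha>2 y2 \<beta>2 x' y' \<theta> where
    q: "q1 = ((x1, \<alpha>1), (y1, \<beta>1))" "q2 = ((x2, \<alpha>2), (y2, \<beta>2))" "p = ((x', y'), \<theta>)"
    by (metis surj_pair)
  obtain \<phi>1 \<psi>1 where 1: "\<phi>1 \<in> homs (symm S) x' x1" "\<psi>1 \<in> homs (symm T) y' y1"
    "lrel \<sigma> \<phi>1 \<in> symm_neg A" "rrel \<tau> \<psi>1 \<in> symm_pos C" "\<theta> = rrel \<sigma> \<phi>1 O \<alpha>1" "\<theta> = lrel \<tau> \<psi>1 O \<beta>1"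
    using assms(3) unfolding q transport_def prod.case by blast
  obtain \<phi>2 \<psi>2 where 2: "\<phi>2 \<in> homs (symm S) x' x2" "\<psi>2 \<in> homs (symm T) y' y2"
    "lrel \<sigma> \<phi>2 \<in> symm_neg A" "rrel \<tau> \<psi>2 \<in> symm_pos C" "\<theta> = rrel \<sigma> \<phi>2 O \<alpha>2" "\<theta> = lrel \<tau> \<psi>2 O \<beta>2"
    using assms(4) unfolding q transport_def prod.case by blast
  have \<phi>: "\<phi>1 \<in> symm S" "\<phi>2 \<in> symm S" "Domain \<phi>1 = x'" "Domain \<phi>2 = x'" "Range \<phi>1 = x1" "Range \<phi>2 = x2"
    and \<psi>: "\<psi>1 \<in> symm T" "\<psi>2 \<in> symm T" "Domain \<psi>1 = y'" "Domain \<psi>2 = y'" "Range \<psi>1 = y1" "Range \<psi>2 = y2"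
    using 1(1,2) 2(1,2) by (auto simp: homs_iff)
  have ab: "\<alpha>1 \<in> homs (symm_pos B) (right \<sigma> x1) (rB XB)" "\<beta>1 \<in> homs (symm_neg B) (left \<tau> y1) (rB XB)"
    "\<alpha>2 \<in> homs (symm_pos B) (right \<sigma> x2) (rB XB)" "\<beta>2 \<in> homs (symm_neg B) (left \<tau> y2) (rB XB)"
    using assms(1,2) unfolding q polarized_pairs_iff by blast+
  have l: "(lrel \<sigma> \<phi>1)\<inverse> \<in> homs (symm_neg A) (left \<sigma> x1) (left \<sigma> x')"
    "(lrel \<sigma> \<phi>2)\<inverse> \<in> homs (symm_neg A) (left \<sigma> x2) (left \<sigma> x')"
    using homs_converse[OF game_isos(1)] L.lrel_homs 1(3) 2(3) \<phi> by metis+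
  have r: "(rrel \<tau> \<psi>1)\<inverse> \<in> homs (symm_pos C) (right \<tau> y1) (right \<tau> y')"
    "(rrel \<tau> \<psi>2)\<inverse> \<in> homs (symm_pos C) (right \<tau> y2) (right \<tau> y')"
    using homs_converse[OF game_isos(5)] R.rrel_homs 1(4) 2(4) \<psi> by metis+
  have "lrel \<sigma> \<phi>1 O (lrel \<sigma> \<phi>1)\<inverse> = lrel \<sigma> \<phi>2 O (lrel \<sigma> \<phi>2)\<inverse>"
    using iso_comp_converse[OF game_isos(1) 1(3)] iso_comp_converse[OF game_isos(1) 2(3)]
      L.Domain_lrel[OF \<phi>(1)] L.Domain_lrel[OF \<phi>(2)] \<phi>(3,4) by simp
  then have "\<phi>1 = \<phi>2 \<and> \<alpha>1 = \<alpha>2"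
    using L.factor_unique[OF \<phi>(1,2), of "(lrel \<sigma> \<phi>1)\<inverse>" "left \<sigma> x'" "(lrel \<sigma> \<phi>2)\<inverse>" \<alpha>1 "rB XB" \<alpha>2]
      l ab \<phi> 1(5) 2(5) by simp
  moreover have "rrel \<tau> \<psi>1 O (rrel \<tau> \<psi>1)\<inverse> = rrel \<tau> \<psi>2 O (rrel \<tau> \<psi>2)\<inverse>"
    using iso_comp_converse[OF game_isos(5) 1(4)] iso_comp_converse[OF game_isos(5) 2(4)]
      R.Domain_rrel[OF \<psi>(1)] R.Domain_rrel[OF \<psi>(2)] \<psi>(3,4) by simp
  then have "\<psi>1 = \<psi>2 \<and> \<beta>1 = \<beta>2"
    using R.factor_unique[OF \<psi>(1,2), of \<beta>1 "rB XB" \<beta>2 "(rrel \<tau> \<psi>1)\<inverse>" "right \<tau> y'" "(rrel \<tau> \<psi>2)\<inverse>"]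
      r ab \<psi> 1(6) 2(6) by simp
  ultimately show ?thesis using \<phi>(5,6) \<psi>(5,6) q by simp
qed

text \<open>The two configurations synchronize along \<open>\<alpha> O \<beta>\<inverse>\<close>,
  the symmetry from \<open>x\<close> to \<open>y\<close> on \<open>B\<close> that passes through the
  representative.\<close>

lemma matching_exists:
  assumes "((x, \<alpha>), (y, \<beta>)) \<in> polarized_pairs XB"
  shows "\<exists>p\<in>matching_pairs XB. transport ((x, \<alpha>), (y, \<beta>)) p"
proof -
  have m: "x \<in> pos_covered S" "related_by (symm_neg A) (left \<sigma> x) (rA XA)"
    "y \<in> pos_covered T" "related_by (symm_pos C) (right \<tau> y) (rC XC)"
    and ab: "\<alpha> \<in> homs (symm_pos B) (right \<sigma> x) (rB XB)" "\<beta> \<in> homs (symm_neg B) (left \<tau> y) (rB XB)"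
    using assms by (auto simp: polarized_pairs_iff)
  have ab': "\<alpha> \<in> homs (symm B) (right \<sigma> x) (rB XB)" "\<beta> \<in> homs (symm B) (left \<tau> y) (rB XB)"
    using ab tcg_pos_sub[OF L.tcg_right] tcg_neg_sub[OF L.tcg_right] by (auto simp: homs_iff)
  have c: "x \<in> conf S" "y \<in> conf T" using m(1,3) by (auto simp: pos_covered_def)
  have "\<alpha> O \<beta>\<inverse> \<in> homs (symm B) (right \<sigma> x) (left \<tau> y)"
    using homs_comp[OF game_isos(2) ab'(1) homs_converse[OF game_isos(2) ab'(2)]] .
  then obtain \<phi> \<psi> where s: "\<phi> \<in> symm S" "Domain \<phi> = x" "\<psi> \<in> symm T" "Domain \<psi> = y"
    "lrel \<sigma> \<phi> \<in> symm_neg A" "rrel \<tau> \<psi> \<in> symm_pos C" "rrel \<sigma> \<phi> = (\<alpha> O \<beta>\<inverse>) O lrel \<tau> \<psi>"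
    using sync_exists[OF c, of "\<alpha> O \<beta>\<inverse>"] unfolding homs_iff by blast
  \<comment> \<open>The new configuration on \<open>B\<close> reaches the representative by going
    back along \<phi> and then along \<alpha>. By the equation of \<open>sync_exists\<close> the
    route over \<psi> and \<beta> gives the same symmetry.\<close>
  let ?x = "Range \<phi>" and ?y = "Range \<psi>" and ?\<theta> = "(rrel \<sigma> \<phi>)\<inverse> O \<alpha>"
  have hom: "\<phi> \<in> homs (symm S) x ?x" "\<psi> \<in> homs (symm T) y ?y" using s by (auto simp: homs_iff)
  have rB: "rrel \<sigma> \<phi> \<in> homs (symm B) (right \<sigma> x) (right \<sigma> ?x)"
    using L.rrel_homs[OF s(1) L.disp_symm(3)[OF s(1)]] s(2) by simp
  have lB: "lrel \<tau> \<psi> \<in> homs (symm B) (left \<tau> y) (left \<tau> ?y)"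
    using R.lrel_homs[OF s(3) R.disp_symm(2)[OF s(3)]] s(4) by simp
  have "rrel \<sigma> \<phi> \<in> homs (symm B) (right \<sigma> x) (left \<tau> ?y)"
    unfolding s(7) by (rule homs_comp[OF game_isos(2) \<open>\<alpha> O \<beta>\<inverse> \<in> _\<close> lB])
  then have eq: "right \<sigma> ?x = left \<tau> ?y" using rB by (simp add: homs_iff)
  have "related_by (symm_neg A) (left \<sigma> ?x) (rA XA)"
    using related_trans[OF game_isos(1) L.lrel_homs[OF s(1,5)]] s(2) m(2) by simp
  moreover have "related_by (symm_pos C) (right \<tau> ?y) (rC XC)"
    using related_trans[OF game_isos(5) R.rrel_homs[OF s(3,6)]] s(4) m(4) by simp
  moreover have "?\<theta> \<in> homs (symm B) (right \<sigma> ?x) (rB XB)"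
    using homs_comp[OF game_isos(2) homs_converse[OF game_isos(2) rB] ab'(1)] .
  ultimately have "((?x, ?y), ?\<theta>) \<in> matching_pairs XB"
    using pos_covered_homs(1)[OF m(1) hom(1)] pos_covered_homs(2)[OF m(3) hom(2)] eq
    by (simp add: matching_pairs_iff matching_wit_iff)
  moreover have "?\<theta> = (lrel \<tau> \<psi>)\<inverse> O \<beta>"
  proof -
    have "?\<theta> = (lrel \<tau> \<psi>)\<inverse> O ((\<beta> O \<alpha>\<inverse>) O \<alpha>)" by (simp add: s(7) converse_relcomp O_assoc)
    also have "(\<beta> O \<alpha>\<inverse>) O \<alpha> = \<beta>"
      using homs_cancel_right[OF game_isos(2) homs_converse[OF game_isos(2) ab'(1)], of \<beta>] ab'(2) by (simp add: homs_iff)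
    finally show ?thesis .
  qed
  then have "transport ((x, \<alpha>), (y, \<beta>)) ((?x, ?y), ?\<theta>)"
    unfolding transport_def prod.case
    using homs_converse[OF L.iso hom(1)] homs_converse[OF R.iso hom(2)]
      iso_converse[OF game_isos(1) s(5)] iso_converse[OF game_isos(5) s(6)]
    by (intro bexI[of _ "\<phi>\<inverse>"] bexI[of _ "\<psi>\<inverse>"]) (simp_all add: lrel_converse rrel_converse)
  ultimately show ?thesis by blast
qed

text \<open>Two solutions differ by a symmetry of each strategy, and \<open>sync_unique\<close>
  reduces both to identities once they are seen to agree on \<open>B\<close>.\<close>

lemma matching_unique:
  assumes "q \<in> polarized_pairs XB" "p1 \<in> matching_pairs XB" "p2 \<in> matching_pairs XB" "transport q p1" "transport q p2"
  shows "p1 = p2"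
proof -
  obtain x \<alpha> y \<beta> x1 y1 \<theta>1 x2 y2 \<theta>2 where
    q: "q = ((x, \<alpha>), (y, \<beta>))" "p1 = ((x1, y1), \<theta>1)" "p2 = ((x2, y2), \<theta>2)"
    by (metis surj_pair)
  obtain \<phi>1 \<psi>1 where 1: "\<phi>1 \<in> homs (symm S) x1 x" "\<psi>1 \<in> homs (symm T) y1 y"
    "lrel \<sigma> \<phi>1 \<in> symm_neg A" "rrel \<tau> \<psi>1 \<in> symm_pos C" "\<theta>1 = rrel \<sigma> \<phi>1 O \<alpha>" "\<theta>1 = lrel \<tau> \<psi>1 O \<beta>"
    using assms(4) unfolding q transport_def prod.case by blast
  obtain \<phi>2 \<psi>2 where 2: "\<phi>2 \<in> homs (symm S) x2 x" "\<psi>2 \<in> homs (symm T) y2 y"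
    "lrel \<sigma> \<phi>2 \<in> symm_neg A" "rrel \<tau> \<psi>2 \<in> symm_pos C" "\<theta>2 = rrel \<sigma> \<phi>2 O \<alpha>" "\<theta>2 = lrel \<tau> \<psi>2 O \<beta>"
    using assms(5) unfolding q transport_def prod.case by blast
  have \<phi>: "\<phi>1 \<in> symm S" "\<phi>2 \<in> symm S" "Domain \<phi>1 = x1" "Domain \<phi>2 = x2" "Range \<phi>1 = x" "Range \<phi>2 = x"
    and \<psi>: "\<psi>1 \<in> symm T" "\<psi>2 \<in> symm T" "Domain \<psi>1 = y1" "Domain \<psi>2 = y2" "Range \<psi>1 = y" "Range \<psi>2 = y"
    using 1(1,2) 2(1,2) by (auto simp: homs_iff)
  have ab: "\<alpha> \<in> homs (symm_pos B) (right \<sigma> x) (rB XB)" "\<beta> \<in> homs (symm_neg B) (left \<tau> y) (rB XB)"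
    using assms(1) unfolding q polarized_pairs_iff by blast+
  have eq: "right \<sigma> x1 = left \<tau> y1" using assms(2) unfolding q matching_pairs_iff matching_wit_iff by blast
  let ?\<omega> = "\<phi>1 O \<phi>2\<inverse>" and ?\<chi> = "\<psi>1 O \<psi>2\<inverse>"
  have hom: "?\<omega> \<in> homs (symm S) x1 x2" "?\<chi> \<in> homs (symm T) y1 y2"
    using homs_comp[OF L.iso 1(1) homs_converse[OF L.iso 2(1)]]
      homs_comp[OF R.iso 1(2) homs_converse[OF R.iso 2(2)]] by auto
  have rel: "lrel \<sigma> ?\<omega> = lrel \<sigma> \<phi>1 O (lrel \<sigma> \<phi>2)\<inverse>" "rrel \<sigma> ?\<omega> = rrel \<sigma> \<phi>1 O (rrel \<sigma> \<phi>2)\<inverse>"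
    using L.rel_comp[OF \<phi>(1) iso_converse[OF L.iso \<phi>(2)]] \<phi>(5,6) by (simp_all add: lrel_converse rrel_converse)
  have rel': "lrel \<tau> ?\<chi> = lrel \<tau> \<psi>1 O (lrel \<tau> \<psi>2)\<inverse>" "rrel \<tau> ?\<chi> = rrel \<tau> \<psi>1 O (rrel \<tau> \<psi>2)\<inverse>"
    using R.rel_comp[OF \<psi>(1) iso_converse[OF R.iso \<psi>(2)]] \<psi>(5,6) by (simp_all add: lrel_converse rrel_converse)
  have l: "lrel \<sigma> ?\<omega> \<in> symm_neg A"
    unfolding rel using 1(3) 2(3) L.Range_lrel[OF \<phi>(1)] L.Range_lrel[OF \<phi>(2)] \<phi>(5,6)
    by (intro iso_comp[OF game_isos(1)] iso_converse[OF game_isos(1)]) auto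
  have r: "rrel \<tau> ?\<chi> \<in> symm_pos C"
    unfolding rel' using 1(4) 2(4) R.Range_rrel[OF \<psi>(1)] R.Range_rrel[OF \<psi>(2)] \<psi>(5,6)
    by (intro iso_comp[OF game_isos(5)] iso_converse[OF game_isos(5)]) auto
  have "rrel \<sigma> \<phi>1 = \<theta>1 O \<alpha>\<inverse>" "rrel \<sigma> \<phi>2 = \<theta>2 O \<alpha>\<inverse>"
    using homs_cancel_right[OF game_isos(3) ab(1), of "rrel \<sigma> \<phi>1"] homs_cancel_right[OF game_isos(3) ab(1), of "rrel \<sigma> \<phi>2"]
      L.Range_rrel[OF \<phi>(1)] L.Range_rrel[OF \<phi>(2)] \<phi>(5,6) unfolding 1(5) 2(5) by simp_all
  then have "rrel \<sigma> ?\<omega> = (\<theta>1 O \<alpha>\<inverse>) O (\<theta>2 O \<alpha>\<inverse>)\<inverse>" using rel(2) by simp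
  also have "\<dots> = \<theta>1 O ((\<alpha>\<inverse> O \<alpha>) O \<theta>2\<inverse>)" by (simp add: converse_relcomp O_assoc)
  \<comment> \<open>Both \<open>\<alpha>\<inverse> O \<alpha>\<close> and
    \<open>\<beta>\<inverse> O \<beta>\<close> are the identity on the representative; replacing one
    by the other moves the computation from the side of \<sigma> to that of \<tau>.\<close>
  also have "\<alpha>\<inverse> O \<alpha> = Id_on (rB XB)" using iso_converse_comp[OF game_isos(3)] ab(1) by (auto simp: homs_iff)
  also have "Id_on (rB XB) = \<beta>\<inverse> O \<beta>" using iso_converse_comp[OF game_isos(4)] ab(2) by (auto simp: homs_iff)
  also have "\<theta>1 O ((\<beta>\<inverse> O \<beta>) O \<theta>2\<inverse>) = (\<theta>1 O \<beta>\<inverse>) O (\<theta>2 O \<beta>\<inverse>)\<inverse>" by (simp add: converse_relcomp O_assoc)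
  also have "\<theta>1 O \<beta>\<inverse> = lrel \<tau> \<psi>1"
    using homs_cancel_right[OF game_isos(4) ab(2), of "lrel \<tau> \<psi>1"] R.Range_lrel[OF \<psi>(1)] \<psi>(5)
    unfolding 1(6) by simp
  also have "\<theta>2 O \<beta>\<inverse> = lrel \<tau> \<psi>2"
    using homs_cancel_right[OF game_isos(4) ab(2), of "lrel \<tau> \<psi>2"] R.Range_lrel[OF \<psi>(2)] \<psi>(6)
    unfolding 2(6) by simp
  finally have "rrel \<sigma> ?\<omega> = lrel \<tau> ?\<chi>" using rel'(1) by simp
  then have id: "?\<omega> = Id_on x1" "?\<chi> = Id_on y1"
    using sync_unique[of ?\<omega> ?\<chi>] hom l r eq unfolding homs_iff by metis+
  then have x: "x1 = x2" "y1 = y2" using hom unfolding homs_iff by (metis Range_Id_on)+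
  have "\<phi>1 = \<phi>2"
  proof -
    have "\<phi>1 = ?\<omega> O \<phi>2"
      using homs_cancel_right[OF L.iso homs_converse[OF L.iso 2(1)], of \<phi>1] \<phi>(5) by simp
    then show ?thesis using id(1) x \<phi>(4) by auto
  qed
  then show ?thesis using x 1(5) 2(5) q by simp
qed

section \<open>Cancellation of the group orders and the sum over classes\<close>

lemma ecard_polarized_matching: "ecard (polarized_pairs XB) = ecard (matching_pairs XB)"
proof (rule ecard_eqI_rel[where R = transport])
  show "\<exists>!p. p \<in> matching_pairs XB \<and> transport q p" if "q \<in> polarized_pairs XB" for q
    using that matching_exists matching_unique by (metis surj_pair)
  show "\<exists>!q. q \<in> polarized_pairs XB \<and> transport q p" if "p \<in> matching_pairs XB" for p
    using that polarized_exists polarized_unique by (metis surj_pair)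
qed

lemma coll_product:
  assumes "canonical B (rB XB)"
  shows "ecard {(x, y) \<in> matching_wit. related_by (symm B) (right \<sigma> x) (rB XB)} =
    coll A B rA rB \<sigma> XA XB * coll B C rB rC \<tau> XB XC"
proof -
  let ?b = "rB XB" and ?M = "{(x, y) \<in> matching_wit. related_by (symm B) (right \<sigma> x) (rB XB)}"
  let ?K = "homs (symm B) ?b ?b"
  have b: "?b \<in> conf B" using assms by (simp add: canonical_def)
  have fin: "finite ?K"
  proof (rule finite_subset)
    show "?K \<subseteq> Pow (?b \<times> ?b)"
    proof
      fix \<theta> assume "\<theta> \<in> ?K"
      moreover have "\<theta> \<subseteq> Domain \<theta> \<times> Range \<theta>" by auto
      ultimately show "\<theta> \<in> Pow (?b \<times> ?b)" by (simp add: homs_iff)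
    qed
    show "finite (Pow (?b \<times> ?b))" using conf_finite[OF tcg_es[OF L.tcg_right] b] by simp
  qed
  have "Id_on ?b \<in> ?K" using iso_Id_on[OF game_isos(2) b] by (auto simp: homs_iff)
  then have ne: "?K \<noteq> {}" by blast
  have "ecard (polarized_pairs XB) =
      (coll A B rA rB \<sigma> XA XB * ecard (homs (symm_pos B) ?b ?b)) * (coll B C rB rC \<tau> XB XC * ecard (homs (symm_neg B) ?b ?b))"
    unfolding polarized_pairs_def ecard_times coll_def
  proof (intro arg_cong2[where f = "(*)"] ecard_Sigma)
    show "\<exists>h. bij_betw h (homs (symm_pos B) (right \<sigma> x) ?b) (homs (symm_pos B) ?b ?b)"
      if "x \<in> pos_wit A B rA rB \<sigma> XA XB" for x
      using that by (intro homs_endo_bij[OF game_isos(3)]) (simp add: pos_wit_def)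
    show "\<exists>h. bij_betw h (homs (symm_neg B) (left \<tau> y) ?b) (homs (symm_neg B) ?b ?b)"
      if "y \<in> pos_wit B C rB rC \<tau> XB XC" for y
      using that by (intro homs_endo_bij[OF game_isos(4)]) (simp add: pos_wit_def)
  qed
  moreover have "ecard (matching_pairs XB) = ecard ?M * ecard ?K"
    unfolding matching_pairs_def
    by (intro ecard_Sigma homs_endo_bij[OF game_isos(2)]) auto
  ultimately have "ecard ?M * ecard ?K = (coll A B rA rB \<sigma> XA XB * coll B C rB rC \<tau> XB XC) * ecard ?K"
    using ecard_polarized_matching canonical_homs[OF L.tcg_right assms] by (simp add: ac_simps)
  then show ?thesis by (rule ecard_mult_cancel[OF fin ne])
qed

text \<open>Matching witnesses are sorted by the symmetry class of their common configuration on
  \<open>B\<close>, and each fibre is the set counted by \<open>coll_product\<close>.\<close>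

lemma coll_comp_strat_sum:
  assumes "canonical_choice B rB"
  shows "coll A C rA rC (comp_strat A C \<tau> \<sigma>) XA XC =
    (\<Sum>\<^sub>\<infinity>XB\<in>symm_classes B. coll A B rA rB \<sigma> XA XB * coll B C rB rC \<tau> XB XC)"
proof -
  let ?R = "{(x, y). related_by (symm B) x y}"
  let ?c = "\<lambda>(x, y). ?R `` {right \<sigma> x}"
  have eqv: "equiv (conf B) ?R" by (rule related_by_equiv[OF game_isos(2)])
  have c: "right \<sigma> x \<in> conf B" if "(x, y) \<in> matching_wit" for x y
    using that by (intro L.right_conf) (simp add: matching_wit_iff pos_covered_def)
  have "?c ` matching_wit \<subseteq> symm_classes B"
  proof
    fix X assume "X \<in> ?c ` matching_wit"
    then obtain p where p: "X = ?c p" "p \<in> matching_wit" by (rule imageE)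
    moreover obtain x y where "p = (x, y)" by fastforce
    ultimately show "X \<in> symm_classes B"
      using quotientI[OF c[of x y], of ?R] by (simp add: symm_classes_def)
  qed
  then have "ecard matching_wit = (\<Sum>\<^sub>\<infinity>XB\<in>symm_classes B. ecard {p \<in> matching_wit. ?c p = XB})"
    by (rule ecard_partition)
  also have "\<dots> = (\<Sum>\<^sub>\<infinity>XB\<in>symm_classes B. coll A B rA rB \<sigma> XA XB * coll B C rB rC \<tau> XB XC)"
  proof (rule infsum_cong)
    fix XB assume XB: "XB \<in> symm_classes B"
    then have b: "rB XB \<in> XB" "canonical B (rB XB)" using assms by (auto simp: canonical_choice_def)
    have bc: "rB XB \<in> conf B" using b(2) by (simp add: canonical_def)
    obtain z where z: "XB = ?R `` {z}"
      using XB unfolding symm_classes_def by (rule quotientE)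
    then have "(z, rB XB) \<in> ?R" using b(1) by simp
    then have "XB = ?R `` {rB XB}" unfolding z by (rule equiv_class_eq[OF eqv])
    \<comment> \<open>A class contains its representative, so belonging to it amounts to being
      related to that representative.\<close>
    then have cls: "?R `` {z} = XB \<longleftrightarrow> related_by (symm B) z (rB XB)" if "z \<in> conf B" for z
      using eq_equiv_class_iff[OF eqv that bc] by simp
    have "{p \<in> matching_wit. ?c p = XB} = {(x, y) \<in> matching_wit. related_by (symm B) (right \<sigma> x) (rB XB)}"
      using cls[OF c] by auto
    then show "ecard {p \<in> matching_wit. ?c p = XB} = coll A B rA rB \<sigma> XA XB * coll B C rB rC \<tau> XB XC"
      using coll_product[OF b(2)] by simp
  qed
  finally show ?thesis by (simp add: coll_comp_strat)
qed

end

end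

theorem mainTheorem1:
  fixes A :: "'a tcg" and B :: "'b tcg" and C :: "'c tcg"
    and \<sigma> :: "('s, 'a + 'b) strat" and \<tau> :: "('t, 'b + 'c) strat"
    and rA :: "'a set set \<Rightarrow> 'a set" and rB :: "'b set set \<Rightarrow> 'b set" and rC :: "'c set set \<Rightarrow> 'c set"
  assumes "thin_concurrent_game A" and "thin_concurrent_game B" and "thin_concurrent_game C"
    and "representable A" and "representable B" and "representable C"
    and "canonical_choice A rA" and "canonical_choice B rB" and "canonical_choice C rC"
    and "sim_strategy A B \<sigma>" and "sim_strategy B C \<tau>"
    and "no_deadlock A B C \<sigma> \<tau>"
    and "XA \<in> symm_classes A" and "XC \<in> symm_classes C"
  shows "coll A C rA rC (comp_strat A C \<tau> \<sigma>) XA XC =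
    (\<Sum>\<^sub>\<infinity>XB\<in>symm_classes B. coll A B rA rB \<sigma> XA XB * coll B C rB rC \<tau> XB XC)"
proof -
  interpret composition A B C \<sigma> \<tau>
    using assms by unfold_locales
  show ?thesis using assms(8) by (rule coll_comp_strat_sum)
qed

end
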